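(* Let $\nu\ge\frac12$ be real, let $0<j_{\nu,1}<j_{\nu,2}<\cdots$ be the positive zeros of the Bessel function $J_\nu$ and put $j_{\nu,-k}=-j_{\nu,k}$ for $k\ge1$. Let $n\ge1$ and let $z_1,\dots,z_n\in\mathbb{C}$ be such that $z_j\ne j_{\nu,k}/\pi$ for all $j$ and all integers $k\neq0$. Then $$ \begin{aligned} \mathrm{RP}_{k\neq0}\Big[\prod_{j=1}^{n}\Big(\frac{j_{\nu,k}}{\pi}-z_j\Big)\Big]&=\prod_{j=1}^{n}\mathrm{RP}_{k\ne0}\Big[\frac{j_{\nu,k}}{\pi}-z_j\Big]\\ &=\prod_{j=1}^{n}\frac{\sqrt2\,\pi}{z_j^{\nu}}J_\nu(\pi z_j)\exp\Big(-\frac{\pi i}{2}\Big(\nu+\frac12\Big)-z_j\,\mathrm{FP}\,\zeta^*_{J_\nu}(1)\Big), \end{aligned} $$ where $\mathrm{RP}_{k\ne0}$ denotes the zeta regularized product over all nonzero integers $k$.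
   Context: $J_\nu(z)=\sum_{n\ge0}\frac{(-1)^n}{n!\,\Gamma(n+\nu+1)}\left(\frac z2\right)^{2n+\nu}$; the expression $z^{-\nu}J_\nu(\pi z)$ is understood as the entire function $\sum_{n\ge0}\frac{(-1)^n}{n!\,\Gamma(n+\nu+1)}\left(\frac{\pi}{2}\right)^{2n+\nu}z^{2n}$. Bessel zeta function: $\zeta_{J_\nu}(s)=\sum_{k\ge1}(j_{\nu,k}/\pi)^{-s}$ for $\mathrm{Re}(s)>1$, continued meromorphically, and $\zeta^*_{J_\nu}(s)=(1+e^{-\pi is})\zeta_{J_\nu}(s)$ is the zeta function of the sequence $\{j_{\nu,k}/\pi\}_{k\neq0}$. $\mathrm{FP}\,\zeta^*_{J_\nu}(1)$ is the constant term of the Laurent expansion of $\zeta^*_{J_\nu}$ at $s=1$. Zeta regularized product: for a sequence $\{a_k\}$ of nonzero numbers whose zeta function $\sum_k a_k^{-s}$ converges absolutely in a right half-plane and continues meromorphically to a region containing $s=0$, holomorphically at $s=0$, its zeta regularized product is $\mathrm{RP}_k[a_k]=\exp\left(-\frac{d}{ds}\big|_{s=0}\sum_k a_k^{-s}\right)$. For $a_k=\prod_{j=1}^n(\lambda_k-z_j)$, with $\lambda_k=j_{\nu,k}/\pi$, the power is $a_k^{-s}=\prod_{j=1}^n(\lambda_k-z_j)^{-s}$. Branch convention: for $k\ge1$, $\log\lambda_k$ is real and $\log\lambda_{-k}=\log\lambda_k+\pi i$; and $(\lambda_k-z_j)^{-s}=e^{-s\log(\lambda_k-z_j)}$ with $\log(\lambda_k-z_j)=\log\lambda_k+\mathrm{Log}(1-z_j/\lambda_k)$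 (principal $\mathrm{Log}$) whenever $|\lambda_k|>|z_j|$, any branch being allowed for the finitely many other $k$. *)

theory Defs
  imports "HOL-Complex_Analysis.Complex_Analysis"
begin

subsection \<open>Zeta regularized products\<close>

text \<open>
  A family of nonzero numbers is given together with logarithms l k of its members, which fix
  the powers: the (-s)-th power of the k-th member is exp (- s * l k).

  Z is a meromorphic continuation to D of the zeta function of the family. The region D is
  required to contain, with each of its points, the horizontal ray to the right of that point
  (so D is connected, as it contains a right half-plane). The intersection of two such regions
  is again such a region, hence two continuations agree wherever both are defined.
\<close>
definition zeta_continuation ::
    "'i set \<Rightarrow> ('i \<Rightarrow> complex) \<Rightarrow> complex set \<Rightarrow> (complex \<Rightarrow> complex) \<Rightarrow> bool" where
  "zeta_continuation I l D Z \<longleftrightarrow>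
     open D \<and> (\<forall>s\<in>D. \<forall>t\<ge>0. s + complex_of_real t \<in> D) \<and>
     Z nicely_meromorphic_on D \<and>
     (\<exists>\<sigma>::real. \<forall>s. Re s > \<sigma> \<longrightarrow>
        s \<in> D \<and>
        (\<lambda>k. norm (exp (- s * l k))) summable_on I \<and>
        Z s = (\<Sum>\<^sub>\<infinity>k\<in>I. exp (- s * l k)))"

text \<open>The value at a pole is 0, the convention of \<^const>\<open>nicely_meromorphic_on\<close>.\<close>
definition zeta_fun :: "'i set \<Rightarrow> ('i \<Rightarrow> complex) \<Rightarrow> complex \<Rightarrow> complex" where
  "zeta_fun I l s = (THE v. \<exists>D Z. zeta_continuation I l D Z \<and> s \<in> D \<and> v = Z s)"

definition zeta_regularizable ::
    "'i set \<Rightarrow> ('i \<Rightarrow> complex) \<Rightarrow> ('i \<Rightarrow> complex) \<Rightarrow> bool" where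
  "zeta_regularizable I a l \<longleftrightarrow>
     (\<forall>k\<in>I. exp (l k) = a k) \<and>
     (\<exists>D Z. zeta_continuation I l D Z \<and> 0 \<in> D \<and> Z analytic_on {0})"

text \<open>Only meaningful for regularizable families; the value depends on the logarithms l alone.\<close>
definition zeta_reg_prod :: "'i set \<Rightarrow> ('i \<Rightarrow> complex) \<Rightarrow> complex" where
  "zeta_reg_prod I l = exp (- deriv (zeta_fun I l) 0)"

definition finite_part :: "(complex \<Rightarrow> complex) \<Rightarrow> complex \<Rightarrow> complex" where
  "finite_part f a = fls_nth (laurent_expansion f a) 0"


subsection \<open>Bessel functions and their zeros\<close>

definition bessel_J :: "real \<Rightarrow> complex \<Rightarrow> complex" where
  "bessel_J \<nu> z =
     (\<Sum>n. (-1) ^ n / (fact n * Gamma (of_nat n + of_real \<nu> + 1))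
            * (z / 2) powr (2 * of_nat n + of_real \<nu>))"

text \<open>The entire function denoted \<open>z\<close> to the power \<open>-\<nu>\<close> times \<open>J\<^sub>\<nu>(\<pi> z)\<close>.\<close>
definition bessel_J_entire :: "real \<Rightarrow> complex \<Rightarrow> complex" where
  "bessel_J_entire \<nu> z =
     (\<Sum>n. (-1) ^ n / (fact n * Gamma (of_nat n + of_real \<nu> + 1))
            * of_real (pi / 2) powr (2 * of_nat n + of_real \<nu>) * z ^ (2 * n))"

text \<open>The positive zeros in increasing order, indexed from 1; the value at index 0 is only the
  starting point of the recursion.\<close>
primrec bessel_zero_nat :: "real \<Rightarrow> nat \<Rightarrow> real" where
  "bessel_zero_nat \<nu> 0 = 0"
| "bessel_zero_nat \<nu> (Suc k) =
     (LEAST x::real. x > bessel_zero_nat \<nu> k \<and> bessel_J \<nu> (of_real x) = 0)"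

definition bessel_zero :: "real \<Rightarrow> int \<Rightarrow> real" where
  "bessel_zero \<nu> k =
     (if k \<ge> 0 then bessel_zero_nat \<nu> (nat k) else - bessel_zero_nat \<nu> (nat (- k)))"

definition bessel_lam :: "real \<Rightarrow> int \<Rightarrow> real" where
  "bessel_lam \<nu> k = bessel_zero \<nu> k / pi"

definition bessel_log :: "real \<Rightarrow> int \<Rightarrow> complex" where
  "bessel_log \<nu> k =
     (if k > 0 then of_real (ln (bessel_lam \<nu> k))
      else of_real (ln (bessel_lam \<nu> (- k))) + of_real pi * \<i>)"

definition bessel_zeta :: "real \<Rightarrow> complex \<Rightarrow> complex" where
  "bessel_zeta \<nu> = zeta_fun {1..} (bessel_log \<nu>)"

definition bessel_zeta_star :: "real \<Rightarrow> complex \<Rightarrow> complex" where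
  "bessel_zeta_star \<nu> s = (1 + exp (- of_real pi * \<i> * s)) * bessel_zeta \<nu> s"

text \<open>An admissible choice of \<open>log (\<lambda>\<^sub>k - z)\<close> for all nonzero k.\<close>
definition bessel_shift_log :: "real \<Rightarrow> complex \<Rightarrow> (int \<Rightarrow> complex) \<Rightarrow> bool" where
  "bessel_shift_log \<nu> z l \<longleftrightarrow>
     (\<forall>k. k \<noteq> 0 \<longrightarrow>
        exp (l k) = of_real (bessel_lam \<nu> k) - z \<and>
        (norm z < \<bar>bessel_lam \<nu> k\<bar> \<longrightarrow>
           l k = bessel_log \<nu> k + Ln (1 - z / of_real (bessel_lam \<nu> k))))"

end

theory Submission
  imports Defs "HOL-Real_Asymp.Real_Asymp"
begin

text \<open>
  By Sturm comparison the gaps of the scaled zeros \<open>\<lambda>\<^sub>k\<close> lie between \<open>1\<close> and \<open>1 + O(k\<^sup>-\<^sup>2)\<close>, so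
  \<open>\<lambda>\<^sub>k = k + c + O(1/k)\<close> for some constant. This suffices to continue \<open>\<zeta>(s) = \<Sum> \<lambda>\<^sub>k\<^sup>-\<^sup>s\<close> to
  \<open>Re s > -1\<close> by the midpoint rule, with residue 1 at 1, and the same midpoint sums show
  \<open>\<Sum> ln (1 + y\<^sup>2/\<lambda>\<^sub>k\<^sup>2) = \<pi> y + 2 \<zeta>(0) ln y + 2 \<zeta>'(0) + o(1)\<close>. By Lommel's argument and
  Hadamard's theorem the left-hand side is the logarithm of \<open>E(iy)/E(0)\<close>, with \<open>E(z)\<close> the entire
  function \<open>z\<^sup>-\<^sup>\<nu> J\<^sub>\<nu>(\<pi> z)\<close>; comparison with the growth of the modified Bessel function yields
  \<open>\<zeta>(0)\<close> and \<open>\<zeta>'(0)\<close> without knowing \<open>c\<close> in advance. The factor \<open>1 + exp (-\<pi> i s)\<close> cancels the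
  pole of \<open>\<zeta>\<close>, which gives the finite part \<open>\<pi> i\<close> at 1. The shifts by \<open>z\<^sub>j\<close> are treated by
  expanding the summands to first order in \<open>1/\<lambda>\<^sub>k\<close>. Multiplicativity holds because the only
  correction, the value of \<open>\<zeta>\<^sup>*\<close> next to 1, enters linearly in the \<open>z\<^sub>j\<close>.
\<close>

text \<open>The obstacle is that the Bessel function oscillates on the real axis: an explicit
  expansion of its zeros would need precise asymptotics there. The proof uses none. Sturm comparison
  gives only the existence of the shift c; the numerical constants come from the imaginary axis,
  where all terms of the power series are positive and Laplace's method is one application of
  dominated convergence. The two unknowns separate because ln y is unbounded: its coefficients must
  agree first, and then the constants can be compared. The bound \<nu> \<ge> 1/2 makes \<nu>^2 - 1/4
  nonnegative, so that the Sturm potential 1 - (\<nu>^2 - 1/4)/x^2 is nondecreasing and at most 1,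
  and it makes the exponent \<nu> - 1/2 of Poisson's weight nonnegative. In the variable w = (pi
  z/2)^2 the entire function has order 1/2, so its product over the zeros carries no exponential
  factor that would have to be determined.\<close>

declare bessel_zero_nat.simps(2) [simp del]

subsection \<open>Uniqueness of the continuation\<close>

text \<open>The value of a nicely meromorphic function is its limit at a regular point and 0 at a
  pole. Both are determined by the punctured neighbourhood.\<close>

lemma nicely_meromorphic_eq_if_eventually_eq:
  assumes f: "f nicely_meromorphic_on {s}" and g: "g nicely_meromorphic_on {s}"
    and ev: "eventually (\<lambda>w. f w = g w) (at s)"
  shows "f s = g s"
proof -
  have c: "is_pole f s \<longleftrightarrow> is_pole g s" "\<And>c. (f \<longlongrightarrow> c) (at s) \<longleftrightarrow> (g \<longlongrightarrow> c) (at s)"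
    using ev by (auto intro!: is_pole_cong tendsto_cong)
  have f1: "(is_pole f s \<and> f s = 0) \<or> f \<midarrow>s\<rightarrow> f s" and g1: "(is_pole g s \<and> g s = 0) \<or> g \<midarrow>s\<rightarrow> g s"
    using f g by (auto simp: nicely_meromorphic_on_def)
  have np: "\<not> (h \<longlongrightarrow> c) (at s)" if "is_pole h s" for h :: "complex \<Rightarrow> complex" and c
    using that not_tendsto_and_filterlim_at_infinity[of "at s" h c] by (auto simp: is_pole_def)
  show ?thesis
  proof (cases "is_pole f s")
    case True
    then show ?thesis using f1 g1 c np by metis
  next
    case False
    then have "f \<midarrow>s\<rightarrow> f s" "f \<midarrow>s\<rightarrow> g s" using f1 g1 c by auto
    then show ?thesis by (rule tendsto_unique[rotated]) simp
  qed
qed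

text \<open>The identity theorem on the intersection of the domains needs this set to be connected:
  each of its points reaches the common half-plane along a horizontal ray that stays inside.\<close>

lemma zeta_continuation_unique:
  assumes 1: "zeta_continuation I l D1 Z1" and 2: "zeta_continuation I l D2 Z2"
    and s: "s \<in> D1" "s \<in> D2"
  shows "Z1 s = Z2 s"
proof -
  obtain \<sigma>1 where \<sigma>1: "\<And>s. Re s > \<sigma>1 \<Longrightarrow> s \<in> D1 \<and> Z1 s = (\<Sum>\<^sub>\<infinity>k\<in>I. exp (- s * l k))"
    using 1 unfolding zeta_continuation_def by blast
  obtain \<sigma>2 where \<sigma>2: "\<And>s. Re s > \<sigma>2 \<Longrightarrow> s \<in> D2 \<and> Z2 s = (\<Sum>\<^sub>\<infinity>k\<in>I. exp (- s * l k))"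
    using 2 unfolding zeta_continuation_def by blast
  define \<sigma> where "\<sigma> = max \<sigma>1 \<sigma>2"
  define A where "A = D1 \<inter> D2"
  define H where "H = {w. Re w > \<sigma>}"
  have H: "w \<in> A \<and> Z1 w = Z2 w" if "w \<in> H" for w
    using \<sigma>1[of w] \<sigma>2[of w] that by (auto simp: H_def A_def \<sigma>_def)
  have ray: "w + of_real t \<in> A" if "w \<in> A" "t \<ge> 0" for w t
    using 1 2 that unfolding zeta_continuation_def A_def by blast
  have op: "open A" and m1: "Z1 nicely_meromorphic_on A" and m2: "Z2 nicely_meromorphic_on A"
    using 1 2 unfolding zeta_continuation_def A_def by (auto intro: nicely_meromorphic_on_subset)
  have opH: "open H" unfolding H_def by (rule open_halfspace_Re_gt)
  define R where "R w = (\<lambda>t. w + complex_of_real t) ` {0..} \<union> H" for w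
  have conR: "connected (R w)" for w
    unfolding R_def
  proof (rule connected_Un)
    show "connected ((\<lambda>t. w + complex_of_real t) ` {0..})"
      by (intro connected_continuous_image continuous_intros) auto
    show "connected H" unfolding H_def by (intro convex_connected convex_halfspace_Re_gt)
    define t where "t = max 0 (\<sigma> - Re w + 1)"
    have "w + of_real t \<in> H" by (auto simp: H_def t_def)
    moreover have "w + of_real t \<in> (\<lambda>t. w + complex_of_real t) ` {0..}" by (auto simp: t_def)
    ultimately show "(\<lambda>t. w + complex_of_real t) ` {0..} \<inter> H \<noteq> {}" by blast
  qed
  have "R w \<subseteq> A" if "w \<in> A" for w using ray[OF that] H by (auto simp: R_def)
  moreover have "w \<in> R w" for w by (auto simp: R_def image_iff intro!: bexI[of _ 0])
  ultimately have "A = (\<Union>w\<in>A. R w)" by blast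
  moreover have "connected (\<Union>w\<in>A. R w)"
  proof (rule connected_Union)
    have "complex_of_real (\<sigma> + 1) \<in> \<Inter> (R ` A)" by (auto simp: R_def H_def)
    then show "\<Inter> (R ` A) \<noteq> {}" by blast
  qed (use conR in auto)
  ultimately have con: "connected A" by simp
  define f where "f = (\<lambda>w. Z1 w - Z2 w)"
  have mf: "f meromorphic_on A"
    unfolding f_def using m1 m2 by (intro meromorphic_intros) (auto simp: nicely_meromorphic_on_def)
  define p where "p = complex_of_real (\<sigma> + 1)"
  have p: "p \<in> H" by (simp add: p_def H_def)
  have evH: "eventually (\<lambda>w. w \<in> H) (nhds w)" if "w \<in> H" for w
    using that opH by (rule eventually_nhds_in_open[rotated])
  \<comment> \<open>The identity theorem is applied to \<open>remove_sings f\<close>, as the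
    difference \<open>f\<close> itself may have a wrong value at a point where two poles
    cancel.\<close>
  have z: "remove_sings f w = 0" if "w \<in> H" for w
  proof -
    have "eventually (\<lambda>w. f w = 0) (at w)"
      using evH[OF that] unfolding eventually_at_filter
      by eventually_elim (use H in \<open>auto simp: f_def\<close>)
    then show ?thesis by (intro remove_sings_eqI) (rule tendsto_eventually)
  qed
  have "eventually (\<lambda>w. remove_sings f w = 0) (at p)"
    using evH[OF p] unfolding eventually_at_filter by eventually_elim (use z in auto)
  then have fr: "frequently (\<lambda>w. remove_sings f w = 0) (at p)"
    by (simp add: eventually_frequently)
  have all: "remove_sings f w = 0" if "w \<in> A" for w
    using frequently_eq_meromorphic_imp_constant[OF fr remove_sings_nicely_meromorphic[OF mf] op con]
      H[OF p] that by blast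
  have sA: "s \<in> A" using s by (simp add: A_def)
  have "isolated_singularity_at f s"
    using mf sA by (metis meromorphic_on_isolated_singularity meromorphic_on_meromorphic_at)
  then have "eventually (\<lambda>w. remove_sings f w = f w) (at s)"
    by (rule eventually_remove_sings_eq_at)
  moreover have "eventually (\<lambda>w. w \<in> A) (at s)"
    using op sA by (rule eventually_at_in_open')
  ultimately have "eventually (\<lambda>w. Z1 w = Z2 w) (at s)"
    by eventually_elim (use all in \<open>auto simp: f_def\<close>)
  then show ?thesis
    using nicely_meromorphic_on_subset[OF m1] nicely_meromorphic_on_subset[OF m2] sA
    by (intro nicely_meromorphic_eq_if_eventually_eq) auto
qed

lemma zeta_fun_eq:
  assumes "zeta_continuation I l D Z" "s \<in> D"
  shows "zeta_fun I l s = Z s"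
  unfolding zeta_fun_def
  by (rule the_equality) (use assms zeta_continuation_unique in blast)+

lemma zeta_reg_prod_eq:
  assumes "zeta_continuation I l D Z" "0 \<in> D"
  shows "zeta_reg_prod I l = exp (- deriv Z 0)"
proof -
  have "open D" using assms by (simp add: zeta_continuation_def)
  then have "eventually (\<lambda>s. s \<in> D) (nhds 0)" using assms(2) by (rule eventually_nhds_in_open)
  then have "eventually (\<lambda>s. zeta_fun I l s = Z s) (nhds 0)"
    by eventually_elim (rule zeta_fun_eq[OF assms(1)])
  then have "deriv (zeta_fun I l) 0 = deriv Z 0" by (rule deriv_cong_ev) simp
  then show ?thesis by (simp add: zeta_reg_prod_def)
qed

subsection \<open>Hadamard products of genus zero\<close>

text \<open>The map u / (2M - u) sends the half-plane Re u < M into the unit disc and fixes 0, so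
  Schwarz's lemma applies after rescaling. Solving the resulting inequality for
  \<open>norm (g w)\<close> gives the bound.\<close>

lemma Borel_Caratheodory:
  assumes hol: "g holomorphic_on ball 0 R" and g0: "g 0 = 0"
    and M: "\<And>w. norm w < R \<Longrightarrow> Re (g w) < M" and w: "norm w < R"
  shows "norm (g w) \<le> 2 * M * norm w / (R - norm w)"
proof -
  have R: "R > 0" using w norm_ge_zero[of w] by linarith
  have M0: "M > 0" using M[of 0] R g0 by simp
  define h where "h z = g (of_real R * z) / (2 * of_real M - g (of_real R * z))" for z
  have inR: "norm (of_real R * z) < R" if "norm z < 1" for z :: complex
    using that R by (simp add: norm_mult)
  have ne: "2 * of_real M - g (of_real R * z) \<noteq> 0" if "norm z < 1" for z
  proof
    assume "2 * of_real M - g (of_real R * z) = 0"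
    then have "Re (g (of_real R * z)) = 2 * M" by (simp add: complex_eq_iff)
    then show False using M[OF inR[OF that]] M0 by simp
  qed
  have "(g \<circ> (\<lambda>z. of_real R * z)) holomorphic_on ball 0 1"
    by (rule holomorphic_on_compose_gen[OF _ hol]) (use inR in \<open>auto intro!: holomorphic_intros\<close>)
  then have "(\<lambda>z. g (of_real R * z)) holomorphic_on ball 0 1" by (simp add: o_def)
  then have hh: "h holomorphic_on ball 0 1"
    unfolding h_def using ne by (intro holomorphic_intros) auto
  have h1: "norm (h z) < 1" if "norm z < 1" for z
  proof -
    define u where "u = g (of_real R * z)"
    have "Re u < M" using M[OF inR[OF that]] by (simp add: u_def)
    then have "4 * M * Re u < 4 * M * M" using M0 by simp
    moreover have "(norm (2 * of_real M - u))\<^sup>2 = (norm u)\<^sup>2 + 4 * M * M - 4 * M * Re u"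
      unfolding cmod_power2 by (simp add: power2_eq_square algebra_simps)
    ultimately have "(norm u)\<^sup>2 < (norm (2 * of_real M - u))\<^sup>2" by linarith
    then have "norm u < norm (2 * of_real M - u)"
      by (simp add: power_less_imp_less_base)
    then show ?thesis using ne[OF that]
      by (simp add: h_def norm_divide u_def[symmetric] divide_less_eq)
  qed
  have h0: "h 0 = 0" by (simp add: h_def g0)
  define \<xi> where "\<xi> = w / of_real R"
  have \<xi>: "norm \<xi> < 1" using w R by (simp add: \<xi>_def norm_divide)
  have "norm (h \<xi>) \<le> norm \<xi>" by (rule Schwarz_Lemma(1)[OF hh h0 h1 \<xi>])
  moreover have "of_real R * \<xi> = w" using R by (simp add: \<xi>_def)
  ultimately have "norm (g w) \<le> norm \<xi> * norm (2 * of_real M - g w)"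
    using ne[OF \<xi>] by (simp add: h_def norm_divide divide_le_eq)
  also have "norm (2 * of_real M - g w) \<le> 2 * M + norm (g w)"
    using norm_triangle_ineq4[of "2 * of_real M" "g w"] M0 by (simp add: norm_mult)
  finally have "norm (g w) \<le> norm \<xi> * (2 * M + norm (g w))"
    by (simp add: mult_left_mono)
  moreover have "norm \<xi> = norm w / R" using R by (simp add: \<xi>_def norm_divide)
  ultimately show ?thesis using R w by (simp add: field_simps)
qed

text \<open>The points are distinct, so the product already divided out does not vanish at
  \<open>a N\<close>; hence the quotient does, and one more linear factor comes out. One factor is
  removed at each point, whatever its multiplicity.\<close>

lemma divide_out_simple_zeros:
  fixes a :: "nat \<Rightarrow> real"
  assumes hol: "F holomorphic_on UNIV" and zeros: "\<And>k. F (of_real (a k)) = 0"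
    and a0: "\<And>k. a k \<noteq> 0" and inj: "inj a"
  shows "\<exists>Q. Q holomorphic_on UNIV \<and> (\<forall>w. F w = Q w * (\<Prod>k<N. 1 - w / of_real (a k)))"
proof (induction N)
  case 0
  then show ?case using hol by (intro exI[of _ F]) auto
next
  case (Suc N)
  then obtain Q where Q: "Q holomorphic_on UNIV" "\<And>w. F w = Q w * (\<Prod>k<N. 1 - w / of_real (a k))"
    by blast
  have nz: "(\<Prod>k<N. 1 - complex_of_real (a N) / of_real (a k)) \<noteq> 0"
  proof -
    have "1 - complex_of_real (a N) / of_real (a k) \<noteq> 0" if "k < N" for k
    proof -
      have "a N \<noteq> a k" using inj that by (metis injD less_irrefl)
      then show ?thesis using a0[of k] by simp
    qed
    then show ?thesis by simp
  qed
  have QN: "Q (of_real (a N)) = 0"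
    using Q(2)[of "of_real (a N)"] zeros[of N] nz by (metis mult_eq_0_iff)
  define R where "R z = (if z = of_real (a N) then deriv Q (of_real (a N))
     else (Q z - Q (of_real (a N))) / (z - of_real (a N)))" for z
  have R: "R holomorphic_on UNIV"
    unfolding R_def using pole_lemma_open[OF Q(1) open_UNIV] by simp
  have QR: "Q z = (z - of_real (a N)) * R z" for z
    by (auto simp: R_def QN)
  show ?case
  proof (intro exI[of _ "\<lambda>z. - of_real (a N) * R z"] conjI allI)
    show "(\<lambda>z. - of_real (a N) * R z) holomorphic_on UNIV"
      using R by (intro holomorphic_intros)
    show "F w = - of_real (a N) * R w * (\<Prod>k<Suc N. 1 - w / of_real (a k))" for w
      using a0[of N] by (simp add: Q(2) QR field_simps)
  qed
qed

text \<open>Dividing out the first \<open>N\<close> zeros does not increase \<open>F\<close> on the circle of radius \<open>2 a\<^sub>N\<close>. On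
  the disc of radius \<open>a\<^sub>N\<close> the quotient is therefore the exponential of a function whose real part
  is at most \<open>M(2 a\<^sub>N) = o(a\<^sub>N)\<close>, so by Borel--Caratheodory it tends to the constant \<open>F 0\<close>.\<close>
theorem hadamard_product_genus_0:
  fixes a :: "nat \<Rightarrow> real" and F :: "complex \<Rightarrow> complex" and M :: "real \<Rightarrow> real"
  assumes hol: "F holomorphic_on UNIV" and F0: "F 0 \<noteq> 0"
    and zeros: "\<And>w. F w = 0 \<longleftrightarrow> (\<exists>k. w = of_real (a k))"
    and simple: "\<And>k. deriv F (of_real (a k)) \<noteq> 0"
    and pos: "\<And>k. a k > 0" and mono: "strict_mono a" and lim: "filterlim a at_top sequentially"
    and growth: "\<And>w. norm (F w) \<le> exp (M (norm w))" and M: "((\<lambda>r. M r / r) \<longlongrightarrow> 0) at_top"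
  shows "(\<lambda>N. \<Prod>k<N. 1 - w / of_real (a k)) \<longlonglongrightarrow> F w / F 0"
proof -
  have a0: "a k \<noteq> 0" for k using pos[of k] by simp
  have inj: "inj a" using mono by (rule strict_mono_imp_inj_on)
  have "\<forall>N. \<exists>Q. Q holomorphic_on UNIV \<and> (\<forall>w. F w = Q w * (\<Prod>k<N. 1 - w / of_real (a k)))"
    using divide_out_simple_zeros[OF hol _ a0 inj] zeros by blast
  then obtain Q where Qh: "\<And>N. Q N holomorphic_on UNIV"
    and Q: "\<And>N w. F w = Q N w * (\<Prod>k<N. 1 - w / of_real (a k))"
    by metis
  have Q0: "Q N 0 = F 0" for N using Q[of 0 N] by simp
  \<comment> \<open>A zero of the quotient inside the disc must be one of the points already divided
    out, hence a multiple zero of \<open>F\<close>; simplicity excludes this.\<close>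
  have Qnz: "Q N w \<noteq> 0" if w: "norm w < a N" for N w
  proof
    assume Qw: "Q N w = 0"
    then have "F w = 0" using Q[of w N] by simp
    then obtain k where k: "w = of_real (a k)" using zeros by blast
    then have kN: "k < N" using w pos[of k] mono by (simp add: strict_mono_less)
    have hP: "(\<lambda>w. \<Prod>k<N. 1 - w / complex_of_real (a k)) holomorphic_on UNIV"
      by (intro holomorphic_intros) (use a0 in auto)
    have "F = (\<lambda>w. Q N w * (\<Prod>k<N. 1 - w / of_real (a k)))" using Q by blast
    then have "deriv F w = deriv (\<lambda>w. Q N w * (\<Prod>k<N. 1 - w / of_real (a k))) w" by simp
    also have "\<dots> = Q N w * deriv (\<lambda>w. \<Prod>k<N. 1 - w / complex_of_real (a k)) w
        + deriv (Q N) w * (\<Prod>k<N. 1 - w / of_real (a k))"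
      using Qh[of N] hP by (intro deriv_mult) (auto simp: holomorphic_on_def)
    also have "(\<Prod>k<N. 1 - w / complex_of_real (a k)) = 0"
      using kN k a0[of k] by (intro prod_zero) auto
    finally show False using simple[of k] k Qw by simp
  qed
  \<comment> \<open>The summand 1 makes the bound on the real part strict, as
    \<open>Borel_Caratheodory\<close> demands.\<close>
  define T where "T N = \<bar>M (2 * a N)\<bar> + \<bar>ln (norm (F 0))\<bar> + 1" for N
  have key: "\<exists>g. norm g \<le> 2 * T N * norm w / (a N - norm w) \<and>
      F w = F 0 * exp g * (\<Prod>k<N. 1 - w / of_real (a k))" if wN: "norm w < a N" for N
  proof -
    have "Q N holomorphic_on ball 0 (a N)" using Qh holomorphic_on_subset by blast
    moreover have "contractible (ball (0::complex) (a N))" by (rule convex_imp_contractible) simp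
    ultimately obtain g where g: "g holomorphic_on ball 0 (a N)"
        "\<And>z. z \<in> ball 0 (a N) \<Longrightarrow> Q N z = exp (g z)"
      using contractible_imp_holomorphic_log[of "Q N" "ball 0 (a N)"] Qnz by auto
    have bnd: "norm (Q N z) \<le> exp (M (2 * a N))" if "norm z < a N" for z
    proof (rule maximum_modulus_frontier[of "Q N" "ball 0 (2 * a N)"])
      show "Q N holomorphic_on interior (ball 0 (2 * a N))"
        using Qh holomorphic_on_subset by blast
      show "continuous_on (closure (ball 0 (2 * a N))) (Q N)"
        using Qh holomorphic_on_imp_continuous_on continuous_on_subset by blast
      show "z \<in> ball 0 (2 * a N)" using that pos[of N] by simp
      show "norm (Q N u) \<le> exp (M (2 * a N))" if "u \<in> frontier (ball 0 (2 * a N))" for u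
      proof -
        have u: "norm u = 2 * a N" using that pos[of N] by simp
        have "1 \<le> norm (1 - u / of_real (a k))" if "k < N" for k
        proof -
          have "a k \<le> a N" using mono that by (simp add: strict_mono_less_eq)
          then have "2 \<le> norm (u / of_real (a k))"
            using u pos[of k] by (simp add: norm_divide field_simps)
          then show ?thesis using norm_triangle_ineq2[of "u / of_real (a k)" 1]
            by (simp add: norm_minus_commute)
        qed
        then have "1 \<le> (\<Prod>k<N. norm (1 - u / of_real (a k)))"
          by (intro prod_ge_1) auto
        then have "norm (Q N u) * 1 \<le> norm (Q N u) * (\<Prod>k<N. norm (1 - u / of_real (a k)))"
          by (intro mult_left_mono) auto
        also have "\<dots> = norm (F u)" by (simp add: Q[of u N] norm_mult prod_norm)
        also have "\<dots> \<le> exp (M (2 * a N))" using growth[of u] u by simp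
        finally show ?thesis by simp
      qed
    qed simp
    define h where "h z = g z - g 0" for z
    have e0: "exp (g 0) = F 0" using g(2)[of 0] pos[of N] Q0 by simp
    have "norm (h w) \<le> 2 * T N * norm w / (a N - norm w)"
    proof (rule Borel_Caratheodory[OF _ _ _ wN])
      show "h holomorphic_on ball 0 (a N)" unfolding h_def using g by (intro holomorphic_intros)
      show "Re (h z) < T N" if z: "norm z < a N" for z
      proof -
        have "exp (Re (g z)) \<le> exp (M (2 * a N))"
          using bnd[OF z] g(2)[of z] z by (simp add: norm_exp_eq_Re)
        moreover have "exp (Re (g 0)) = norm (F 0)" using e0 by (metis norm_exp_eq_Re)
        then have "Re (g 0) = ln (norm (F 0))" by (metis ln_exp)
        ultimately show ?thesis by (simp add: h_def T_def)
      qed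
    qed (simp add: h_def)
    moreover have "Q N w = F 0 * exp (h w)"
      using g(2)[of w] wN e0 by (simp add: h_def exp_diff F0)
    ultimately show ?thesis using Q[of w N] by auto
  qed
  \<comment> \<open>For the finitely many N with \<open>a N \<le> norm w\<close> the value 0 is a
    default that does not affect the limit.\<close>
  define e where "e N = (if norm w < a N then SOME g. norm g \<le> 2 * T N * norm w / (a N - norm w) \<and>
      F w = F 0 * exp g * (\<Prod>k<N. 1 - w / of_real (a k)) else 0)" for N
  have e: "norm (e N) \<le> 2 * T N * norm w / (a N - norm w)"
      "F w = F 0 * exp (e N) * (\<Prod>k<N. 1 - w / of_real (a k))" if "norm w < a N" for N
    using someI_ex[OF key[OF that]] that by (simp_all add: e_def)
  have ev: "eventually (\<lambda>N. norm w < a N) sequentially"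
    using lim by (simp add: filterlim_at_top_dense)
  have Ta: "(\<lambda>N. T N / a N) \<longlonglongrightarrow> 0"
  proof -
    have "filterlim (\<lambda>N. 2 * a N) at_top sequentially"
      by (rule filterlim_tendsto_pos_mult_at_top[OF tendsto_const _ lim]) simp
    then have "(\<lambda>N. M (2 * a N) / (2 * a N)) \<longlonglongrightarrow> 0" by (rule filterlim_compose[OF M])
    then have "(\<lambda>N. 2 * \<bar>M (2 * a N) / (2 * a N)\<bar>) \<longlonglongrightarrow> 0"
      by (intro tendsto_mult_right_zero tendsto_rabs_zero)
    moreover have "2 * \<bar>M (2 * a N) / (2 * a N)\<bar> = \<bar>M (2 * a N)\<bar> / a N" for N
      using pos[of N] by (simp add: abs_mult)
    ultimately have 1: "(\<lambda>N. \<bar>M (2 * a N)\<bar> / a N) \<longlonglongrightarrow> 0" by simp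
    have 2: "(\<lambda>N. (\<bar>ln (norm (F 0))\<bar> + 1) / a N) \<longlonglongrightarrow> 0"
      by (rule real_tendsto_divide_at_top[OF tendsto_const lim])
    show ?thesis using tendsto_add[OF 1 2] by (simp add: T_def add_divide_distrib add.assoc)
  qed
  have wa: "(\<lambda>N. norm w / a N) \<longlonglongrightarrow> 0"
    by (rule real_tendsto_divide_at_top[OF tendsto_const lim])
  have "(\<lambda>N. 2 * (T N / a N) * norm w / (1 - norm w / a N)) \<longlonglongrightarrow> 2 * 0 * norm w / (1 - 0)"
    by (intro tendsto_intros Ta wa) simp
  moreover have "2 * (T N / a N) * norm w / (1 - norm w / a N) = 2 * T N * norm w / (a N - norm w)" for N
  proof -
    have "1 - norm w / a N = (a N - norm w) / a N" using pos[of N] by (simp add: diff_divide_distrib)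
    then show ?thesis using a0[of N] by simp
  qed
  ultimately have b: "(\<lambda>N. 2 * T N * norm w / (a N - norm w)) \<longlonglongrightarrow> 0" by (simp only:) simp
  have "e \<longlonglongrightarrow> 0"
    by (rule Lim_null_comparison[OF _ b]) (use ev e(1) in \<open>auto elim: eventually_mono\<close>)
  then have "(\<lambda>N. F w / F 0 * exp (- e N)) \<longlonglongrightarrow> F w / F 0 * exp (- 0)"
    by (intro tendsto_intros)
  moreover have "eventually (\<lambda>N. F w / F 0 * exp (- e N) = (\<Prod>k<N. 1 - w / of_real (a k))) sequentially"
    using ev by eventually_elim (use e(2) F0 in \<open>simp add: exp_minus field_simps\<close>)
  ultimately show ?thesis by (simp add: Lim_transform_eventually)
qed

subsection \<open>Zeta functions of perturbed arithmetic progressions\<close>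

lemma vector_mean_value_bound:
  fixes f :: "real \<Rightarrow> 'a::real_normed_vector"
  assumes S: "convex S" and f: "\<And>x. x \<in> S \<Longrightarrow> (f has_vector_derivative f' x) (at x)"
    and B: "\<And>x. x \<in> S \<Longrightarrow> norm (f' x) \<le> B" and xy: "x \<in> S" "y \<in> S"
  shows "norm (f x - f y) \<le> B * \<bar>x - y\<bar>"
proof -
  have "norm (f x - f y) \<le> B * norm (x - y)"
  proof (rule differentiable_bound[OF S _ _ xy])
    show "(f has_derivative (\<lambda>h. h *\<^sub>R f' u)) (at u within S)" if "u \<in> S" for u
      using f[OF that] unfolding has_vector_derivative_def by (rule has_derivative_at_withinI)
    show "onorm (\<lambda>h. h *\<^sub>R f' u) \<le> B" if "u \<in> S" for u
      by (rule onorm_le) (use B[OF that] in \<open>simp add: mult.commute[of B] mult_left_mono\<close>)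
  qed
  then show ?thesis by simp
qed

text \<open>Moving the sample point p to the midpoint of [m, m+1] costs a first derivative, and the
  midpoint rule itself a second one. Symmetrising about the midpoint reduces the latter to mean
  value inequalities, without any integral.\<close>

lemma midpoint_rule_remainder:
  fixes h :: "real \<Rightarrow> 'a::real_normed_vector"
  assumes H: "\<And>x. x \<ge> d \<Longrightarrow> (H has_vector_derivative h x) (at x)"
    and h: "\<And>x. x \<ge> d \<Longrightarrow> (h has_vector_derivative h1 x) (at x)"
    and h1: "\<And>x. x \<ge> d \<Longrightarrow> (h1 has_vector_derivative h2 x) (at x)"
    and A: "\<And>x. x \<ge> d \<Longrightarrow> norm (h1 x) \<le> A" and B: "\<And>x. x \<ge> d \<Longrightarrow> norm (h2 x) \<le> B"
    and d: "p \<ge> d" "m \<ge> d"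
  shows "norm (h p - (H (m + 1) - H m)) \<le> \<bar>p - (m + 1/2)\<bar> * A + B"
proof -
  define \<mu> where "\<mu> = m + 1/2"
  have B0: "B \<ge> 0" using B[OF d(1)] norm_ge_zero by (rule order_trans[rotated])
  have 1: "norm (h p - h \<mu>) \<le> A * \<bar>p - \<mu>\<bar>"
    by (rule vector_mean_value_bound[of "{d..}" h h1]) (use h A d in \<open>auto simp: \<mu>_def\<close>)
  define L where "L t = h (\<mu> + t) + h (\<mu> - t) - 2 *\<^sub>R h \<mu>" for t
  have L: "norm (L t) \<le> B" if t: "t \<in> {0..1/2}" for t
  proof -
    have "norm (L t - L 0) \<le> B * \<bar>t - 0\<bar>"
    proof (rule vector_mean_value_bound[of "{0..1/2}"])
      show "(L has_vector_derivative (h1 (\<mu> + u) - h1 (\<mu> - u))) (at u)" if "u \<in> {0..1/2}" for u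
      proof -
        have "((\<lambda>t. h (\<mu> + t)) has_vector_derivative 1 *\<^sub>R h1 (\<mu> + u)) (at u)"
          by (rule vector_diff_chain_at[of "\<lambda>t. \<mu> + t" 1 u h, unfolded o_def])
             (use that d in \<open>auto intro!: derivative_eq_intros h simp: \<mu>_def\<close>)
        moreover have "((\<lambda>t. h (\<mu> - t)) has_vector_derivative (-1) *\<^sub>R h1 (\<mu> - u)) (at u)"
          by (rule vector_diff_chain_at[of "\<lambda>t. \<mu> - t" "-1" u h, unfolded o_def])
             (use that d in \<open>auto intro!: derivative_eq_intros h simp: \<mu>_def\<close>)
        ultimately show ?thesis unfolding L_def by (auto intro!: derivative_eq_intros)
      qed
      show "norm (h1 (\<mu> + u) - h1 (\<mu> - u)) \<le> B" if "u \<in> {0..1/2}" for u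
      proof -
        have "norm (h1 (\<mu> + u) - h1 (\<mu> - u)) \<le> B * \<bar>(\<mu> + u) - (\<mu> - u)\<bar>"
          by (rule vector_mean_value_bound[of "{d..}" h1 h2])
             (use h1 B d that in \<open>auto simp: \<mu>_def\<close>)
        also have "\<dots> \<le> B * 1" using that B0 by (intro mult_left_mono) auto
        finally show ?thesis by simp
      qed
    qed (use t in auto)
    also have "\<dots> \<le> B * 1" using t B0 by (intro mult_left_mono) auto
    finally show ?thesis by (simp add: L_def scaleR_2)
  qed
  \<comment> \<open>\<open>K\<close> compares the integral over [\<mu> - t, \<mu> + t] with the
    midpoint value; its derivative is the second difference \<open>L\<close>.\<close>
  define K where "K t = H (\<mu> + t) - H (\<mu> - t) - (2 * t) *\<^sub>R h \<mu>" for t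
  have "norm (K (1/2) - K 0) \<le> B * \<bar>1/2 - 0\<bar>"
  proof (rule vector_mean_value_bound[of "{0..1/2}" K L])
    show "(K has_vector_derivative L u) (at u)" if "u \<in> {0..1/2}" for u
    proof -
      have "((\<lambda>t. H (\<mu> + t)) has_vector_derivative 1 *\<^sub>R h (\<mu> + u)) (at u)"
        by (rule vector_diff_chain_at[of "\<lambda>t. \<mu> + t" 1 u H, unfolded o_def])
           (use that d in \<open>auto intro!: derivative_eq_intros H simp: \<mu>_def\<close>)
      moreover have "((\<lambda>t. H (\<mu> - t)) has_vector_derivative (-1) *\<^sub>R h (\<mu> - u)) (at u)"
        by (rule vector_diff_chain_at[of "\<lambda>t. \<mu> - t" "-1" u H, unfolded o_def])
           (use that d in \<open>auto intro!: derivative_eq_intros H simp: \<mu>_def\<close>)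
      ultimately show ?thesis unfolding K_def L_def by (auto intro!: derivative_eq_intros)
    qed
  qed (use L in auto)
  then have 2: "norm (H (m + 1) - H m - h \<mu>) \<le> B" using B0 by (simp add: K_def \<mu>_def add.commute)
  have "h p - (H (m + 1) - H m) = (h p - h \<mu>) - (H (m + 1) - H m - h \<mu>)" by simp
  then have "norm (h p - (H (m + 1) - H m)) \<le> A * \<bar>p - \<mu>\<bar> + B"
    using norm_triangle_ineq4[of "h p - h \<mu>" "H (m + 1) - H m - h \<mu>"] 1 2 by simp
  then show ?thesis by (simp add: \<mu>_def mult.commute)
qed

section \<open>Real bases to complex powers\<close>

definition npow :: "complex \<Rightarrow> real \<Rightarrow> complex" where
  "npow s x = exp (- s * of_real (ln x))"

lemma norm_npow: "x > 0 \<Longrightarrow> norm (npow s x) = x powr (- Re s)"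
  by (simp add: npow_def norm_exp_eq_Re powr_def)

lemma npow_0 [simp]: "npow 0 x = 1"
  by (simp add: npow_def)

lemma npow_minus_1: "x > 0 \<Longrightarrow> npow (-1) x = of_real x"
  by (simp add: npow_def exp_of_real)

lemma npow_add_1: "x > 0 \<Longrightarrow> npow (s + 1) x = npow s x / of_real x"
  by (simp add: npow_def ring_distribs exp_diff exp_of_real)

lemma npow_has_vector_derivative:
  assumes "x > 0"
  shows "((\<lambda>x. npow s x) has_vector_derivative (- s * npow (s + 1) x)) (at x)"
proof -
  have "((\<lambda>x. complex_of_real (ln x)) has_vector_derivative of_real (1 / x)) (at x)"
    by (rule has_vector_derivative_of_real) (use assms DERIV_ln_divide in
      \<open>simp add: has_real_derivative_iff_has_vector_derivative[symmetric]\<close>)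
  then have "((\<lambda>x. npow s x) has_vector_derivative (- s * of_real (1 / x)) * npow s x) (at x)"
    unfolding npow_def
    by (intro field_vector_diff_chain_at[where g=exp and f="\<lambda>x. - s * of_real (ln x)", unfolded o_def]
        has_vector_derivative_mult_right) (auto intro!: DERIV_exp)
  then show ?thesis using assms by (simp add: npow_add_1)
qed

lemma npow_has_field_derivative:
  "((\<lambda>s. npow s x) has_field_derivative (- of_real (ln x) * npow s x)) (at s)"
  unfolding npow_def by (auto intro!: derivative_eq_intros)

lemma npow_shift_has_field_derivative:
  "((\<lambda>s. npow (s - 1) x) has_field_derivative (- of_real (ln x) * npow (s - 1) x)) (at s)"
  unfolding npow_def by (auto intro!: derivative_eq_intros)

text \<open>An error O(1/k) is what the midpoint rule tolerates: it changes the power -s of the k-th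
  member by O(k^(-Re s - 2)), the same order as the error of the rule. The condition c > 1/2 keeps
  \<open>m 0\<close> below positive, so that its logarithm and powers make sense.\<close>

locale perturbed_progression =
  fixes lam :: "nat \<Rightarrow> real" and c C :: real
  assumes lam_pos: "lam k > 0" and c: "c > 1/2"
    and lam_bound: "\<bar>lam k - (real k + c)\<bar> \<le> C / real (k + 1)"
begin

text \<open>Left end of the unit interval centred at k + c, the approximate position of
  \<open>lam k\<close>.\<close>

definition m :: "nat \<Rightarrow> real" where "m k = real k + c - 1/2"

lemma m_pos: "m k > 0" using c by (simp add: m_def)

lemma m_Suc: "m (Suc k) = m k + 1" by (simp add: m_def)

lemma C_nonneg: "C \<ge> 0" using lam_bound[of 0] by simp

lemma lam_asymp: "(\<lambda>k. lam k / real (k + 1)) \<longlonglongrightarrow> 1"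
proof -
  have 1: "(\<lambda>k. (lam k - (real k + c)) / real (k + 1)) \<longlonglongrightarrow> 0"
  proof (rule Lim_null_comparison)
    show "\<forall>\<^sub>F k in sequentially. norm ((lam k - (real k + c)) / real (k + 1)) \<le> C / real (k + 1)"
    proof (intro always_eventually allI)
      fix k
      have "norm ((lam k - (real k + c)) / real (k + 1)) \<le> (C / real (k + 1)) / real (k + 1)"
        using divide_right_mono[OF lam_bound, of "real (k + 1)" k] by simp
      also have "\<dots> \<le> (C / real (k + 1)) / 1"
        using C_nonneg by (intro divide_left_mono) auto
      finally show "norm ((lam k - (real k + c)) / real (k + 1)) \<le> C / real (k + 1)" by simp
    qed
    show "(\<lambda>k. C / real (k + 1)) \<longlonglongrightarrow> 0" by real_asymp
  qed
  have 2: "(\<lambda>k. (real k + c) / real (k + 1)) \<longlonglongrightarrow> 1" by real_asymp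
  show ?thesis using tendsto_add[OF 1 2] by (simp add: add_divide_distrib[symmetric])
qed

text \<open>A common linear lower bound puts the sample points and the interval ends on one ray on
  which the derivatives can be estimated.\<close>

lemma lower_bound: "\<exists>\<delta>>0. \<delta> \<le> 1 \<and> (\<forall>k. \<delta> * real (k + 1) \<le> lam k \<and> \<delta> * real (k + 1) \<le> m k)"
proof -
  have "(\<lambda>k. inverse (lam k / real (k + 1))) \<longlonglongrightarrow> inverse 1"
    by (rule tendsto_inverse[OF lam_asymp]) simp
  then have "Bseq (\<lambda>k. inverse (lam k / real (k + 1)))"
    by (intro convergent_imp_Bseq) (auto simp: convergent_def)
  then obtain K where K: "K > 0" "\<And>k. norm (inverse (lam k / real (k + 1))) \<le> K"
    by (auto elim: BseqE)
  have l: "real (k + 1) / K \<le> lam k" for k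
    using K(2)[of k] K(1) lam_pos[of k] by (simp add: field_simps)
  define \<delta> where "\<delta> = Min {1, 1 / K, c - 1/2}"
  have \<delta>: "\<delta> > 0" "\<delta> \<le> 1" "\<delta> \<le> 1 / K" "\<delta> \<le> c - 1/2" using K c by (auto simp: \<delta>_def)
  have "\<delta> * real (k + 1) \<le> lam k" for k
    using mult_right_mono[OF \<delta>(3), of "real (k+1)"] l[of k] by simp
  moreover have "\<delta> * real (k + 1) \<le> m k" for k
    using mult_right_mono[OF \<delta>(2), of "real k"] \<delta>(4) by (simp add: m_def algebra_simps)
  ultimately show ?thesis using \<delta> by blast
qed

text \<open>Telescoping \<open>m\<^sub>k\<close> to the power \<open>1 - s\<close> sums the leading part of \<open>(s - 1) \<lambda>\<^sub>k\<close> to the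
  power \<open>-s\<close>; by the midpoint rule the remainder \<open>V\<close> is small enough to converge for
  \<open>Re s > -1\<close>. The factor \<open>s - 1\<close> keeps everything holomorphic at 1.\<close>
definition V :: "nat \<Rightarrow> complex \<Rightarrow> complex" where
  "V k s = (s - 1) * npow s (lam k) - (npow (s - 1) (m k) - npow (s - 1) (m (Suc k)))"

definition V' :: "nat \<Rightarrow> complex \<Rightarrow> complex" where
  "V' k s = npow s (lam k) - (s - 1) * of_real (ln (lam k)) * npow s (lam k)
     + of_real (ln (m k)) * npow (s - 1) (m k) - of_real (ln (m (Suc k))) * npow (s - 1) (m (Suc k))"

lemma V_has_field_derivative: "(V k has_field_derivative V' k s) (at s)"
proof -
  show ?thesis unfolding V_def [abs_def] V'_def
    by (rule derivative_eq_intros npow_has_field_derivative npow_shift_has_field_derivative refl)+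
      (simp add: algebra_simps)
qed

text \<open>The midpoint rule for (s - 1) x^(-s) with antiderivative -x^(1-s). The displacement of
  \<open>lam k\<close> contributes C/(k+1) times a first derivative, the rule itself a second
  derivative; both have order k^(-Re s - 2).\<close>

lemma V_bound:
  assumes \<delta>: "\<delta> > 0" "\<delta> \<le> 1" "\<And>k. \<delta> * real (k + 1) \<le> lam k \<and> \<delta> * real (k + 1) \<le> m k"
    and s: "Re s > -1"
  shows "norm (V k s) \<le> norm (s - 1) * norm s * (C + norm (s + 1)) * (\<delta> * real (k + 1)) powr (- Re s - 2)"
proof -
  define d where "d = \<delta> * real (k + 1)"
  have d: "d > 0" using \<delta> by (simp add: d_def)
  define h where "h x = (s - 1) * npow s x" for x
  define h1 where "h1 x = (s - 1) * (- s * npow (s + 1) x)" for x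
  define h2 where "h2 x = (s - 1) * (- s * (- (s + 1) * npow (s + 1 + 1) x))" for x
  have "norm (h (lam k) - ((- npow (s - 1) (m k + 1)) - (- npow (s - 1) (m k))))
      \<le> \<bar>lam k - (m k + 1/2)\<bar> * (norm (s - 1) * norm s * d powr (- Re s - 1))
        + norm (s - 1) * norm s * norm (s + 1) * d powr (- Re s - 2)"
  proof (rule midpoint_rule_remainder[of d "\<lambda>x. - npow (s - 1) x" h h1 h2])
    fix x assume x: "x \<ge> d"
    then have x0: "x > 0" using d by simp
    show "((\<lambda>x. - npow (s - 1) x) has_vector_derivative h x) (at x)"
      using has_vector_derivative_minus[OF npow_has_vector_derivative[OF x0, of "s - 1"]]
      by (simp add: h_def algebra_simps)
    show "(h has_vector_derivative h1 x) (at x)" unfolding h_def h1_def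
      by (intro has_vector_derivative_mult_right npow_has_vector_derivative x0)
    show "(h1 has_vector_derivative h2 x) (at x)" unfolding h1_def h2_def
      by (intro has_vector_derivative_mult_right npow_has_vector_derivative x0)
    have "x powr (- Re s - 1) \<le> d powr (- Re s - 1)" using x d s by (intro powr_mono2') auto
    moreover have "norm (npow (s + 1) x) = x powr (- Re s - 1)" by (subst norm_npow[OF x0]) simp
    then have "norm (h1 x) = norm (s - 1) * norm s * x powr (- Re s - 1)"
      by (simp only: h1_def norm_mult norm_minus_cancel mult.assoc)
    ultimately show "norm (h1 x) \<le> norm (s - 1) * norm s * d powr (- Re s - 1)"
      by (simp add: mult_left_mono)
    have "x powr (- Re s - 2) \<le> d powr (- Re s - 2)" using x d s by (intro powr_mono2') auto
    moreover have "norm (npow (s + 1 + 1) x) = x powr (- Re s - 2)"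
      by (subst norm_npow[OF x0]) (simp add: algebra_simps)
    then have "norm (h2 x) = norm (s - 1) * norm s * norm (s + 1) * x powr (- Re s - 2)"
      by (simp only: h2_def norm_mult norm_minus_cancel mult.assoc)
    ultimately show "norm (h2 x) \<le> norm (s - 1) * norm s * norm (s + 1) * d powr (- Re s - 2)"
      by (simp add: mult_left_mono)
  qed (use \<delta> in \<open>auto simp: d_def\<close>)
  also have "\<bar>lam k - (m k + 1/2)\<bar> * (norm (s - 1) * norm s * d powr (- Re s - 1))
      \<le> norm (s - 1) * norm s * C * d powr (- Re s - 2)"
  proof -
    have "\<bar>lam k - (m k + 1/2)\<bar> \<le> C / real (k + 1)" using lam_bound[of k] by (simp add: m_def)
    also have "\<dots> \<le> C / d"
      using C_nonneg \<delta> d by (intro divide_left_mono) (auto simp: d_def intro!: mult_left_le_one_le)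
    finally have "\<bar>lam k - (m k + 1/2)\<bar> * (norm (s - 1) * norm s * d powr (- Re s - 1))
        \<le> C / d * (norm (s - 1) * norm s * d powr (- Re s - 1))"
      by (rule mult_right_mono) simp
    also have "d powr (- Re s - 2) = d powr (- Re s - 1) / d"
      using powr_diff[of d "- Re s - 1" 1] d by (simp add: algebra_simps)
    then have "C / d * (norm (s - 1) * norm s * d powr (- Re s - 1))
        = norm (s - 1) * norm s * C * d powr (- Re s - 2)" by simp
    finally show ?thesis .
  qed
  finally show ?thesis
    by (simp add: V_def h_def d_def m_Suc algebra_simps)
qed

lemma V_locally_dominated:
  assumes s: "Re s > -1"
  shows "\<exists>d h. 0 < d \<and> summable h \<and>
    (\<forall>\<^sub>F n in sequentially. \<forall>y\<in>ball s d \<inter> {s. Re s > -1}. norm (V n y) \<le> h n)"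
proof -
  obtain \<delta> where \<delta>: "\<delta> > 0" "\<delta> \<le> 1" "\<And>k. \<delta> * real (k + 1) \<le> lam k \<and> \<delta> * real (k + 1) \<le> m k"
    using lower_bound by blast
  \<comment> \<open>Half the distance to the line Re s = -1: on this ball the exponents -Re y - 2
    stay below a constant less than -1.\<close>
  define r where "r = (Re s + 1) / 2"
  define N where "N = norm s + r"
  have r: "r > 0" using s by (simp add: r_def)
  have N: "N > 0" using r norm_ge_zero[of s] by (simp add: N_def add_nonneg_pos)
  define K where "K = (N + 1) * N * (C + (N + 1)) * \<delta> powr (- N - 2)"
  define h where "h n = K * real (n + 1) powr (r - Re s - 2)" for n
  have "summable (\<lambda>n. real (Suc n) powr (r - Re s - 2))"
    by (subst summable_Suc_iff, subst summable_real_powr_iff) (use s in \<open>simp add: r_def field_simps\<close>)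
  then have "summable h" unfolding h_def by (intro summable_mult) simp
  moreover have "norm (V n y) \<le> h n" if y: "y \<in> ball s r" "Re y > -1" for n y
  proof -
    have sy: "norm (s - y) < r" using y by (simp add: dist_norm)
    have ny: "norm y \<le> N" using norm_triangle_sub[of y s] sy by (simp add: N_def norm_minus_commute)
    have ry: "Re s - r \<le> Re y" using abs_Re_le_cmod[of "s - y"] sy by simp
    have Rey: "Re y \<le> N" using complex_Re_le_cmod[of y] ny by linarith
    have n1: "norm (y - 1) \<le> N + 1" "norm (y + 1) \<le> N + 1"
      using norm_triangle_ineq4[of y 1] norm_triangle_ineq[of y 1] ny by auto
    have "norm (V n y) \<le> norm (y - 1) * norm y * (C + norm (y + 1)) * (\<delta> * real (n + 1)) powr (- Re y - 2)"
      by (rule V_bound[OF \<delta> y(2)])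
    also have "\<dots> = norm (y - 1) * norm y * (C + norm (y + 1)) * (\<delta> powr (- Re y - 2) * real (n + 1) powr (- Re y - 2))"
      using \<delta> by (simp add: powr_mult)
    also have "\<dots> \<le> (N + 1) * N * (C + (N + 1)) * (\<delta> powr (- N - 2) * real (n + 1) powr (r - Re s - 2))"
      using n1 ny N C_nonneg \<delta> ry Rey
      by (intro mult_mono powr_mono powr_mono' add_mono mult_nonneg_nonneg add_nonneg_nonneg) auto
    finally show ?thesis by (simp add: h_def K_def mult.assoc)
  qed
  ultimately show ?thesis using r by (intro exI[of _ r] exI[of _ h]) auto
qed

text \<open>\<open>H\<close> is s - 1 times the zeta function; the first term is the sum of the
  telescoping leading parts.\<close>

definition H :: "complex \<Rightarrow> complex" where "H s = npow (s - 1) (m 0) + (\<Sum>k. V k s)"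
definition H' :: "complex \<Rightarrow> complex" where
  "H' s = - of_real (ln (m 0)) * npow (s - 1) (m 0) + (\<Sum>k. V' k s)"

lemma V_summable_deriv:
  assumes s: "Re s > -1"
  shows "summable (\<lambda>k. V k s)" "summable (\<lambda>k. V' k s)"
    "((\<lambda>s. \<Sum>k. V k s) has_field_derivative (\<Sum>k. V' k s)) (at s)"
proof -
  have op: "open {s. Re s > -1}" by (rule open_halfspace_Re_gt)
  obtain g g' where g: "\<And>s. Re s > -1 \<Longrightarrow> (\<lambda>k. V k s) sums g s \<and> (\<lambda>k. V' k s) sums g' s \<and>
      (g has_field_derivative g' s) (at s)"
    using series_and_derivative_comparison_local[OF op, of V V']
      V_has_field_derivative V_locally_dominated by (auto simp: mem_Collect_eq)
  show "summable (\<lambda>k. V k s)" "summable (\<lambda>k. V' k s)" using g[OF s] by (auto simp: sums_iff)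
  have eq: "g' s = (\<Sum>k. V' k s)" using g[OF s] by (auto simp: sums_iff)
  show "((\<lambda>s. \<Sum>k. V k s) has_field_derivative (\<Sum>k. V' k s)) (at s)"
    by (rule has_field_derivative_transform_within_open[of g _ _ "{s. Re s > -1}"])
       (use g s op eq in \<open>auto simp: sums_iff\<close>)
qed

lemma H_has_field_derivative:
  assumes s: "Re s > -1"
  shows "(H has_field_derivative H' s) (at s)"
proof -
  show ?thesis unfolding H_def [abs_def] H'_def
    by (intro DERIV_add npow_shift_has_field_derivative V_summable_deriv s)
qed

text \<open>This is the residue of the zeta function at 1; all \<open>V k 1\<close> vanish.\<close>

lemma H_1: "H 1 = 1"
  by (simp add: H_def V_def)

text \<open>At s = 0 the integrand is constant and the midpoint rule exact. The zeta function thus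
  has the value 1/2 - c at 0.\<close>

lemma H_0: "H 0 = of_real (c - 1/2)"
proof -
  have "V k 0 = 0" for k using m_pos[of k] m_pos[of "Suc k"] by (simp add: V_def npow_minus_1 m_Suc)
  then show ?thesis using m_pos[of 0] by (simp add: H_def npow_minus_1) (simp add: m_def)
qed

lemma npow_summable:
  assumes s: "Re s > 1"
  shows "summable (\<lambda>k. norm (npow s (lam k)))"
proof -
  obtain \<delta> where \<delta>: "\<delta> > 0" "\<And>k. \<delta> * real (k + 1) \<le> lam k" using lower_bound by blast
  have "summable (\<lambda>n. real (Suc n) powr (- Re s))"
    by (subst summable_Suc_iff, subst summable_real_powr_iff) (use s in simp)
  then have "summable (\<lambda>n. \<delta> powr (- Re s) * real (n + 1) powr (- Re s))"
    by (intro summable_mult) simp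
  then show ?thesis
  proof (rule summable_comparison_test')
    fix n
    have "lam n powr (- Re s) \<le> (\<delta> * real (n + 1)) powr (- Re s)"
      using \<delta> s by (intro powr_mono2') auto
    then show "norm (norm (npow s (lam n))) \<le> \<delta> powr (- Re s) * real (n + 1) powr (- Re s)"
      using \<delta> lam_pos[of n] by (simp add: norm_npow powr_mult)
  qed
qed

lemma zeta_sums:
  assumes s: "Re s > 1"
  shows "(\<lambda>k. npow s (lam k)) sums (H s / (s - 1))"
proof -
  have "(\<lambda>k. npow (s - 1) (m k)) \<longlonglongrightarrow> 0"
  proof (rule tendsto_norm_zero_cancel)
    have "(\<lambda>k. m k powr (1 - Re s)) \<longlonglongrightarrow> 0" unfolding m_def using s by real_asymp
    then show "(\<lambda>k. norm (npow (s - 1) (m k))) \<longlonglongrightarrow> 0"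
      using m_pos by (simp add: norm_npow)
  qed
  from telescope_sums'[OF this]
  have t: "(\<lambda>k. npow (s - 1) (m k) - npow (s - 1) (m (Suc k))) sums npow (s - 1) (m 0)" by simp
  have "(\<lambda>k. V k s) sums (\<Sum>k. V k s)" using V_summable_deriv(1)[of s] s by (simp add: summable_sums)
  from sums_add[OF t this] have "(\<lambda>k. (s - 1) * npow s (lam k)) sums H s"
    by (simp add: V_def H_def)
  then have "(\<lambda>k. (s - 1) * npow s (lam k) / (s - 1)) sums (H s / (s - 1))" by (rule sums_divide)
  moreover have "s \<noteq> 1" using s by auto
  ultimately show ?thesis by simp
qed

text \<open>The error of \<open>ln (lam k)\<close> against the integral of ln over
  [\<open>m k\<close>, \<open>m (Suc k)\<close>]; it is the value of \<open>V' k\<close> at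
  0.\<close>

definition r :: "nat \<Rightarrow> real" where
  "r k = 1 + ln (lam k) + m k * ln (m k) - m (Suc k) * ln (m (Suc k))"

lemma H'_0: "summable r" "H' 0 = of_real ((\<Sum>k. r k) - m 0 * ln (m 0))"
proof -
  have "V' k 0 = of_real (r k)" for k
    using m_pos[of k] m_pos[of "Suc k"] by (simp add: V'_def r_def npow_minus_1)
  then have V': "(\<lambda>k. V' k 0) = (\<lambda>k. of_real (r k))" by blast
  have "summable (\<lambda>k. V' k 0)" by (rule V_summable_deriv) simp
  then show "summable r" by (simp add: V')
  then show "H' 0 = of_real ((\<Sum>k. r k) - m 0 * ln (m 0))"
    using m_pos[of 0] by (simp add: H'_def V' suminf_of_real npow_minus_1)
qed

text \<open>As \<open>H\<close> is s - 1 times zeta, the limit is 2 zeta'(0), and c - 1/2 is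
  -zeta(0). The summand is ln (x^2 + y^2) - 2 ln x at x = \<open>lam k\<close>. Both parts are
  replaced by integrals over unit intervals, with errors \<open>q y k\<close> and
  \<open>2 * r k\<close>: the integrals telescope, the first errors vanish as y grows, and the
  second ones enter \<open>H' 0\<close>.\<close>

lemma log_det_asymptotics:
  shows "\<And>y. y > 0 \<Longrightarrow> summable (\<lambda>k. ln (1 + y\<^sup>2 / (lam k)\<^sup>2))"
    and "((\<lambda>y. (\<Sum>k. ln (1 + y\<^sup>2 / (lam k)\<^sup>2)) - pi * y + 2 * (c - 1/2) * ln y)
       \<longlongrightarrow> - 2 * Re (H' 0) - 2 * Re (H 0)) at_top"
proof -
  obtain \<delta> where \<delta>: "\<delta> > 0" "\<delta> \<le> 1" "\<And>k. \<delta> * real (k + 1) \<le> lam k \<and> \<delta> * real (k + 1) \<le> m k"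
    using lower_bound by blast
  define g where "g y x = ln (x\<^sup>2 + y\<^sup>2)" for y x :: real
  define G where "G y x = x * ln (x\<^sup>2 + y\<^sup>2) - 2 * x + 2 * y * arctan (x / y)" for y x :: real
  define q where "q y k = g y (lam k) - (G y (m k + 1) - G y (m k))" for y k
  have rem: "norm (q y k) \<le> \<bar>lam k - (m k + 1/2)\<bar> * A + B"
    if y: "y > 0" and A: "\<And>x. x \<ge> \<delta> * real (k + 1) \<Longrightarrow> \<bar>2 * x / (x\<^sup>2 + y\<^sup>2)\<bar> \<le> A"
      and B: "\<And>x. x \<ge> \<delta> * real (k + 1) \<Longrightarrow> 2 / (x\<^sup>2 + y\<^sup>2) \<le> B" for y k A B
    unfolding q_def
  proof (rule midpoint_rule_remainder)
    have yy: "x\<^sup>2 + y\<^sup>2 > 0" for x using y by (simp add: add_nonneg_pos)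
    fix x assume x: "x \<ge> \<delta> * real (k + 1)"
    have *: "1 + (x / y)\<^sup>2 = (x\<^sup>2 + y\<^sup>2) / y\<^sup>2" using y by (simp add: field_simps)
    have "(G y has_real_derivative (ln (x\<^sup>2 + y\<^sup>2) + x * (2 * x / (x\<^sup>2 + y\<^sup>2)) - 2
        + 2 * y * (inverse (1 + (x / y)\<^sup>2) / y))) (at x)"
      unfolding G_def using yy[of x] y by (auto intro!: derivative_eq_intros simp: divide_simps)
    moreover have "ln (x\<^sup>2 + y\<^sup>2) + x * (2 * x / (x\<^sup>2 + y\<^sup>2)) - 2 + 2 * y * (inverse (1 + (x / y)\<^sup>2) / y) = g y x"
    proof -
      have "2 * y * (inverse (1 + (x / y)\<^sup>2) / y) = 2 * y\<^sup>2 / (x\<^sup>2 + y\<^sup>2)"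
        unfolding * using y by (simp add: power2_eq_square)
      moreover have "x * (2 * x / (x\<^sup>2 + y\<^sup>2)) + 2 * y\<^sup>2 / (x\<^sup>2 + y\<^sup>2) = 2 * (x\<^sup>2 + y\<^sup>2) / (x\<^sup>2 + y\<^sup>2)"
        by (simp add: add_divide_distrib[symmetric] power2_eq_square)
      moreover have "2 * (x\<^sup>2 + y\<^sup>2) / (x\<^sup>2 + y\<^sup>2) = 2"
        by (rule nonzero_mult_div_cancel_right) (use yy[of x] in linarith)
      ultimately show ?thesis by (simp add: g_def)
    qed
    ultimately show "(G y has_vector_derivative g y x) (at x)"
      by (simp add: has_real_derivative_iff_has_vector_derivative)
    show "(g y has_vector_derivative 2 * x / (x\<^sup>2 + y\<^sup>2)) (at x)"
      unfolding g_def has_real_derivative_iff_has_vector_derivative[symmetric]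
      using yy[of x] by (auto intro!: derivative_eq_intros)
    show "((\<lambda>x. 2 * x / (x\<^sup>2 + y\<^sup>2)) has_vector_derivative
        (2 * (x\<^sup>2 + y\<^sup>2) - 2 * x * (2 * x)) / (x\<^sup>2 + y\<^sup>2)\<^sup>2) (at x)"
      unfolding has_real_derivative_iff_has_vector_derivative[symmetric]
      using yy[of x] by (auto intro!: derivative_eq_intros simp: power2_eq_square)
    show "norm (2 * x / (x\<^sup>2 + y\<^sup>2)) \<le> A" using A[OF x] by simp
    have quot: "2 * S / S\<^sup>2 = 2 / S" if "S > 0" for S :: real
      using that by (simp add: power2_eq_square)
    have "\<bar>2 * (x\<^sup>2 + y\<^sup>2) - 2 * x * (2 * x)\<bar> \<le> 2 * (x\<^sup>2 + y\<^sup>2)"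
      by (simp add: abs_le_iff power2_eq_square)
    then have "\<bar>2 * (x\<^sup>2 + y\<^sup>2) - 2 * x * (2 * x)\<bar> / (x\<^sup>2 + y\<^sup>2)\<^sup>2 \<le> 2 * (x\<^sup>2 + y\<^sup>2) / (x\<^sup>2 + y\<^sup>2)\<^sup>2"
      by (rule divide_right_mono) simp
    also have "2 * (x\<^sup>2 + y\<^sup>2) / (x\<^sup>2 + y\<^sup>2)\<^sup>2 = 2 / (x\<^sup>2 + y\<^sup>2)" by (rule quot[OF yy])
    also have "\<dots> \<le> B" by (rule B[OF x])
    finally show "norm ((2 * (x\<^sup>2 + y\<^sup>2) - 2 * x * (2 * x)) / (x\<^sup>2 + y\<^sup>2)\<^sup>2) \<le> B" by simp
  qed (use \<delta> in auto)
  have lb: "\<bar>lam k - (m k + 1/2)\<bar> \<le> C / real (k + 1)" for k using lam_bound[of k] by (simp add: m_def)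
  define Q where "Q k = (2 * C / \<delta> + 2 / \<delta>\<^sup>2) * (1 / real (k + 1) ^ 2)" for k
  have "summable (\<lambda>k. 1 / real (Suc k) ^ 2)"
    using inverse_power_summable[of 2, where 'a=real] by (subst summable_Suc_iff) (simp add: inverse_eq_divide)
  then have Qs: "summable Q" unfolding Q_def by (intro summable_mult) simp
  \<comment> \<open>Dropping y^2 from the denominators gives a summable majorant independent of y,
    as Tannery's theorem requires.\<close>
  have qQ: "norm (q y k) \<le> Q k" if y: "y > 0" for y k
  proof -
    define d where "d = \<delta> * real (k + 1)"
    have d: "d > 0" using \<delta> by (simp add: d_def)
    have collect: "C / N * (2 / (\<delta> * N)) + 2 / (\<delta> * N)\<^sup>2 = (2 * C / \<delta> + 2 / \<delta>\<^sup>2) * (1 / N ^ 2)"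
      if "N > 0" for N using \<delta>(1) that by (simp add: field_simps power2_eq_square)
    have "norm (q y k) \<le> \<bar>lam k - (m k + 1/2)\<bar> * (2 / d) + 2 / d\<^sup>2"
    proof (rule rem[OF y])
      fix x assume "x \<ge> \<delta> * real (k + 1)"
      then have x: "x \<ge> d" by (simp add: d_def)
      have "2 * x / (x\<^sup>2 + y\<^sup>2) \<le> 2 * x / x\<^sup>2"
        using x d y by (intro divide_left_mono) (auto intro!: mult_pos_pos add_pos_pos)
      also have "\<dots> = 2 / x" using x d by (simp add: power2_eq_square)
      also have "\<dots> \<le> 2 / d" using x d by (intro divide_left_mono) auto
      finally show "\<bar>2 * x / (x\<^sup>2 + y\<^sup>2)\<bar> \<le> 2 / d" using x d by simp
      have "d\<^sup>2 \<le> x\<^sup>2" using x d by (intro power_mono) auto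
      then show "2 / (x\<^sup>2 + y\<^sup>2) \<le> 2 / d\<^sup>2" using d y
        by (intro divide_left_mono) (auto intro!: mult_pos_pos add_pos_pos add_increasing2)
    qed
    also have "\<dots> \<le> C / real (k + 1) * (2 / d) + 2 / d\<^sup>2"
      using lb[of k] d by (intro add_right_mono mult_right_mono) auto
    also have "\<dots> = Q k" unfolding Q_def d_def by (rule collect) simp
    finally show ?thesis .
  qed
  \<comment> \<open>For fixed k the denominators are estimated by y instead: 2xy \<le> x^2 + y^2
    bounds the first derivative by 1/y.\<close>
  have qlim: "((\<lambda>y. q y k) \<longlongrightarrow> 0) at_top" for k
  proof (rule Lim_null_comparison)
    show "\<forall>\<^sub>F y in at_top. norm (q y k) \<le> C / real (k + 1) * (1 / y) + 2 / y\<^sup>2"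
      using eventually_gt_at_top[of 0]
    proof eventually_elim
      case (elim y)
      have "norm (q y k) \<le> \<bar>lam k - (m k + 1/2)\<bar> * (1 / y) + 2 / y\<^sup>2"
      proof (rule rem[OF elim])
        fix x assume "x \<ge> \<delta> * real (k + 1)"
        moreover have "\<delta> * real (k + 1) > 0" using \<delta>(1) by simp
        ultimately have x: "x > 0" by linarith
        have "2 * x * y \<le> x\<^sup>2 + y\<^sup>2" by (rule sum_squares_bound)
        then show "\<bar>2 * x / (x\<^sup>2 + y\<^sup>2)\<bar> \<le> 1 / y"
          using x elim by (simp add: divide_simps add_pos_pos)
        show "2 / (x\<^sup>2 + y\<^sup>2) \<le> 2 / y\<^sup>2" using x elim
          by (intro divide_left_mono) (auto intro!: mult_pos_pos add_pos_pos)
      qed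
      also have "\<dots> \<le> C / real (k + 1) * (1 / y) + 2 / y\<^sup>2"
        using lb[of k] elim by (intro add_right_mono mult_right_mono) auto
      finally show ?case .
    qed
    show "((\<lambda>y. C / real (k + 1) * (1 / y) + 2 / y\<^sup>2) \<longlongrightarrow> 0) at_top" by real_asymp
  qed
  have Sq: "((\<lambda>y. \<Sum>k. q y k) \<longlongrightarrow> 0) at_top"
  proof -
    have "\<forall>\<^sub>F (k, y) in at_top \<times>\<^sub>F at_top. norm (q y k) \<le> Q k"
      unfolding eventually_prod_filter
      by (rule exI[of _ "\<lambda>_. True"], rule exI[of _ "\<lambda>y. y > 0"])
         (use qQ in \<open>auto simp: eventually_gt_at_top\<close>)
    from tannerys_theorem[OF qlim this Qs] show ?thesis by simp
  qed
  \<comment> \<open>An antiderivative of ln (1 + y^2/x^2) in x. Its limit at infinity comes from the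
    arctangent and is the source of the linear term pi y.\<close>
  define \<Phi> where "\<Phi> y x = G y x - 2 * (x * ln x - x)" for y x :: real
  have sums: "(\<lambda>k. ln (1 + y\<^sup>2 / (lam k)\<^sup>2)) sums ((\<Sum>k. q y k) - 2 * (\<Sum>k. r k) + (pi * y - \<Phi> y (m 0)))"
    if y: "y > 0" for y
  proof -
    have "((\<lambda>x. \<Phi> y x) \<longlongrightarrow> pi * y) at_top" unfolding \<Phi>_def G_def using y by real_asymp
    moreover have "filterlim m at_top sequentially" unfolding m_def by real_asymp
    ultimately have "(\<lambda>k. \<Phi> y (m k)) \<longlonglongrightarrow> pi * y" by (rule filterlim_compose)
    from telescope_sums[OF this] have 1: "(\<lambda>k. \<Phi> y (m (Suc k)) - \<Phi> y (m k)) sums (pi * y - \<Phi> y (m 0))" .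
    have 2: "(\<lambda>k. q y k) sums (\<Sum>k. q y k)"
      by (intro summable_sums summable_comparison_test'[OF Qs]) (use qQ[OF y] in auto)
    have 3: "(\<lambda>k. 2 * r k) sums (2 * (\<Sum>k. r k))" by (intro sums_mult summable_sums H'_0)
    have "ln (1 + y\<^sup>2 / (lam k)\<^sup>2) = q y k - 2 * r k + (\<Phi> y (m (Suc k)) - \<Phi> y (m k))" for k
    proof -
      have l: "lam k > 0" by (rule lam_pos)
      have "1 + y\<^sup>2 / (lam k)\<^sup>2 = ((lam k)\<^sup>2 + y\<^sup>2) / (lam k)\<^sup>2" using l by (simp add: field_simps)
      then have "ln (1 + y\<^sup>2 / (lam k)\<^sup>2) = g y (lam k) - 2 * ln (lam k)"
        using l y by (simp add: g_def ln_div add_pos_pos ln_realpow)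
      then show ?thesis by (simp add: q_def r_def \<Phi>_def m_Suc algebra_simps)
    qed
    then show ?thesis using sums_add[OF sums_diff[OF 2 3] 1] by simp
  qed
  show "summable (\<lambda>k. ln (1 + y\<^sup>2 / (lam k)\<^sup>2))" if "y > 0" for y
    using sums[OF that] by (simp add: sums_iff)
  define m0 where "m0 = m 0"
  have m0: "m0 > 0" using m_pos by (simp add: m0_def)
  have P: "((\<lambda>y. \<Phi> y m0 - 2 * m0 * ln y) \<longlongrightarrow> 2 * m0 - 2 * m0 * ln m0) at_top"
  proof -
    have 1: "((\<lambda>y. m0 * (ln (m0\<^sup>2 + y\<^sup>2) - 2 * ln y)) \<longlongrightarrow> m0 * 0) at_top"
      by (intro tendsto_mult tendsto_const) real_asymp
    have 2: "((\<lambda>y. 2 * y * arctan (m0 / y)) \<longlongrightarrow> 2 * m0) at_top"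
      using m0 by real_asymp
    have "((\<lambda>y. m0 * (ln (m0\<^sup>2 + y\<^sup>2) - 2 * ln y) + 2 * y * arctan (m0 / y) - 2 * m0 * ln m0) \<longlongrightarrow>
        m0 * 0 + 2 * m0 - 2 * m0 * ln m0) at_top"
      by (intro tendsto_intros 1 2)
    then show ?thesis by (simp add: \<Phi>_def G_def algebra_simps)
  qed
  have "((\<lambda>y. (\<Sum>k. q y k) - 2 * (\<Sum>k. r k) - (\<Phi> y m0 - 2 * m0 * ln y)) \<longlongrightarrow>
      0 - 2 * (\<Sum>k. r k) - (2 * m0 - 2 * m0 * ln m0)) at_top"
    by (intro tendsto_intros Sq P)
  moreover have "0 - 2 * (\<Sum>k. r k) - (2 * m0 - 2 * m0 * ln m0) = - 2 * Re (H' 0) - 2 * Re (H 0)"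
    by (simp add: H'_0 H_0 m0_def) (simp add: m_def)
  moreover have "\<forall>\<^sub>F y in at_top. (\<Sum>k. q y k) - 2 * (\<Sum>k. r k) - (\<Phi> y m0 - 2 * m0 * ln y)
      = (\<Sum>k. ln (1 + y\<^sup>2 / (lam k)\<^sup>2)) - pi * y + 2 * (c - 1/2) * ln y"
    using eventually_gt_at_top[of 0]
  proof eventually_elim
    case (elim y)
    have "(\<Sum>k. ln (1 + y\<^sup>2 / (lam k)\<^sup>2)) = (\<Sum>k. q y k) - 2 * (\<Sum>k. r k) + (pi * y - \<Phi> y (m 0))"
      using sums[OF elim] by (simp add: sums_iff)
    moreover have "m0 = c - 1/2" by (simp add: m0_def m_def)
    ultimately show ?case by (simp add: m0_def)
  qed
  ultimately show "((\<lambda>y. (\<Sum>k. ln (1 + y\<^sup>2 / (lam k)\<^sup>2)) - pi * y + 2 * (c - 1/2) * ln y)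
       \<longlongrightarrow> - 2 * Re (H' 0) - 2 * Re (H 0)) at_top"
    by (simp add: filterlim_cong)
qed

end

subsection \<open>The Bessel--Clifford function\<close>

definition clifford_coeff :: "real \<Rightarrow> nat \<Rightarrow> real" where
  "clifford_coeff \<nu> n = 1 / (fact n * Gamma (real n + \<nu> + 1))"

text \<open>The Bessel--Clifford function, an entire function of order \<open>1/2\<close> with
  \<open>J\<^sub>\<nu>(x) = (x/2)\<^sup>\<nu> C\<^sub>\<nu>(x\<^sup>2/4)\<close>.\<close>
definition clifford :: "real \<Rightarrow> complex \<Rightarrow> complex" where
  "clifford \<nu> w = (\<Sum>n. of_real ((-1) ^ n * clifford_coeff \<nu> n) * w ^ n)"

lemma clifford_coeff_pos: "\<nu> > -1 \<Longrightarrow> clifford_coeff \<nu> n > 0"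
  unfolding clifford_coeff_def by (intro divide_pos_pos mult_pos_pos Gamma_real_pos) auto

lemma clifford_coeff_Suc:
  assumes "\<nu> > -1"
  shows "clifford_coeff \<nu> (Suc n) = clifford_coeff \<nu> n / (real (Suc n) * (real n + \<nu> + 1))"
proof -
  have "Gamma (real (Suc n) + \<nu> + 1) = (real n + \<nu> + 1) * Gamma (real n + \<nu> + 1)"
    using Gamma_plus1[of "real n + \<nu> + 1"] assms by (force simp: add_ac elim!: nonpos_Ints_cases)
  then show ?thesis by (simp add: clifford_coeff_def)
qed

lemma clifford_coeff_shift:
  assumes "\<nu> > -1"
  shows "clifford_coeff \<nu> n = (real n + \<nu> + 1) * clifford_coeff (\<nu> + 1) n"
    and "clifford_coeff (\<nu> + 1) n = real (Suc n) * clifford_coeff \<nu> (Suc n)"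
proof -
  have "Gamma (real n + (\<nu> + 1) + 1) = (real n + \<nu> + 1) * Gamma (real n + \<nu> + 1)"
    using Gamma_plus1[of "real n + \<nu> + 1"] assms by (force simp: add_ac elim!: nonpos_Ints_cases)
  then show "clifford_coeff \<nu> n = (real n + \<nu> + 1) * clifford_coeff (\<nu> + 1) n"
    using assms by (simp add: clifford_coeff_def)
  show "clifford_coeff (\<nu> + 1) n = real (Suc n) * clifford_coeff \<nu> (Suc n)"
    by (simp add: clifford_coeff_def add_ac)
qed

lemma clifford_coeff_le:
  assumes "\<nu> \<ge> 0"
  shows "clifford_coeff \<nu> n \<le> clifford_coeff \<nu> 0 / (fact n)\<^sup>2"
proof (induction n)
  case (Suc n)
  have "clifford_coeff \<nu> (Suc n) = clifford_coeff \<nu> n / (real (Suc n) * (real n + \<nu> + 1))"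
    using assms by (intro clifford_coeff_Suc) simp
  also have "\<dots> \<le> (clifford_coeff \<nu> 0 / (fact n)\<^sup>2) / (real (Suc n) * real (Suc n))"
    using assms Suc.IH clifford_coeff_pos[of \<nu> n] clifford_coeff_pos[of \<nu> 0]
    by (intro frac_le mult_left_mono) auto
  also have "\<dots> = clifford_coeff \<nu> 0 / (fact (Suc n))\<^sup>2" by (simp add: power2_eq_square)
  finally show ?case .
qed simp

text \<open>With r = sqrt (norm w) the term is at most a constant times (r^n/n!)^2. Bounding one of
  the two factors by exp r leaves an exponential series, whence growth of order exp (2r).\<close>

lemma clifford_term_bound:
  fixes w :: complex
  assumes "\<nu> \<ge> 0"
  shows "norm (of_real ((-1) ^ n * clifford_coeff \<nu> n) * w ^ n)
    \<le> clifford_coeff \<nu> 0 * exp (sqrt (norm w)) * (inverse (fact n) * sqrt (norm w) ^ n)"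
proof -
  define r where "r = sqrt (norm w)"
  have r: "r \<ge> 0" "norm w = r * r" by (auto simp: r_def)
  have "norm (of_real ((-1) ^ n * clifford_coeff \<nu> n) * w ^ n) = clifford_coeff \<nu> n * (r ^ n * r ^ n)"
    using clifford_coeff_pos[of \<nu> n] assms
    by (simp add: norm_mult norm_power abs_mult r(2) power_mult_distrib)
  also have "\<dots> \<le> clifford_coeff \<nu> 0 / (fact n)\<^sup>2 * (r ^ n * r ^ n)"
    using clifford_coeff_le[OF assms, of n] r by (intro mult_right_mono) auto
  also have "\<dots> = clifford_coeff \<nu> 0 * (inverse (fact n) * r ^ n) * (inverse (fact n) * r ^ n)"
    by (simp add: power2_eq_square divide_inverse)
  also have "\<dots> \<le> clifford_coeff \<nu> 0 * exp r * (inverse (fact n) * r ^ n)"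
  proof -
    have "inverse (fact n) * r ^ n \<le> exp r"
      using sum_le_suminf[OF summable_exp_generic[of r], of "{n}"] r
      by (simp add: exp_def)
    then show ?thesis using r clifford_coeff_pos[of \<nu> 0] assms
      by (intro mult_right_mono mult_left_mono) auto
  qed
  finally show ?thesis by (simp add: r_def)
qed

lemma clifford_summable:
  assumes "\<nu> \<ge> 0"
  shows "summable (\<lambda>n. of_real ((-1) ^ n * clifford_coeff \<nu> n) * (w::complex) ^ n)"
proof (rule summable_comparison_test')
  show "summable (\<lambda>n. clifford_coeff \<nu> 0 * exp (sqrt (norm w)) * (inverse (fact n) * sqrt (norm w) ^ n))"
    using summable_exp_generic[of "sqrt (norm w)"] by (intro summable_mult) simp
qed (use clifford_term_bound[OF assms] in auto)

lemma norm_clifford_le: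
  assumes "\<nu> \<ge> 0"
  shows "norm (clifford \<nu> w) \<le> exp (ln (clifford_coeff \<nu> 0) + 2 * sqrt (norm w))"
proof -
  let ?t = "\<lambda>n. clifford_coeff \<nu> 0 * exp (sqrt (norm w)) * (inverse (fact n) * sqrt (norm w) ^ n)"
  have s: "?t sums (clifford_coeff \<nu> 0 * exp (sqrt (norm w)) * exp (sqrt (norm w)))"
    using exp_converges[of "sqrt (norm w)"] by (intro sums_mult) simp
  have "norm (clifford \<nu> w) \<le> (\<Sum>n. ?t n)"
    unfolding clifford_def by (rule norm_suminf_le) (use s clifford_term_bound[OF assms] in \<open>auto simp: sums_iff\<close>)
  also have "\<dots> = clifford_coeff \<nu> 0 * exp (sqrt (norm w)) * exp (sqrt (norm w))"
    using s by (simp add: sums_iff)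
  also have "\<dots> = exp (ln (clifford_coeff \<nu> 0) + 2 * sqrt (norm w))"
    using clifford_coeff_pos[of \<nu> 0] assms by (simp add: exp_add[symmetric] exp_add mult_exp_exp)
  finally show ?thesis .
qed

lemma clifford_has_field_derivative:
  assumes "\<nu> \<ge> 0"
  shows "(clifford \<nu> has_field_derivative (- clifford (\<nu> + 1) w)) (at w)"
proof -
  have "((\<lambda>w. \<Sum>n. complex_of_real ((-1) ^ n * clifford_coeff \<nu> n) * w ^ n) has_field_derivative
      (\<Sum>n. diffs (\<lambda>n. complex_of_real ((-1) ^ n * clifford_coeff \<nu> n)) n * w ^ n)) (at w)"
    by (rule termdiffs_strong_converges_everywhere) (rule clifford_summable[OF assms])
  moreover have "diffs (\<lambda>n. complex_of_real ((-1) ^ n * clifford_coeff \<nu> n)) n * w ^ n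
      = - (of_real ((-1) ^ n * clifford_coeff (\<nu> + 1) n) * w ^ n)" for n
    using clifford_coeff_shift(2)[of \<nu> n] assms by (simp add: diffs_def)
  ultimately show ?thesis
    using suminf_minus[OF clifford_summable[of "\<nu> + 1" w]] assms
    by (simp add: clifford_def[abs_def])
qed

lemma clifford_holomorphic: "\<nu> \<ge> 0 \<Longrightarrow> clifford \<nu> holomorphic_on A"
  using clifford_has_field_derivative field_differentiable_at_within
  by (auto simp: holomorphic_on_def field_differentiable_def) blast

text \<open>The three-term recurrence of Bessel functions at the orders \<nu>, \<nu>+1, \<nu>+2,
  written at w = x^2/4. As differentiation raises the order by one and changes the sign, it is also
  Bessel's differential equation.\<close>

lemma clifford_recurrence:
  assumes "\<nu> \<ge> 0"
  shows "w * clifford (\<nu> + 2) w - of_real (\<nu> + 1) * clifford (\<nu> + 1) w + clifford \<nu> w = 0"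
proof -
  define a where "a \<mu> n = complex_of_real ((-1) ^ n * clifford_coeff \<mu> n) * w ^ n" for \<mu> n
  have s: "a \<mu> sums clifford \<mu> w" if "\<mu> \<ge> 0" for \<mu>
    unfolding a_def[abs_def] clifford_def by (rule summable_sums[OF clifford_summable[OF that]])
  define f where "f n = of_real (\<nu> + 1) * a (\<nu> + 1) n - a \<nu> n" for n
  have f: "f sums (of_real (\<nu> + 1) * clifford (\<nu> + 1) w - clifford \<nu> w)"
    unfolding f_def[abs_def] using assms by (intro sums_diff sums_mult s) auto
  \<comment> \<open>The constant terms cancel, so a factor w can be taken out of the series.\<close>
  have f0: "f 0 = 0" using clifford_coeff_shift(1)[of \<nu> 0] assms by (simp add: f_def a_def)
  have "f (Suc n) = w * a (\<nu> + 2) n" for n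
  proof -
    have 1: "clifford_coeff \<nu> (Suc n) = (real (Suc n) + \<nu> + 1) * clifford_coeff (\<nu> + 1) (Suc n)"
      by (rule clifford_coeff_shift) (use assms in simp)
    have 2: "clifford_coeff (\<nu> + 2) n = real (Suc n) * clifford_coeff (\<nu> + 1) (Suc n)"
      using clifford_coeff_shift(2)[of "\<nu> + 1" n] assms by (simp add: add.assoc)
    have 3: "(\<nu> + 1) * clifford_coeff (\<nu> + 1) (Suc n) - clifford_coeff \<nu> (Suc n) = - clifford_coeff (\<nu> + 2) n"
      unfolding 1 2 by (simp add: algebra_simps)
    have "f (Suc n) = of_real ((-1) ^ Suc n * ((\<nu> + 1) * clifford_coeff (\<nu> + 1) (Suc n)
        - clifford_coeff \<nu> (Suc n))) * w ^ Suc n"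
      by (simp add: f_def a_def algebra_simps)
    then show ?thesis unfolding 3 by (simp add: a_def)
  qed
  then have "(\<lambda>n. f (Suc n)) sums (w * clifford (\<nu> + 2) w)"
    using sums_mult[OF s[of "\<nu> + 2"], of w] assms by simp
  then have "f sums (w * clifford (\<nu> + 2) w)" using sums_Suc_iff[of f] f0 by simp
  from sums_unique2[OF this f] show ?thesis by simp
qed

subsection \<open>Growth along the imaginary axis\<close>

lemma cosh_sums: "(\<lambda>n. x ^ (2 * n) / fact (2 * n)) sums cosh (x::real)"
proof -
  define f where "f n = (if even n then x ^ n /\<^sub>R fact n else 0)" for n
  have "f sums cosh x" unfolding f_def[abs_def] by (rule cosh_converges)
  moreover have "strict_mono (\<lambda>n::nat. 2 * n)" by (rule strict_monoI) simp
  moreover have "f n = 0" if "n \<notin> range (\<lambda>n. 2 * n)" for n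
    using that by (auto simp: f_def elim!: evenE)
  ultimately have "(\<lambda>n. f (2 * n)) sums cosh x" using sums_mono_reindex[of "\<lambda>n. 2 * n" f] by blast
  then show ?thesis by (simp add: f_def divide_inverse mult.commute)
qed

lemma Gamma_nat_plus_half: "Gamma (real n + 1/2) = sqrt pi * fact (2 * n) / (4 ^ n * fact n)"
proof (induction n)
  case (Suc n)
  have *: "Gamma (real (Suc n) + 1/2) = (real n + 1/2) * Gamma (real n + 1/2)"
    using Gamma_plus1[of "real n + 1/2"] by (force simp: add_ac elim!: nonpos_Ints_cases)
  have "(real n + 1/2) * Gamma (real n + 1/2) = sqrt pi * (2 * N * (2 * real n + 1) * fact (2 * n)) / (4 * 4 ^ n * (N * fact n))"
    if "N > 0" for N unfolding Suc.IH using that by (simp add: field_simps)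
  from this[of "real (Suc n)"] have "(real n + 1/2) * Gamma (real n + 1/2)
      = sqrt pi * fact (2 * Suc n) / (4 ^ Suc n * fact (Suc n))"
    by (simp add: algebra_simps)
  then show ?case unfolding * .
qed (simp add: Gamma_one_half_real)

text \<open>The weight of Poisson's integral for the modified Bessel function; Laplace's method applied to
  that integral gives the constant in the growth of \<open>C\<^sub>\<nu>\<close> on the negative axis.\<close>
definition poisson_weight :: "real \<Rightarrow> real \<Rightarrow> real" where
  "poisson_weight \<mu> u = indicator {0..1} u * (1 - u\<^sup>2) powr \<mu>"

lemma poisson_weight_measurable [measurable]: "poisson_weight \<mu> \<in> borel_measurable borel"
  unfolding poisson_weight_def by measurable

text \<open>The substitution t = u^2 turns the Beta integrand into the weight times an even
  power.\<close>

lemma poisson_weight_moment: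
  assumes "\<mu> > -1"
  shows "integrable lborel (\<lambda>u. poisson_weight \<mu> u * u ^ (2 * n))"
    and "(\<integral>u. poisson_weight \<mu> u * u ^ (2 * n) \<partial>lborel) = Beta (real n + 1/2) (\<mu> + 1) / 2"
proof -
  define f where "f t = t powr (real n + 1/2 - 1) * (1 - t) powr (\<mu> + 1 - 1)" for t :: real
  have int: "set_integrable lborel {0..1} f"
    unfolding f_def using assms by (intro integrable_Beta) auto
  have val: "(LINT t:{0..1}|lborel. f t) = Beta (real n + 1/2) (\<mu> + 1)"
    using set_borel_integral_eq_integral(2)[OF int] has_integral_Beta_real[of "real n + 1/2" "\<mu> + 1"] assms
    by (simp add: f_def[abs_def] integral_unique)
  have d: "((\<lambda>u::real. u\<^sup>2) has_real_derivative 2 * u) (at u)" for u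
    by (auto intro!: derivative_eq_intros)
  have c: "continuous_on {0..1::real} (\<lambda>u. 2 * u)" by (intro continuous_intros)
  have int': "set_integrable lborel {0\<^sup>2..1\<^sup>2} f" using int by simp
  note sub = integral_substitution[of "\<lambda>u. u\<^sup>2" 0 1 f "\<lambda>u. 2 * u", OF int' d c]
  \<comment> \<open>The equation fails at u = 0 when n = 0: the left side is 0 there and the right
    side 2. Hence the detour through equality almost everywhere.\<close>
  have eq: "f (u\<^sup>2) * (2 * u) * indicator {0..1} u = 2 * (poisson_weight \<mu> u * u ^ (2 * n))" if "u \<noteq> 0" for u
  proof (cases "u \<in> {0..1}")
    case True
    then have u: "u > 0" using that by auto
    have "(u\<^sup>2) powr (real n + 1/2 - 1) * u = u ^ (2 * n)"
    proof -
      have "(u\<^sup>2) powr (real n + 1/2 - 1) = u powr (2 * (real n + 1/2 - 1))"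
        using u powr_powr[of u 2 "real n + 1/2 - 1"] by (simp only: powr_numeral)
      then have "(u\<^sup>2) powr (real n + 1/2 - 1) * u = u powr (2 * (real n + 1/2 - 1)) * u powr 1"
        using u by simp
      also have "\<dots> = u powr (real (2 * n))" unfolding powr_add[symmetric] by (simp add: algebra_simps)
      also have "\<dots> = u ^ (2 * n)" using u by (rule powr_realpow)
      finally show ?thesis .
    qed
    then show ?thesis using True by (simp add: f_def poisson_weight_def)
  qed (simp add: poisson_weight_def)
  have ae: "AE u in lborel. f (u\<^sup>2) * (2 * u) * indicator {0..1} u = 2 * (poisson_weight \<mu> u * u ^ (2 * n))"
    using AE_lborel_singleton[of "0::real"] by eventually_elim (rule eq)
  have m: "(\<lambda>u. f (u\<^sup>2) * (2 * u) * indicator {0..1} u) \<in> borel_measurable lborel"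
    unfolding f_def by measurable
  have "set_integrable lborel {0..1} (\<lambda>u. f (u\<^sup>2) * (2 * u))" by (rule sub(1)) auto
  then have "integrable lborel (\<lambda>u. f (u\<^sup>2) * (2 * u) * indicator {0..1} u)"
    by (simp add: set_integrable_def mult.commute)
  then have "integrable lborel (\<lambda>u. 2 * (poisson_weight \<mu> u * u ^ (2 * n)))"
    by (subst (asm) integrable_cong_AE[OF m _ ae]) measurable
  then show "integrable lborel (\<lambda>u. poisson_weight \<mu> u * u ^ (2 * n))" by simp
  have "(\<integral>u. f (u\<^sup>2) * (2 * u) * indicator {0..1} u \<partial>lborel) = (\<integral>t. f t * indicator {0..1} t \<partial>lborel)"
    using sub(2) by simp
  also have "\<dots> = Beta (real n + 1/2) (\<mu> + 1)"
    using val by (simp add: set_lebesgue_integral_def mult.commute)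
  also have "(\<integral>u. f (u\<^sup>2) * (2 * u) * indicator {0..1} u \<partial>lborel)
      = (\<integral>u. 2 * (poisson_weight \<mu> u * u ^ (2 * n)) \<partial>lborel)"
    by (rule integral_cong_AE[OF m _ ae]) measurable
  finally show "(\<integral>u. poisson_weight \<mu> u * u ^ (2 * n) \<partial>lborel) = Beta (real n + 1/2) (\<mu> + 1) / 2"
    by simp
qed

text \<open>The series of cosh is integrated term by term. The moments are Beta values, and the
  (2n)! in their Gamma(n + 1/2) cancels the denominators of the series. Multiplied by (x/2)^\<nu>,
  the sum is the modified Bessel function.\<close>

lemma poisson_integral:
  assumes \<nu>: "\<nu> > -1/2"
  shows "(\<lambda>n. clifford_coeff \<nu> n * (x / 2) ^ (2 * n)) sums
     (2 / (sqrt pi * Gamma (\<nu> + 1/2)) * (\<integral>u. poisson_weight (\<nu> - 1/2) u * cosh (x * u) \<partial>lborel))"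
proof -
  define \<mu> where "\<mu> = \<nu> - 1/2"
  have \<mu>: "\<mu> > -1" using \<nu> by (simp add: \<mu>_def)
  define t where "t n u = x ^ (2 * n) / fact (2 * n) * (poisson_weight \<mu> u * u ^ (2 * n))" for n u
  have int: "integrable lborel (t n)" for n
    unfolding t_def by (intro integrable_mult_right poisson_weight_moment \<mu>)
  have t0: "t n u \<ge> 0" for n u by (auto simp: t_def poisson_weight_def)
  have cosh: "(\<lambda>n. t n u) sums (poisson_weight \<mu> u * cosh (x * u))" for u
    using sums_mult[OF cosh_sums[of "x * u"], of "poisson_weight \<mu> u"]
    by (simp add: t_def power_mult_distrib mult_ac)
  have m: "Gamma (\<nu> + 1/2) > 0" using \<nu> by (intro Gamma_real_pos) simp
  have moment: "(\<integral>u. t n u \<partial>lborel) = sqrt pi * Gamma (\<nu> + 1/2) / 2 * (clifford_coeff \<nu> n * (x / 2) ^ (2 * n))" for n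
  proof -
    have "(\<integral>u. t n u \<partial>lborel) = x ^ (2 * n) / fact (2 * n) * (Beta (real n + 1/2) (\<mu> + 1) / 2)"
      unfolding t_def by (subst integral_mult_right_zero) (simp add: poisson_weight_moment(2)[OF \<mu>])
    also have "Beta (real n + 1/2) (\<mu> + 1) = sqrt pi * fact (2 * n) / 4 ^ n * Gamma (\<nu> + 1/2) * clifford_coeff \<nu> n"
      unfolding Beta_def Gamma_nat_plus_half by (simp add: clifford_coeff_def \<mu>_def add_ac)
    also have "(4::real) ^ n = 2 ^ (2 * n)" by (simp add: power_mult)
    finally show ?thesis by (simp add: power_divide mult_ac)
  qed
  \<comment> \<open>Needed before sum and integral may be exchanged; on [0,1] the moment of order 2n
    is at most that of order 0.\<close>
  have summ: "summable (\<lambda>n. clifford_coeff \<nu> n * (x / 2) ^ (2 * n))"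
  proof (rule summable_comparison_test')
    let ?I = "\<integral>u. poisson_weight \<mu> u * u ^ (2 * 0) \<partial>lborel"
    show "summable (\<lambda>n. 2 / (sqrt pi * Gamma (\<nu> + 1/2)) * (x ^ (2 * n) / fact (2 * n) * ?I))"
      using cosh_sums[of x] by (intro summable_mult summable_mult2) (auto simp: sums_iff)
    fix n
    have "(\<integral>u. t n u \<partial>lborel) \<le> (\<integral>u. x ^ (2 * n) / fact (2 * n) * (poisson_weight \<mu> u * u ^ (2 * 0)) \<partial>lborel)"
    proof (rule integral_mono[OF int])
      show "integrable lborel (\<lambda>u. x ^ (2 * n) / fact (2 * n) * (poisson_weight \<mu> u * u ^ (2 * 0)))"
        by (intro integrable_mult_right poisson_weight_moment \<mu>)
      show "t n u \<le> x ^ (2 * n) / fact (2 * n) * (poisson_weight \<mu> u * u ^ (2 * 0))" for u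
      proof (cases "u \<in> {0..1}")
        case True
        then have "u ^ (2 * n) \<le> 1" by (intro power_le_one) auto
        then have "poisson_weight \<mu> u * u ^ (2 * n) \<le> poisson_weight \<mu> u * 1"
          by (rule mult_left_mono) (simp add: poisson_weight_def)
        then have "poisson_weight \<mu> u * u ^ (2 * n) \<le> poisson_weight \<mu> u * u ^ (2 * 0)" by simp
        then show ?thesis unfolding t_def by (rule mult_left_mono) auto
      qed (simp add: t_def poisson_weight_def)
    qed
    also have "\<dots> = x ^ (2 * n) / fact (2 * n) * ?I" by (rule integral_mult_right_zero)
    finally have "clifford_coeff \<nu> n * (x / 2) ^ (2 * n) \<le> 2 / (sqrt pi * Gamma (\<nu> + 1/2)) * (x ^ (2 * n) / fact (2 * n) * ?I)"
      using m by (simp add: moment field_simps)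
    then show "norm (clifford_coeff \<nu> n * (x / 2) ^ (2 * n)) \<le> 2 / (sqrt pi * Gamma (\<nu> + 1/2)) * (x ^ (2 * n) / fact (2 * n) * ?I)"
      using clifford_coeff_pos[of \<nu> n] \<nu> by (simp add: abs_mult)
  qed
  have "(\<lambda>n. \<integral>u. t n u \<partial>lborel) sums (\<integral>u. (\<Sum>n. t n u) \<partial>lborel)"
  proof (rule sums_integral[OF int])
    show "AE u in lborel. summable (\<lambda>n. norm (t n u))"
      using cosh t0 by (auto simp: sums_iff)
    show "summable (\<lambda>n. \<integral>u. norm (t n u) \<partial>lborel)"
      using summ t0 by (simp add: moment)
  qed
  also have "(\<lambda>u. \<Sum>n. t n u) = (\<lambda>u. poisson_weight \<mu> u * cosh (x * u))"
    using cosh by (auto simp: sums_iff)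
  finally have "(\<lambda>n. 2 / (sqrt pi * Gamma (\<nu> + 1/2)) * (\<integral>u. t n u \<partial>lborel)) sums
     (2 / (sqrt pi * Gamma (\<nu> + 1/2)) * (\<integral>u. poisson_weight \<mu> u * cosh (x * u) \<partial>lborel))"
    by (rule sums_mult)
  then show ?thesis using m by (simp add: moment \<mu>_def)
qed

text \<open>For large x the mass concentrates at the endpoint u = 1. With u = 1 - v/x the weight is
  close to (2v/x)^\<mu> and exp (-x) cosh (xu) close to exp (-v)/2, which leaves a Gamma
  integral.\<close>

lemma laplace_limit:
  assumes \<mu>: "\<mu> \<ge> 0"
  shows "((\<lambda>x. x powr (\<mu> + 1) * exp (- x) * (\<integral>u. poisson_weight \<mu> u * cosh (x * u) \<partial>lborel))
     \<longlongrightarrow> 2 powr \<mu> / 2 * Gamma (\<mu> + 1)) at_top"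
proof -
  define s where "s x v = x powr \<mu> * exp (- x) * (poisson_weight \<mu> (1 + (- 1 / x) * v) * cosh (x * (1 + (- 1 / x) * v)))" for x v :: real
  \<comment> \<open>A majorant of all \<open>s x\<close> with x > 0, and twice their limit: for v
    \<le> x the second exponential of cosh is at most the first, and in the limit it
    disappears.\<close>
  define w where "w v = 2 powr \<mu> * (indicator {0..} v * v powr (\<mu> + 1 - 1) / exp v)" for v :: real
  have G: "has_bochner_integral lborel (\<lambda>t. indicator {0..} t * t powr (\<mu> + 1 - 1) / exp t) (Gamma (\<mu> + 1))"
    by (rule has_bochner_integral_nn_integral)
       (use Gamma_conv_nn_integral_real[of "\<mu> + 1"] Gamma_real_pos[of "\<mu> + 1"] \<mu> in auto)
  have w: "integrable lborel w" "integral\<^sup>L lborel w = 2 powr \<mu> * Gamma (\<mu> + 1)"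
    using has_bochner_integral_mult_right[OF G, of "2 powr \<mu>"]
    unfolding w_def[abs_def] by (auto simp: has_bochner_integral_iff)
  have s_eq: "s x v = (if v \<le> x \<and> 0 \<le> v then v powr \<mu> * (2 - v / x) powr \<mu> * ((exp (- v) + exp (v - 2 * x)) / 2) else 0)"
    if x: "x > 0" for x v
  proof -
    have i: "1 + (- 1 / x) * v \<in> {0..1} \<longleftrightarrow> v \<le> x \<and> 0 \<le> v" using x by (auto simp: field_simps)
    show ?thesis
    proof (cases "v \<le> x \<and> 0 \<le> v")
      case True
      have "1 - (1 + (- 1 / x) * v)\<^sup>2 = (v / x) * (2 - v / x)"
        by (simp add: power2_eq_square algebra_simps)
      moreover have "((v / x) * (2 - v / x)) powr \<mu> = v powr \<mu> / x powr \<mu> * (2 - v / x) powr \<mu>"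
        using True x by (subst powr_mult) (auto simp: powr_divide field_simps)
      ultimately have "poisson_weight \<mu> (1 + (- 1 / x) * v) = v powr \<mu> / x powr \<mu> * (2 - v / x) powr \<mu>"
        using i True by (simp add: poisson_weight_def)
      moreover have "x * (1 + (- 1 / x) * v) = x - v" using x by (simp add: field_simps)
      moreover have "exp (- x) * cosh (x - v) = (exp (- v) + exp (v - 2 * x)) / 2"
        by (simp add: cosh_def field_simps flip: exp_add)
      ultimately show ?thesis using True x
        by (simp add: s_def)
    next
      case False
      then have *: "poisson_weight \<mu> (1 + (- 1 / x) * v) = 0" using i by (simp add: poisson_weight_def)
      show ?thesis unfolding s_def if_not_P[OF False] * by simp
    qed
  qed
  have lim: "((\<lambda>x. s x v) \<longlongrightarrow> w v / 2) at_top" for v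
  proof (cases "v \<ge> 0")
    case True
    have "((\<lambda>x. 2 - v / x) \<longlongrightarrow> 2) at_top" by real_asymp
    then have a: "((\<lambda>x. (2 - v / x) powr \<mu>) \<longlongrightarrow> 2 powr \<mu>) at_top" by (intro tendsto_intros) auto
    have b: "((\<lambda>x. exp (v - 2 * x)) \<longlongrightarrow> 0) at_top" by real_asymp
    have "((\<lambda>x. v powr \<mu> * (2 - v / x) powr \<mu> * ((exp (- v) + exp (v - 2 * x)) / 2)) \<longlongrightarrow>
        v powr \<mu> * 2 powr \<mu> * ((exp (- v) + 0) / 2)) at_top"
      by (intro tendsto_intros a b) auto
    moreover have "\<forall>\<^sub>F x in at_top. v powr \<mu> * (2 - v / x) powr \<mu> * ((exp (- v) + exp (v - 2 * x)) / 2) = s x v"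
      using eventually_gt_at_top[of 0] eventually_ge_at_top[of v]
      by eventually_elim (use True in \<open>simp add: s_eq\<close>)
    moreover have "v powr \<mu> * 2 powr \<mu> * ((exp (- v) + 0) / 2) = w v / 2"
      using True by (simp add: w_def exp_minus field_simps)
    ultimately show ?thesis by (simp add: Lim_transform_eventually)
  next
    case False
    have "\<forall>\<^sub>F x in at_top. 0 = s x v"
      using eventually_gt_at_top[of 0] by eventually_elim (use False in \<open>simp add: s_eq\<close>)
    then have "((\<lambda>x. s x v) \<longlongrightarrow> 0) at_top" by (rule Lim_transform_eventually[OF tendsto_const])
    then show ?thesis using False by (simp add: w_def)
  qed
  have bound: "norm (s x v) \<le> w v" if x: "x > 0" for x v
  proof (cases "v \<le> x \<and> 0 \<le> v")
    case True
    have a: "(2 - v / x) powr \<mu> \<le> 2 powr \<mu>" using True x \<mu> by (intro powr_mono2) (auto simp: field_simps)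
    have b: "(exp (- v) + exp (v - 2 * x)) / 2 \<le> exp (- v)" using True by simp
    have "v powr \<mu> * (2 - v / x) powr \<mu> * ((exp (- v) + exp (v - 2 * x)) / 2) \<le> v powr \<mu> * 2 powr \<mu> * exp (- v)"
      by (intro mult_mono a b order_refl mult_nonneg_nonneg) auto
    then show ?thesis using True x by (simp add: s_eq w_def exp_minus field_simps)
  next
    case False
    show ?thesis unfolding s_eq[OF x] if_not_P[OF False] by (simp add: w_def)
  qed
  have "((\<lambda>x. integral\<^sup>L lborel (s x)) \<longlongrightarrow> (\<integral>v. w v / 2 \<partial>lborel)) at_top"
  proof (rule integral_dominated_convergence_at_top[where w = w])
    show "(\<lambda>v. w v / 2) \<in> borel_measurable lborel" unfolding w_def by measurable
    show "s t \<in> borel_measurable lborel" for t unfolding s_def[abs_def] cosh_def by measurable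
    show "\<forall>\<^sub>F x in at_top. AE v in lborel. norm (s x v) \<le> w v"
      using eventually_gt_at_top[of 0] by eventually_elim (use bound in auto)
  qed (use lim w in auto)
  moreover have "\<forall>\<^sub>F x in at_top. integral\<^sup>L lborel (s x)
      = x powr (\<mu> + 1) * exp (- x) * (\<integral>u. poisson_weight \<mu> u * cosh (x * u) \<partial>lborel)"
    using eventually_gt_at_top[of 0]
  proof eventually_elim
    case (elim x)
    have "(\<integral>u. poisson_weight \<mu> u * cosh (x * u) \<partial>lborel) = \<bar>- 1 / x\<bar> *\<^sub>R
        (\<integral>v. poisson_weight \<mu> (1 + (- 1 / x) * v) * cosh (x * (1 + (- 1 / x) * v)) \<partial>lborel)"
      by (rule lborel_integral_real_affine) (use elim in simp)
    moreover have "integral\<^sup>L lborel (s x) = x powr \<mu> * exp (- x) *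
        (\<integral>v. poisson_weight \<mu> (1 + (- 1 / x) * v) * cosh (x * (1 + (- 1 / x) * v)) \<partial>lborel)"
      unfolding s_def[abs_def] by (rule integral_mult_right_zero)
    ultimately show ?case using elim by (simp add: powr_add)
  qed
  ultimately have "((\<lambda>x. x powr (\<mu> + 1) * exp (- x) * (\<integral>u. poisson_weight \<mu> u * cosh (x * u) \<partial>lborel))
      \<longlongrightarrow> (\<integral>v. w v / 2 \<partial>lborel)) at_top"
    by (rule Lim_transform_eventually)
  then show ?thesis by (simp add: w(2))
qed

text \<open>The classical equivalence of the modified Bessel function with exp x / sqrt (2 pi x), in
  the normalisation of \<open>clifford_coeff\<close>.\<close>

lemma clifford_asymptotics:
  assumes \<nu>: "\<nu> \<ge> 1/2"
  shows "((\<lambda>x. x powr (\<nu> + 1/2) * exp (- x) * (\<Sum>n. clifford_coeff \<nu> n * (x / 2) ^ (2 * n)))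
    \<longlongrightarrow> 2 powr \<nu> / (sqrt 2 * sqrt pi)) at_top"
proof -
  have g: "Gamma (\<nu> + 1/2) > 0" using \<nu> by (intro Gamma_real_pos) simp
  have "((\<lambda>x. 2 / (sqrt pi * Gamma (\<nu> + 1/2)) * (x powr (\<nu> - 1/2 + 1) * exp (- x) *
      (\<integral>u. poisson_weight (\<nu> - 1/2) u * cosh (x * u) \<partial>lborel))) \<longlongrightarrow>
      2 / (sqrt pi * Gamma (\<nu> + 1/2)) * (2 powr (\<nu> - 1/2) / 2 * Gamma (\<nu> - 1/2 + 1))) at_top"
    by (intro tendsto_mult tendsto_const laplace_limit) (use \<nu> in simp)
  moreover have "2 / (sqrt pi * Gamma (\<nu> + 1/2)) * (2 powr (\<nu> - 1/2) / 2 * Gamma (\<nu> - 1/2 + 1))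
      = 2 powr \<nu> / (sqrt 2 * sqrt pi)"
  proof -
    have "2 powr (\<nu> - 1/2) = 2 powr \<nu> / sqrt 2" unfolding powr_diff by (simp add: powr_half_sqrt)
    moreover have "\<nu> - 1/2 + 1 = \<nu> + 1/2" by simp
    ultimately show ?thesis using g by (simp only:) simp
  qed
  moreover have "2 / (sqrt pi * Gamma (\<nu> + 1/2)) * (x powr (\<nu> - 1/2 + 1) * exp (- x) *
      (\<integral>u. poisson_weight (\<nu> - 1/2) u * cosh (x * u) \<partial>lborel))
      = x powr (\<nu> + 1/2) * exp (- x) * (\<Sum>n. clifford_coeff \<nu> n * (x / 2) ^ (2 * n))" for x
    using poisson_integral[of \<nu> x] \<nu> by (simp add: sums_iff add_ac)
  ultimately show ?thesis by simp
qed

subsection \<open>Reality and simplicity of the zeros\<close>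

definition clifford_real :: "real \<Rightarrow> real \<Rightarrow> real" where
  "clifford_real \<nu> t = Re (clifford \<nu> (of_real t))"

lemma clifford_of_real:
  assumes "\<nu> \<ge> 0"
  shows "clifford \<nu> (of_real t) = of_real (clifford_real \<nu> t)"
    and "(\<lambda>n. (-1) ^ n * clifford_coeff \<nu> n * t ^ n) sums clifford_real \<nu> t"
proof -
  have "(\<lambda>n. complex_of_real ((-1) ^ n * clifford_coeff \<nu> n) * of_real t ^ n) sums clifford \<nu> (of_real t)"
    unfolding clifford_def by (rule summable_sums[OF clifford_summable[OF assms]])
  then have s: "(\<lambda>n. complex_of_real ((-1) ^ n * clifford_coeff \<nu> n * t ^ n)) sums clifford \<nu> (of_real t)"
    by simp
  from sums_Re[OF s] show r: "(\<lambda>n. (-1) ^ n * clifford_coeff \<nu> n * t ^ n) sums clifford_real \<nu> t"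
    unfolding clifford_real_def Re_complex_of_real .
  from sums_unique2[OF s sums_of_real[OF r]]
  show "clifford \<nu> (of_real t) = of_real (clifford_real \<nu> t)" .
qed

lemma clifford_0: "clifford \<nu> 0 = of_real (clifford_coeff \<nu> 0)"
  using powser_zero[of "\<lambda>n. complex_of_real ((-1) ^ n * clifford_coeff \<nu> n)"]
  by (simp add: clifford_def)

text \<open>For t \<le> 0 all terms of the series are nonnegative, and the constant term is
  positive.\<close>

lemma clifford_nonzero_nonpos:
  assumes "\<nu> \<ge> 0" "t \<le> 0"
  shows "clifford \<nu> (of_real t) \<noteq> 0"
proof -
  have s: "(\<lambda>n. (-1) ^ n * clifford_coeff \<nu> n * t ^ n) sums clifford_real \<nu> t"
    by (rule clifford_of_real[OF assms(1)])
  have "(-1) ^ n * clifford_coeff \<nu> n * t ^ n \<ge> 0" for n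
  proof -
    have "(-1) ^ n * t ^ n = (- t) ^ n" by (subst power_mult_distrib[symmetric]) simp
    then have "clifford_coeff \<nu> n * ((-1) ^ n * t ^ n) = clifford_coeff \<nu> n * (- t) ^ n" by (simp only:)
    then have "(-1) ^ n * clifford_coeff \<nu> n * t ^ n = clifford_coeff \<nu> n * (- t) ^ n"
      by (simp only: mult_ac)
    moreover have "clifford_coeff \<nu> n * (- t) ^ n \<ge> 0"
      using clifford_coeff_pos[of \<nu> n] assms by (intro mult_nonneg_nonneg zero_le_power) auto
    ultimately show ?thesis by (simp only:)
  qed
  then have "sum (\<lambda>n. (-1) ^ n * clifford_coeff \<nu> n * t ^ n) {0} \<le> clifford_real \<nu> t"
    using sum_le_suminf[of "\<lambda>n. (-1) ^ n * clifford_coeff \<nu> n * t ^ n" "{0}"] s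
    by (simp add: sums_iff)
  then have "clifford_real \<nu> t > 0" using clifford_coeff_pos[of \<nu> 0] assms by simp
  then show ?thesis using clifford_of_real(1)[OF assms(1)] by simp
qed

text \<open>As w is not 0, zeros at two consecutive orders propagate through the recurrence to all
  higher orders, that is, to all derivatives at w; the function would vanish identically.\<close>

lemma clifford_zero_simple:
  assumes \<nu>: "\<nu> \<ge> 0" and w: "clifford \<nu> w = 0"
  shows "clifford (\<nu> + 1) w \<noteq> 0"
proof
  assume w1: "clifford (\<nu> + 1) w = 0"
  have C0: "clifford \<nu> 0 \<noteq> 0" using clifford_nonzero_nonpos[OF \<nu>, of 0] by simp
  have w0: "w \<noteq> 0" using w C0 by auto
  have all: "clifford (\<nu> + real n) w = 0 \<and> clifford (\<nu> + real n + 1) w = 0" for n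
  proof (induction n)
    case (Suc n)
    have "w * clifford (\<nu> + real n + 2) w = 0"
      using clifford_recurrence[of "\<nu> + real n" w] Suc \<nu> by simp
    then show ?case using Suc w0 by (simp add: add_ac)
  qed (use w w1 in simp)
  have der: "(deriv ^^ n) (clifford \<nu>) = (\<lambda>z. (-1) ^ n * clifford (\<nu> + real n) z)" for n
  proof (induction n)
    case (Suc n)
    have "deriv (\<lambda>z. (-1) ^ n * clifford (\<nu> + real n) z) z = (-1) ^ n * (- clifford (\<nu> + real n + 1) z)" for z
      by (rule DERIV_imp_deriv) (intro DERIV_cmult clifford_has_field_derivative, use \<nu> in simp)
    then show ?case by (simp add: Suc.IH add_ac)
  qed simp
  have "clifford \<nu> 0 = 0"
    by (rule holomorphic_fun_eq_0_on_connected[of "clifford \<nu>" UNIV w])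
       (use clifford_holomorphic[OF \<nu>] all der in auto)
  then show False using C0 by simp
qed

text \<open>Lommel's argument: in \<open>x\<close>, the function \<open>x\<^bsup>2\<nu>+2\<^esup> Im (w C\<^sub>\<nu>\<^sub>+\<^sub>1(w x\<^sup>2) cnj (C\<^sub>\<nu>(w x\<^sup>2)))\<close>
  has the derivative \<open>2 x\<^bsup>2\<nu>+1\<^esup> Im w |C\<^sub>\<nu>(w x\<^sup>2)|\<^sup>2\<close>, which has a fixed sign.\<close>
lemma clifford_zero_real:
  assumes \<nu>: "\<nu> \<ge> 0" and w: "clifford \<nu> w = 0"
  shows "Im w = 0"
proof (rule ccontr)
  assume nz: "Im w \<noteq> 0"
  define A where "A x = clifford \<nu> (w * of_real x ^ 2)" for x
  define B where "B x = clifford (\<nu> + 1) (w * of_real x ^ 2)" for x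
  define C where "C x = clifford (\<nu> + 2) (w * of_real x ^ 2)" for x
  have sq: "((\<lambda>x. w * of_real x ^ 2) has_vector_derivative 2 * w * of_real x) (at x)" for x :: real
    by (rule has_vector_derivative_real_field[of "\<lambda>z. w * z ^ 2"]) (auto intro!: derivative_eq_intros)
  have A: "(A has_vector_derivative (2 * w * of_real x * (- B x))) (at x)" for x
    unfolding A_def B_def
    by (rule field_vector_diff_chain_at[OF sq clifford_has_field_derivative[OF \<nu>], unfolded o_def])
  have B: "(B has_vector_derivative (2 * w * of_real x * (- C x))) (at x)" for x
    using field_vector_diff_chain_at[OF sq clifford_has_field_derivative[of "\<nu> + 1"], unfolded o_def] \<nu>
    by (simp add: B_def[abs_def] C_def[abs_def] add.assoc)
  have rec: "w * of_real x ^ 2 * C x = of_real (\<nu> + 1) * B x - A x" for x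
    using clifford_recurrence[OF \<nu>, of "w * of_real x ^ 2"]
    by (simp add: A_def B_def C_def algebra_simps eq_neg_iff_add_eq_0)
  define P where "P x = w * B x * cnj (A x)" for x
  define P' where "P' x = w * (2 * w * of_real x * (- C x)) * cnj (A x)
      + w * B x * cnj (2 * w * of_real x * (- B x))" for x
  have P: "(P has_vector_derivative P' x) (at x)" for x
    unfolding P_def[abs_def] P'_def
    by (rule has_vector_derivative_eq_rhs,
        rule has_vector_derivative_mult[OF has_vector_derivative_mult_right[OF B] has_vector_derivative_cnj[OF A]])
       (simp add: algebra_simps)
  have ImP: "((\<lambda>x. Im (P x)) has_real_derivative Im (P' x)) (at x)" for x
    using bounded_linear.has_vector_derivative[OF bounded_linear_Im P]
    by (simp add: has_real_derivative_iff_has_vector_derivative)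
  \<comment> \<open>Division by \<open>Im w\<close> makes the derivative nonnegative in both
    half-planes.\<close>
  define D where "D x = x powr (2 * \<nu> + 2) * (Im (P x) / Im w)" for x
  have D: "(D has_real_derivative (2 * x powr (2 * \<nu> + 1) * (norm (A x))\<^sup>2)) (at x)" if x: "x > 0" for x
  proof -
    have "(D has_real_derivative ((2 * \<nu> + 2) * x powr (2 * \<nu> + 2 - 1) * (Im (P x) / Im w)
        + x powr (2 * \<nu> + 2) * (Im (P' x) / Im w))) (at x)"
      unfolding D_def[abs_def]
      by (rule derivative_eq_intros ImP x refl | simp add: x nz)+
    \<comment> \<open>The recurrence eliminates \<open>C\<close>; the term with \<open>B\<close> is
      real and drops out of the imaginary part.\<close>
    moreover have "x * P' x = - (2 * (\<nu> + 1)) * P x + 2 * w * (norm (A x))\<^sup>2 - 2 * (x\<^sup>2 * (norm w)\<^sup>2 * (norm (B x))\<^sup>2)"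
    proof -
      have "x * P' x = w * (- 2 * (w * of_real x ^ 2 * C x)) * cnj (A x) - 2 * of_real (x\<^sup>2) * (w * cnj w) * (B x * cnj (B x))"
        by (simp add: P'_def algebra_simps power2_eq_square)
      also have "\<dots> = - (2 * (\<nu> + 1)) * P x + 2 * w * (A x * cnj (A x)) - 2 * of_real (x\<^sup>2) * (w * cnj w) * (B x * cnj (B x))"
        unfolding rec P_def by (simp add: algebra_simps)
      finally show ?thesis by (simp add: complex_norm_square[symmetric] mult_ac)
    qed
    then have "x * Im (P' x) = - (2 * (\<nu> + 1)) * Im (P x) + 2 * Im w * (norm (A x))\<^sup>2"
      by (auto simp: complex_eq_iff power2_eq_square)
    then have "x powr (2 * \<nu> + 2) * Im (P' x) = x powr (2 * \<nu> + 1) * (- (2 * (\<nu> + 1)) * Im (P x) + 2 * Im w * (norm (A x))\<^sup>2)"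
      using x powr_add[of x "2 * \<nu> + 1" 1] by (simp add: add.assoc mult.assoc)
    then have "(2 * \<nu> + 2) * x powr (2 * \<nu> + 2 - 1) * (Im (P x) / Im w) + x powr (2 * \<nu> + 2) * (Im (P' x) / Im w)
        = 2 * x powr (2 * \<nu> + 1) * (norm (A x))\<^sup>2"
      using nz by (simp add: field_simps)
    ultimately show ?thesis by simp
  qed
  have contA: "continuous_on S A" for S
    by (rule continuous_on_vector_derivative[OF has_vector_derivative_at_within[OF A]])
  have contP: "continuous_on S P" for S
    by (rule continuous_on_vector_derivative[OF has_vector_derivative_at_within[OF P]])
  have contD: "continuous_on {0..1} D"
    unfolding D_def using \<nu> nz
    by (intro continuous_intros continuous_on_powr' contP) auto
  have D0: "D 0 = 0" by (simp add: D_def)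
  \<comment> \<open>The supposed zero w is the argument at x = 1. Monotone and zero at both ends,
    \<open>D\<close> vanishes on [0,1], and so does \<open>A\<close> inside.\<close>
  have D1: "D 1 = 0" using w by (simp add: D_def P_def A_def)
  have mono: "D x \<le> D y" if "0 \<le> x" "x \<le> y" "y \<le> 1" for x y
  proof (rule DERIV_nonneg_imp_increasing_open[OF that(2)])
    show "\<exists>d. (D has_real_derivative d) (at u) \<and> 0 \<le> d" if "x < u" "u < y" for u
      using D[of u] that \<open>0 \<le> x\<close>
      by (intro exI[of _ "2 * u powr (2 * \<nu> + 1) * (norm (A u))\<^sup>2"] conjI) auto
    show "continuous_on {x..y} D" by (rule continuous_on_subset[OF contD]) (use that in auto)
  qed
  have Dz: "D x = 0" if "0 \<le> x" "x \<le> 1" for x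
    using mono[of 0 x] mono[of x 1] that D0 D1 by simp
  have Az: "A x = 0" if x: "0 < x" "x < 1" for x
  proof -
    have "(D has_real_derivative 0) (at x)"
      by (rule has_field_derivative_transform_within_open[of "\<lambda>_. 0" _ _ "{0<..<1}"])
         (use x Dz in auto)
    from DERIV_unique[OF this D[OF x(1)]] show ?thesis using x by simp
  qed
  have "A 0 = 0"
  proof (rule continuous_constant_on_closure[of "{0<..<1}" A 0 0])
    show "continuous_on (closure {0<..<1}) A" by (rule contA)
  qed (use Az in auto)
  then have "clifford \<nu> (of_real 0) = 0" by (simp add: A_def)
  then show False using clifford_nonzero_nonpos[OF \<nu>, of 0] by simp
qed

lemma clifford_real_has_derivative:
  assumes \<nu>: "\<nu> \<ge> 0"
  shows "(clifford_real \<nu> has_real_derivative (- clifford_real (\<nu> + 1) t)) (at t)"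
proof -
  have "((\<lambda>t. clifford \<nu> (of_real t)) has_vector_derivative (- clifford (\<nu> + 1) (of_real t))) (at t)"
    by (rule has_vector_derivative_real_field[OF clifford_has_field_derivative[OF \<nu>]])
  from bounded_linear.has_vector_derivative[OF bounded_linear_Re this]
  show ?thesis by (simp add: has_real_derivative_iff_has_vector_derivative clifford_real_def[abs_def])
qed

lemma clifford_real_recurrence:
  assumes "\<nu> \<ge> 0"
  shows "t * clifford_real (\<nu> + 2) t = (\<nu> + 1) * clifford_real (\<nu> + 1) t - clifford_real \<nu> t"
proof -
  have "Re (of_real t * clifford (\<nu> + 2) (of_real t) - of_real (\<nu> + 1) * clifford (\<nu> + 1) (of_real t) + clifford \<nu> (of_real t)) = 0"
    unfolding clifford_recurrence[OF assms] by simp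
  then show ?thesis using assms by (simp add: clifford_of_real(1))
qed

text \<open>An alternating series with decreasing terms is at least the sum of its first two. In x =
  2 sqrt t this reaches up to x = 2, beyond pi/2, which is all that is needed about the first
  zero.\<close>

lemma clifford_real_pos_initial:
  assumes \<nu>: "\<nu> \<ge> 0" and t: "0 \<le> t" "t < 1"
  shows "clifford_real \<nu> t > 0"
proof -
  define a where "a n = clifford_coeff \<nu> n * t ^ n" for n
  have p: "clifford_coeff \<nu> n > 0" for n using \<nu> by (intro clifford_coeff_pos) simp
  have s: "(\<lambda>n. (-1) ^ n * a n) sums clifford_real \<nu> t"
    using clifford_of_real(2)[OF \<nu>, of t] by (simp add: a_def mult.assoc)
  have le: "clifford_coeff \<nu> (Suc n) \<le> clifford_coeff \<nu> n" for n
  proof -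
    have "real (Suc n) * (real n + \<nu> + 1) \<ge> 1 * 1" using \<nu> by (intro mult_mono) auto
    then show ?thesis using \<nu> p[of n] by (simp add: clifford_coeff_Suc divide_le_eq del: of_nat_Suc)
  qed
  have mono: "a (Suc n) \<le> a n" for n
  proof -
    have "a (Suc n) = clifford_coeff \<nu> (Suc n) * t ^ n * t" by (simp add: a_def)
    also have "\<dots> \<le> clifford_coeff \<nu> n * t ^ n * 1"
      using le[of n] p[of "Suc n"] p[of n] t by (intro mult_mono) auto
    finally show ?thesis by (simp add: a_def)
  qed
  have "(-1) ^ n * clifford_coeff \<nu> n * (- t) ^ n = a n" for n
  proof -
    have "(-1::real) ^ n * (- t) ^ n = t ^ n" by (subst power_mult_distrib[symmetric]) simp
    then have "clifford_coeff \<nu> n * ((-1) ^ n * (- t) ^ n) = a n" by (simp only: a_def)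
    then show ?thesis by (simp only: mult_ac)
  qed
  then have "summable a" using clifford_of_real(2)[OF \<nu>, of "- t"] by (simp add: sums_iff)
  then have "a \<longlonglongrightarrow> 0" by (rule summable_LIMSEQ_zero)
  from summable_Leibniz'(2)[OF this _ mono, of 1] t p
  have "(\<Sum>i<2 * 1. (-1) ^ i * a i) \<le> (\<Sum>i. (-1) ^ i * a i)" by (simp add: a_def less_imp_le)
  then have "a 0 - a 1 \<le> clifford_real \<nu> t" using s by (simp add: numeral_2_eq_2 sums_iff)
  moreover have "clifford_coeff \<nu> (Suc 0) * t \<le> clifford_coeff \<nu> 0 * t"
    by (rule mult_right_mono[OF le t(1)])
  moreover have "clifford_coeff \<nu> 0 * t < clifford_coeff \<nu> 0 * 1"
    by (rule mult_strict_left_mono[OF t(2) p])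
  ultimately show ?thesis by (simp add: a_def)
qed

text \<open>A multiple of \<open>sqrt x * J\<^sub>\<nu> x\<close>, which removes the first order term from Bessel's equation.\<close>
definition bessel_nf :: "real \<Rightarrow> real \<Rightarrow> real" where
  "bessel_nf \<nu> x = x powr (\<nu> + 1/2) * clifford_real \<nu> (x\<^sup>2 / 4)"

definition bessel_nf' :: "real \<Rightarrow> real \<Rightarrow> real" where
  "bessel_nf' \<nu> x = (\<nu> + 1/2) * x powr (\<nu> - 1/2) * clifford_real \<nu> (x\<^sup>2 / 4)
     - x powr (\<nu> + 3/2) / 2 * clifford_real (\<nu> + 1) (x\<^sup>2 / 4)"

lemma bessel_nf_ode:
  assumes \<nu>: "\<nu> \<ge> 0" and x: "x > 0"
  shows "(bessel_nf \<nu> has_real_derivative bessel_nf' \<nu> x) (at x)"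
    and "(bessel_nf' \<nu> has_real_derivative (- (1 - (\<nu>\<^sup>2 - 1/4) / x\<^sup>2) * bessel_nf \<nu> x)) (at x)"
proof -
  have d: "((\<lambda>x. clifford_real \<mu> (x\<^sup>2 / 4)) has_real_derivative (- clifford_real (\<mu> + 1) (x\<^sup>2 / 4) * (x / 2))) (at x)"
    if "\<mu> \<ge> 0" for \<mu>
    by (rule DERIV_chain'[OF _ clifford_real_has_derivative[OF that]]) (auto intro!: derivative_eq_intros)
  \<comment> \<open>Writing all powers as multiples of this one turns both claims into polynomial
    identities.\<close>
  define p where "p = x powr (\<nu> - 3/2)"
  have pw: "x powr (\<nu> - 1/2) = p * x" "x powr (\<nu> + 1/2) = p * x ^ 2" "x powr (\<nu> + 3/2) = p * x ^ 3"
    using x powr_add[of x "\<nu> - 3/2" 1] powr_add[of x "\<nu> - 3/2" 2] powr_add[of x "\<nu> - 3/2" 3]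
    by (simp_all add: p_def powr_numeral add_ac)
  have pd: "((\<lambda>x. x powr r) has_real_derivative r * x powr (r - 1)) (at x)" for r
    by (rule has_real_derivative_powr[OF x])
  have "(bessel_nf \<nu> has_real_derivative ((\<nu> + 1/2) * x powr (\<nu> + 1/2 - 1) * clifford_real \<nu> (x\<^sup>2 / 4)
      + x powr (\<nu> + 1/2) * (- clifford_real (\<nu> + 1) (x\<^sup>2 / 4) * (x / 2)))) (at x)"
    unfolding bessel_nf_def[abs_def]
    by (rule DERIV_cong[OF DERIV_mult[OF pd d[OF \<nu>]]]) simp
  moreover have "(\<nu> + 1/2) * x powr (\<nu> + 1/2 - 1) * clifford_real \<nu> (x\<^sup>2 / 4)
      + x powr (\<nu> + 1/2) * (- clifford_real (\<nu> + 1) (x\<^sup>2 / 4) * (x / 2)) = bessel_nf' \<nu> x"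
  proof -
    have "\<nu> + 1/2 - 1 = \<nu> - 1/2" by simp
    then show ?thesis unfolding bessel_nf'_def pw by (simp only: pw) (simp add: power3_eq_cube power2_eq_square)
  qed
  ultimately show "(bessel_nf \<nu> has_real_derivative bessel_nf' \<nu> x) (at x)" by simp
  define f where "f = clifford_real \<nu> (x\<^sup>2 / 4)"
  define g where "g = clifford_real (\<nu> + 1) (x\<^sup>2 / 4)"
  define h where "h = clifford_real (\<nu> + 1 + 1) (x\<^sup>2 / 4)"
  \<comment> \<open>The second derivative brings in the order \<nu>+2; the recurrence removes it
    again.\<close>
  have rec: "x\<^sup>2 / 4 * h = (\<nu> + 1) * g - f"
    using clifford_real_recurrence[OF \<nu>, of "x\<^sup>2 / 4"] by (simp add: f_def g_def h_def add.assoc)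
  have "(bessel_nf' \<nu> has_real_derivative ((\<nu> + 1/2) * ((\<nu> - 1/2) * x powr (\<nu> - 1/2 - 1) * f + x powr (\<nu> - 1/2) * (- g * (x / 2)))
      - ((\<nu> + 3/2) * x powr (\<nu> + 3/2 - 1) / 2 * g + x powr (\<nu> + 3/2) / 2 * (- h * (x / 2))))) (at x)"
  proof -
    have "((\<lambda>x. (\<nu> + 1/2) * (x powr (\<nu> - 1/2) * clifford_real \<nu> (x\<^sup>2 / 4))
        - 1/2 * (x powr (\<nu> + 3/2) * clifford_real (\<nu> + 1) (x\<^sup>2 / 4))) has_real_derivative
        ((\<nu> + 1/2) * ((\<nu> - 1/2) * x powr (\<nu> - 1/2 - 1) * f + - g * (x / 2) * x powr (\<nu> - 1/2))
         - 1/2 * ((\<nu> + 3/2) * x powr (\<nu> + 3/2 - 1) * g + - h * (x / 2) * x powr (\<nu> + 3/2)))) (at x)"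
      unfolding f_def g_def h_def using \<nu>
      by (intro DERIV_diff DERIV_cmult DERIV_mult pd d) auto
    moreover have "bessel_nf' \<nu> = (\<lambda>x. (\<nu> + 1/2) * (x powr (\<nu> - 1/2) * clifford_real \<nu> (x\<^sup>2 / 4))
        - 1/2 * (x powr (\<nu> + 3/2) * clifford_real (\<nu> + 1) (x\<^sup>2 / 4)))"
      by (rule ext) (simp add: bessel_nf'_def)
    ultimately show ?thesis by (simp only:) (erule DERIV_cong, simp add: algebra_simps add_divide_distrib)
  qed
  moreover have "(\<nu> + 1/2) * ((\<nu> - 1/2) * x powr (\<nu> - 1/2 - 1) * f + x powr (\<nu> - 1/2) * (- g * (x / 2)))
      - ((\<nu> + 3/2) * x powr (\<nu> + 3/2 - 1) / 2 * g + x powr (\<nu> + 3/2) / 2 * (- h * (x / 2)))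
      = - (1 - (\<nu>\<^sup>2 - 1/4) / x\<^sup>2) * bessel_nf \<nu> x"
  proof -
    have e: "\<nu> - 1/2 - 1 = \<nu> - 3/2" "\<nu> + 3/2 - 1 = \<nu> + 1/2" by simp_all
    have "(\<nu> + 1/2) * ((\<nu> - 1/2) * p * f + p * x * (- g * (x / 2)))
        - ((\<nu> + 3/2) * (p * x ^ 2) / 2 * g + p * x ^ 3 / 2 * (- h * (x / 2)))
        = (\<nu>\<^sup>2 - 1/4) * p * f - (\<nu> + 1) * p * x\<^sup>2 * g + p * x\<^sup>2 * (x\<^sup>2 / 4 * h)"
      by (simp add: algebra_simps add_divide_distrib power2_eq_square power3_eq_cube)
    also have "\<dots> = (\<nu>\<^sup>2 - 1/4) * p * f - p * x\<^sup>2 * f" unfolding rec by (simp add: algebra_simps)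
    also have "\<dots> = - (1 - (\<nu>\<^sup>2 - 1/4) / x\<^sup>2) * (p * x\<^sup>2 * f)"
    proof -
      have "(\<nu>\<^sup>2 - 1/4) / x\<^sup>2 * x\<^sup>2 = \<nu>\<^sup>2 - 1/4" using x by simp
      then show ?thesis by algebra
    qed
    finally show ?thesis unfolding bessel_nf_def e pw p_def[symmetric] f_def[symmetric] .
  qed
  ultimately show "(bessel_nf' \<nu> has_real_derivative (- (1 - (\<nu>\<^sup>2 - 1/4) / x\<^sup>2) * bessel_nf \<nu> x)) (at x)"
    by simp
qed

subsection \<open>Sturm comparison and spacing of the zeros\<close>

lemma DERIV_imp_continuous_on:
  fixes f :: "real \<Rightarrow> real"
  shows "(\<And>x. x \<in> S \<Longrightarrow> (f has_real_derivative f' x) (at x)) \<Longrightarrow> continuous_on S f"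
  by (intro continuous_at_imp_continuous_on ballI) (blast intro: DERIV_isCont)

lemma nonvanishing_constant_sign:
  fixes v :: "real \<Rightarrow> real"
  assumes "continuous_on S v" "connected S" "\<And>x. x \<in> S \<Longrightarrow> v x \<noteq> 0"
  shows "(\<forall>x\<in>S. v x > 0) \<or> (\<forall>x\<in>S. v x < 0)"
proof (rule ccontr)
  assume "\<not> ?thesis"
  then obtain x y where xy: "x \<in> S" "y \<in> S" "v x < 0" "v y > 0"
    using assms(3) by (meson linorder_neqE_linordered_idom)
  have "connected (v ` S)" using assms by (intro connected_continuous_image)
  then have "0 \<in> v ` S" by (rule connectedD_interval[of _ "v x" "v y"]) (use xy in auto)
  then show False using assms(3) by auto
qed

text \<open>The Wronskian \<open>W\<close> of v with sin (\<omega>(x - a)) is nonincreasing because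
  q is at least \<omega>^2. Yet it is at most 0 at a and equals \<omega> v(b) > 0 at b = a +
  pi/\<omega>, where the sine completes a half-wave.\<close>

lemma sturm_zero_exists_aux:
  fixes v v' q :: "real \<Rightarrow> real"
  assumes \<omega>: "\<omega> > 0"
    and v: "\<And>x. a \<le> x \<Longrightarrow> x \<le> a + pi / \<omega> \<Longrightarrow> (v has_real_derivative v' x) (at x)"
    and v': "\<And>x. a \<le> x \<Longrightarrow> x \<le> a + pi / \<omega> \<Longrightarrow> (v' has_real_derivative (- q x * v x)) (at x)"
    and q: "\<And>x. a \<le> x \<Longrightarrow> x \<le> a + pi / \<omega> \<Longrightarrow> q x \<ge> \<omega>\<^sup>2"
    and pos: "\<And>x. a < x \<Longrightarrow> x \<le> a + pi / \<omega> \<Longrightarrow> v x > 0"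
  shows False
proof -
  define b where "b = a + pi / \<omega>"
  have ab: "a < b" using \<omega> by (simp add: b_def)
  have va: "v a \<ge> 0"
  proof (rule ccontr)
    assume "\<not> v a \<ge> 0"
    then have neg: "v a < 0" by simp
    have "continuous_on {a..b} v"
      by (rule DERIV_imp_continuous_on[OF v]) (auto simp: b_def)
    moreover have "v b > 0" using ab by (intro pos) (simp_all add: b_def)
    ultimately have "\<exists>x. a \<le> x \<and> x \<le> b \<and> v x = v a / 2"
      using neg ab by (intro IVT') auto
    then obtain x where x: "a \<le> x" "x \<le> b" "v x = v a / 2" by blast
    then have "x \<noteq> a" using neg by auto
    then have "v x > 0" using x by (intro pos) (simp_all add: b_def)
    then show False using x neg by simp
  qed
  define W where "W x = v' x * sin (\<omega> * (x - a)) - v x * (\<omega> * cos (\<omega> * (x - a)))" for x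
  have "W b \<le> W a"
  proof (rule DERIV_nonpos_imp_nonincreasing[of a b W])
    fix x assume x: "a \<le> x" "x \<le> b"
    have "(W has_real_derivative ((- q x * v x) * sin (\<omega> * (x - a)) + cos (\<omega> * (x - a)) * \<omega> * v' x
        - (v' x * (\<omega> * cos (\<omega> * (x - a))) + \<omega> * (- sin (\<omega> * (x - a)) * \<omega>) * v x))) (at x)"
      unfolding W_def[abs_def]
      by (intro DERIV_diff DERIV_mult DERIV_cmult v v') (use x in \<open>auto intro!: derivative_eq_intros simp: b_def\<close>)
    moreover have "(- q x * v x) * sin (\<omega> * (x - a)) + cos (\<omega> * (x - a)) * \<omega> * v' x
        - (v' x * (\<omega> * cos (\<omega> * (x - a))) + \<omega> * (- sin (\<omega> * (x - a)) * \<omega>) * v x)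
        = - ((q x - \<omega>\<^sup>2) * v x * sin (\<omega> * (x - a)))"
      by (simp add: algebra_simps power2_eq_square)
    moreover have "sin (\<omega> * (x - a)) \<ge> 0"
    proof (rule sin_ge_zero)
      have "\<omega> * (x - a) \<le> \<omega> * (pi / \<omega>)" using x \<omega> by (intro mult_left_mono) (auto simp: b_def)
      then show "\<omega> * (x - a) \<le> pi" using \<omega> by simp
    qed (use x \<omega> in simp)
    moreover have "v x \<ge> 0" using va pos[of x] x by (cases "x = a") (auto simp: b_def less_imp_le)
    moreover have "q x - \<omega>\<^sup>2 \<ge> 0" using q[of x] x by (simp add: b_def)
    ultimately show "\<exists>y. (W has_real_derivative y) (at x) \<and> y \<le> 0"
      by (intro exI conjI) (assumption, simp)
  qed (use ab in simp)
  moreover have "W a \<le> 0" using va \<omega> by (simp add: W_def)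
  moreover have "W b = \<omega> * v b" using \<omega> by (simp add: W_def b_def)
  moreover have "v b > 0" using pos[of b] ab by (simp add: b_def)
  ultimately show False using \<omega> mult_pos_pos[of \<omega> "v b"] by linarith
qed

lemma sturm_zero_exists:
  fixes v v' q :: "real \<Rightarrow> real"
  assumes \<omega>: "\<omega> > 0"
    and v: "\<And>x. a \<le> x \<Longrightarrow> x \<le> a + pi / \<omega> \<Longrightarrow> (v has_real_derivative v' x) (at x)"
    and v': "\<And>x. a \<le> x \<Longrightarrow> x \<le> a + pi / \<omega> \<Longrightarrow> (v' has_real_derivative (- q x * v x)) (at x)"
    and q: "\<And>x. a \<le> x \<Longrightarrow> x \<le> a + pi / \<omega> \<Longrightarrow> q x \<ge> \<omega>\<^sup>2"
  shows "\<exists>x. a < x \<and> x \<le> a + pi / \<omega> \<and> v x = 0"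
proof (rule ccontr)
  assume no: "\<not> ?thesis"
  have "continuous_on {a<..a + pi / \<omega>} v"
    by (rule DERIV_imp_continuous_on[OF v]) auto
  then consider "\<forall>x\<in>{a<..a + pi / \<omega>}. v x > 0" | "\<forall>x\<in>{a<..a + pi / \<omega>}. v x < 0"
    using nonvanishing_constant_sign[of "{a<..a + pi / \<omega>}" v] no by auto
  then show False
  proof cases
    case 1
    then show False by (intro sturm_zero_exists_aux[OF \<omega> v v' q]) auto
  next
    case 2
    show False
    proof (rule sturm_zero_exists_aux[OF \<omega>, of a "\<lambda>x. - v x" "\<lambda>x. - v' x" q])
      fix x assume x: "a \<le> x" "x \<le> a + pi / \<omega>"
      show "((\<lambda>x. - v x) has_real_derivative - v' x) (at x)" by (rule DERIV_minus[OF v[OF x]])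
      show "((\<lambda>x. - v' x) has_real_derivative - q x * - v x) (at x)"
        using DERIV_minus[OF v'[OF x]] by simp
    qed (use 2 q in auto)
  qed
qed

text \<open>The reverse comparison, with sin (x - a). If the gap were below pi, the sine would be
  positive at b and the nondecreasing Wronskian would force \<open>v' b > 0\<close>; but v is
  positive before its zero b and cannot reach it with positive slope.\<close>

lemma sturm_gap_aux:
  fixes v v' q :: "real \<Rightarrow> real"
  assumes ab: "a < b"
    and v: "\<And>x. a \<le> x \<Longrightarrow> x \<le> b \<Longrightarrow> (v has_real_derivative v' x) (at x)"
    and v': "\<And>x. a \<le> x \<Longrightarrow> x \<le> b \<Longrightarrow> (v' has_real_derivative (- q x * v x)) (at x)"
    and q: "\<And>x. a \<le> x \<Longrightarrow> x \<le> b \<Longrightarrow> q x \<le> 1"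
    and pos: "\<And>x. a < x \<Longrightarrow> x < b \<Longrightarrow> v x > 0" and z: "v a = 0" "v b = 0" "v' b \<noteq> 0"
  shows "b - a \<ge> pi"
proof (rule ccontr)
  assume "\<not> b - a \<ge> pi"
  then have lt: "b - a < pi" by simp
  define W where "W x = v' x * sin (x - a) - v x * cos (x - a)" for x
  have "W a \<le> W b"
  proof (rule DERIV_nonneg_imp_nondecreasing[of a b W])
    fix x assume x: "a \<le> x" "x \<le> b"
    have "(W has_real_derivative ((- q x * v x) * sin (x - a) + cos (x - a) * v' x
        - (v' x * cos (x - a) + - sin (x - a) * v x))) (at x)"
      unfolding W_def[abs_def]
      by (intro DERIV_diff DERIV_mult v v') (use x in \<open>auto intro!: derivative_eq_intros\<close>)
    moreover have "(- q x * v x) * sin (x - a) + cos (x - a) * v' x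
        - (v' x * cos (x - a) + - sin (x - a) * v x) = (1 - q x) * v x * sin (x - a)"
      by (simp add: algebra_simps)
    moreover have "sin (x - a) \<ge> 0" using x lt by (intro sin_ge_zero) auto
    moreover have "v x \<ge> 0" using z pos[of x] x by (cases "x = a"; cases "x = b") (auto simp: less_imp_le)
    moreover have "1 - q x \<ge> 0" using q[of x] x by simp
    ultimately show "\<exists>y. (W has_real_derivative y) (at x) \<and> 0 \<le> y"
      by (intro exI conjI) (assumption, simp)
  qed (use ab in simp)
  then have "v' b * sin (b - a) \<ge> 0" using z by (simp add: W_def)
  moreover have "sin (b - a) > 0" using ab lt by (intro sin_gt_zero) auto
  ultimately have "v' b \<ge> 0" by (simp add: zero_le_mult_iff)
  then have "v' b > 0" using z by simp
  from DERIV_pos_inc_left[OF v[of b] this] ab obtain d where d: "d > 0" "\<And>h. h > 0 \<Longrightarrow> h < d \<Longrightarrow> v (b - h) < v b"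
    by auto
  define h where "h = min (d / 2) ((b - a) / 2)"
  have "h > 0" "h < d" "a < b - h" "b - h < b" using d ab by (auto simp: h_def min_def field_simps)
  then show False using d(2)[of h] pos[of "b - h"] z by auto
qed

lemma sturm_gap:
  fixes v v' q :: "real \<Rightarrow> real"
  assumes ab: "a < b"
    and v: "\<And>x. a \<le> x \<Longrightarrow> x \<le> b \<Longrightarrow> (v has_real_derivative v' x) (at x)"
    and v': "\<And>x. a \<le> x \<Longrightarrow> x \<le> b \<Longrightarrow> (v' has_real_derivative (- q x * v x)) (at x)"
    and q: "\<And>x. a \<le> x \<Longrightarrow> x \<le> b \<Longrightarrow> q x \<le> 1"
    and nz: "\<And>x. a < x \<Longrightarrow> x < b \<Longrightarrow> v x \<noteq> 0" and z: "v a = 0" "v b = 0" "v' b \<noteq> 0"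
  shows "b - a \<ge> pi"
proof -
  have "continuous_on {a<..<b} v"
    by (rule DERIV_imp_continuous_on[OF v]) auto
  then consider "\<forall>x\<in>{a<..<b}. v x > 0" | "\<forall>x\<in>{a<..<b}. v x < 0"
    using nonvanishing_constant_sign[of "{a<..<b}" v] nz by auto
  then show ?thesis
  proof cases
    case 1
    then show ?thesis by (intro sturm_gap_aux[OF ab v v' q _ z]) auto
  next
    case 2
    show ?thesis
    proof (rule sturm_gap_aux[OF ab, of "\<lambda>x. - v x" "\<lambda>x. - v' x" q])
      fix x assume x: "a \<le> x" "x \<le> b"
      show "((\<lambda>x. - v x) has_real_derivative - v' x) (at x)" by (rule DERIV_minus[OF v[OF x]])
      show "((\<lambda>x. - v' x) has_real_derivative - q x * - v x) (at x)"
        using DERIV_minus[OF v'[OF x]] by simp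
    qed (use 2 q z in auto)
  qed
qed

text \<open>The sequence \<open>l k - k\<close> increases to c, while
  \<open>l k - k + 2 * K / (k + 1)\<close> decreases from N on and stays at or above c. This squeeze
  gives the rate O(1/k) without identifying c.\<close>

lemma near_unit_increments:
  fixes l :: "nat \<Rightarrow> real"
  assumes lower: "\<And>k. l k + 1 \<le> l (Suc k)" and K: "K \<ge> 0"
    and upper: "\<And>k. k \<ge> N \<Longrightarrow> l (Suc k) - l k \<le> 1 + K / (real (k + 1))\<^sup>2"
  shows "\<exists>c C. c \<ge> l 0 \<and> (\<forall>k. \<bar>l k - (real k + c)\<bar> \<le> C / real (k + 1))"
proof -
  define d where "d k = l k - real k" for k
  define e where "e k = d k + 2 * K / real (k + 1)" for k
  have inc: "incseq d" unfolding d_def by (rule incseq_SucI) (use lower in \<open>simp add: algebra_simps\<close>)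
  have e_dec: "e (Suc k) \<le> e k" if "k \<ge> N" for k
  proof -
    \<comment> \<open>The factor 2 in \<open>e\<close> is chosen for this: 2/((k+1)(k+2)) \<ge>
      1/(k+1)^2.\<close>
    have "K / (real (k + 1))\<^sup>2 \<le> 2 * K / real (k + 1) - 2 * K / real (k + 2)"
    proof -
      have "2 * K / real (k + 1) - 2 * K / real (k + 2) = 2 * K / (real (k + 1) * real (k + 2))"
        by (simp add: field_simps)
      also have "\<dots> = K / (real (k + 1) * (real (k + 2) / 2))" by simp
      also have "\<dots> \<ge> K / (real (k + 1) * real (k + 1))"
        using K by (intro divide_left_mono mult_left_mono) auto
      finally show ?thesis by (simp add: power2_eq_square)
    qed
    then show ?thesis using upper[OF that] by (simp add: e_def d_def add_ac)
  qed
  have e_anti: "e n \<le> e m" if "N \<le> m" "m \<le> n" for m n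
    using that(2,1) by (induction rule: dec_induct) (auto intro: order_trans[OF e_dec])
  have d_le_e: "d k \<le> e k" for k using K by (simp add: e_def)
  have "d k \<le> e N" for k
  proof (cases "k \<ge> N")
    case True
    then show ?thesis using d_le_e[of k] e_anti[of N k] by simp
  next
    case False
    then have "d k \<le> d N" using inc by (simp add: incseq_def)
    then show ?thesis using d_le_e[of N] by simp
  qed
  then obtain c where c: "d \<longlonglongrightarrow> c" using incseq_convergent[OF inc] by metis
  have dc: "d k \<le> c" for k by (rule incseq_le[OF inc c])
  have ce: "c \<le> e k" if "k \<ge> N" for k
    by (rule LIMSEQ_le_const2[OF c]) (use d_le_e e_anti[OF that] in \<open>meson order_trans\<close>)
  \<comment> \<open>The second summand pays for the finitely many k below N.\<close>
  define C where "C = 2 * K + (c - d 0) * real (N + 1)"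
  have "\<bar>l k - (real k + c)\<bar> \<le> C / real (k + 1)" for k
  proof -
    have eq: "\<bar>l k - (real k + c)\<bar> = c - d k" using dc[of k] by (simp add: d_def)
    have "(c - d k) * real (k + 1) \<le> C"
    proof (cases "k \<ge> N")
      case True
      have "c - d k \<le> 2 * K / real (k + 1)" using ce[OF True] by (simp add: e_def)
      then have "(c - d k) * real (k + 1) \<le> 2 * K" by (simp add: field_simps)
      moreover have "(c - d 0) * real (N + 1) \<ge> 0" using dc[of 0] by (intro mult_nonneg_nonneg) auto
      ultimately show ?thesis unfolding C_def by linarith
    next
      case False
      have "c - d k \<le> c - d 0" using inc by (simp add: incseq_def)
      then have "(c - d k) * real (k + 1) \<le> (c - d 0) * real (N + 1)"
        using False dc[of 0] by (intro mult_mono) auto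
      then show ?thesis using K by (simp add: C_def)
    qed
    then show ?thesis unfolding eq by (simp add: field_simps)
  qed
  moreover have "c \<ge> l 0" using dc[of 0] by (simp add: d_def)
  ultimately show ?thesis by blast
qed

section \<open>Passage from \<open>bessel_J\<close> and \<open>bessel_J_entire\<close> to
  \<open>clifford\<close>\<close>

lemma of_real_powr_even_shift:
  assumes "a > 0"
  shows "complex_of_real a powr (2 * of_nat n + of_real \<nu>) = of_real (a powr \<nu> * a ^ (2 * n))"
proof -
  have "complex_of_real a powr (2 * of_nat n + of_real \<nu>) = complex_of_real a powr of_real (real (2 * n) + \<nu>)"
    by simp
  also have "\<dots> = of_real (a powr (real (2 * n) + \<nu>))" using assms by (subst powr_of_real) auto
  also have "a powr (real (2 * n) + \<nu>) = a powr \<nu> * a ^ (2 * n)"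
    using assms by (simp only: powr_add powr_realpow mult.commute)
  finally show ?thesis .
qed

lemma bessel_coeff:
  "(-1) ^ n / (fact n * Gamma (of_nat n + of_real \<nu> + 1)) = complex_of_real ((-1) ^ n * clifford_coeff \<nu> n)"
proof -
  have "Gamma (of_nat n + of_real \<nu> + 1) = complex_of_real (Gamma (real n + \<nu> + 1))"
    using Gamma_complex_of_real[of "real n + \<nu> + 1"] by simp
  then show ?thesis by (simp add: clifford_coeff_def)
qed

lemma bessel_J_clifford:
  assumes \<nu>: "\<nu> \<ge> 0" and x: "x > 0"
  shows "bessel_J \<nu> (of_real x) = of_real ((x / 2) powr \<nu> * clifford_real \<nu> (x\<^sup>2 / 4))"
proof -
  have "complex_of_real x / 2 = of_real (x / 2)" by simp
  then have "bessel_J \<nu> (of_real x)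
      = (\<Sum>n. of_real ((-1) ^ n * clifford_coeff \<nu> n) * of_real ((x / 2) powr \<nu> * (x / 2) ^ (2 * n)))"
    unfolding bessel_J_def bessel_coeff using x by (simp only: of_real_powr_even_shift half_gt_zero)
  also have "\<dots> = (\<Sum>n. of_real ((x / 2) powr \<nu>) * of_real ((-1) ^ n * clifford_coeff \<nu> n * (x\<^sup>2 / 4) ^ n))"
  proof (intro suminf_cong)
    fix n
    have "(x / 2)\<^sup>2 = x\<^sup>2 / 4" by (simp add: power_divide)
    then have "(x / 2) ^ (2 * n) = (x\<^sup>2 / 4) ^ n" by (simp only: power_mult)
    then show "complex_of_real ((-1) ^ n * clifford_coeff \<nu> n) * of_real ((x / 2) powr \<nu> * (x / 2) ^ (2 * n))
        = of_real ((x / 2) powr \<nu>) * of_real ((-1) ^ n * clifford_coeff \<nu> n * (x\<^sup>2 / 4) ^ n)"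
      by (simp only: of_real_mult mult_ac)
  qed
  also have "\<dots> = of_real ((x / 2) powr \<nu>) * of_real (clifford_real \<nu> (x\<^sup>2 / 4))"
    using sums_mult[OF sums_of_real[OF clifford_of_real(2)[OF \<nu>, of "x\<^sup>2 / 4"]], of "complex_of_real ((x / 2) powr \<nu>)"]
    by (simp add: sums_iff)
  finally show ?thesis by simp
qed

lemma bessel_J_entire_clifford:
  assumes \<nu>: "\<nu> \<ge> 0"
  shows "bessel_J_entire \<nu> z = of_real ((pi / 2) powr \<nu>) * clifford \<nu> ((of_real pi * z / 2)\<^sup>2)"
proof -
  have "bessel_J_entire \<nu> z
      = (\<Sum>n. of_real ((-1) ^ n * clifford_coeff \<nu> n) * of_real ((pi / 2) powr \<nu> * (pi / 2) ^ (2 * n)) * z ^ (2 * n))"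
    unfolding bessel_J_entire_def bessel_coeff by (simp only: of_real_powr_even_shift pi_half_gt_zero)
  also have "\<dots> = (\<Sum>n. of_real ((pi / 2) powr \<nu>) * (of_real ((-1) ^ n * clifford_coeff \<nu> n) * ((of_real pi * z / 2)\<^sup>2) ^ n))"
  proof (intro suminf_cong)
    fix n
    have "complex_of_real ((pi / 2) ^ (2 * n)) * z ^ (2 * n) = (of_real pi * z / 2) ^ (2 * n)"
      by (simp add: power_mult_distrib power_divide)
    also have "\<dots> = ((of_real pi * z / 2)\<^sup>2) ^ n" by (rule power_mult)
    finally show "of_real ((-1) ^ n * clifford_coeff \<nu> n) * of_real ((pi / 2) powr \<nu> * (pi / 2) ^ (2 * n)) * z ^ (2 * n)
        = of_real ((pi / 2) powr \<nu>) * (of_real ((-1) ^ n * clifford_coeff \<nu> n) * ((of_real pi * z / 2)\<^sup>2) ^ n)"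
      by (simp only: of_real_mult mult.assoc mult.left_commute)
  qed
  also have "\<dots> = of_real ((pi / 2) powr \<nu>) * clifford \<nu> ((of_real pi * z / 2)\<^sup>2)"
    unfolding clifford_def by (rule suminf_mult) (rule clifford_summable[OF \<nu>])
  finally show ?thesis .
qed

section \<open>The positive zeros and their spacing\<close>

locale bessel =
  fixes \<nu> :: real
  assumes \<nu>: "\<nu> \<ge> 1/2"
begin

lemma \<nu>0: "\<nu> \<ge> 0" using \<nu> by simp

definition is_zero :: "real \<Rightarrow> bool" where "is_zero x \<longleftrightarrow> clifford_real \<nu> (x\<^sup>2 / 4) = 0"

lemma bessel_J_eq_0_iff: "x > 0 \<Longrightarrow> bessel_J \<nu> (of_real x) = 0 \<longleftrightarrow> is_zero x"
  using bessel_J_clifford[OF \<nu>0, of x] by (simp add: is_zero_def)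

lemma is_zero_iff: "is_zero x \<longleftrightarrow> clifford \<nu> (of_real (x\<^sup>2 / 4)) = 0"
  using clifford_of_real(1)[OF \<nu>0, of "x\<^sup>2 / 4"] by (simp add: is_zero_def)

lemma bessel_nf_eq_0_iff: "x > 0 \<Longrightarrow> bessel_nf \<nu> x = 0 \<longleftrightarrow> is_zero x"
  by (simp add: bessel_nf_def is_zero_def)

lemma bessel_nf'_nonzero:
  assumes "x > 0" "is_zero x"
  shows "bessel_nf' \<nu> x \<noteq> 0"
proof -
  have "clifford (\<nu> + 1) (of_real (x\<^sup>2 / 4)) \<noteq> 0"
    using clifford_zero_simple[OF \<nu>0] assms(2) by (simp add: is_zero_iff)
  then have "clifford_real (\<nu> + 1) (x\<^sup>2 / 4) \<noteq> 0"
    using clifford_of_real(1)[of "\<nu> + 1" "x\<^sup>2 / 4"] \<nu>0 by simp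
  then show ?thesis using assms by (simp add: bessel_nf'_def is_zero_def)
qed

text \<open>To the right of a the potential is at least 1 - \<tau>, so a sine of frequency sqrt (1 -
  \<tau>) serves for comparison.\<close>

lemma exists_zero_within:
  assumes a: "a > 0" and \<tau>: "(\<nu>\<^sup>2 - 1/4) / a\<^sup>2 \<le> \<tau>" "\<tau> < 1"
  shows "\<exists>x. a < x \<and> x \<le> a + pi / sqrt (1 - \<tau>) \<and> is_zero x"
proof -
  have "\<exists>x. a < x \<and> x \<le> a + pi / sqrt (1 - \<tau>) \<and> bessel_nf \<nu> x = 0"
  proof (rule sturm_zero_exists[where v' = "bessel_nf' \<nu>" and q = "\<lambda>x. 1 - (\<nu>\<^sup>2 - 1/4) / x\<^sup>2"])
    show "0 < sqrt (1 - \<tau>)" using \<tau> by simp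
    fix x assume x: "a \<le> x"
    show "(bessel_nf \<nu> has_real_derivative bessel_nf' \<nu> x) (at x)"
      "(bessel_nf' \<nu> has_real_derivative - (1 - (\<nu>\<^sup>2 - 1/4) / x\<^sup>2) * bessel_nf \<nu> x) (at x)"
      using bessel_nf_ode[OF \<nu>0, of x] x a by auto
    have "(1/2)\<^sup>2 \<le> \<nu>\<^sup>2" using \<nu> by (intro power_mono) auto
    then have "(\<nu>\<^sup>2 - 1/4) / x\<^sup>2 \<le> (\<nu>\<^sup>2 - 1/4) / a\<^sup>2"
      using x a by (intro divide_left_mono power_mono mult_pos_pos) (auto simp: power_divide)
    then show "(sqrt (1 - \<tau>))\<^sup>2 \<le> 1 - (\<nu>\<^sup>2 - 1/4) / x\<^sup>2" using \<tau> by simp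
  qed
  then show ?thesis using a bessel_nf_eq_0_iff by (meson less_trans)
qed

lemma exists_greater_zero: "\<exists>y>x. y > 0 \<and> is_zero y"
proof -
  define a where "a = max 1 (max x (2 * \<bar>\<nu>\<bar>))"
  have a: "a \<ge> 1" "a \<ge> x" "a \<ge> 2 * \<nu>" by (auto simp: a_def)
  have "(2 * \<nu>)\<^sup>2 \<le> a\<^sup>2" using a \<nu>0 by (intro power_mono) auto
  then have "4 * \<nu>\<^sup>2 \<le> a\<^sup>2" by (simp add: power_mult_distrib)
  then have "(\<nu>\<^sup>2 - 1/4) / a\<^sup>2 \<le> 1/4" using a by (simp add: divide_le_eq)
  then obtain y where "a < y" "is_zero y" using exists_zero_within[of a "1/4"] a by auto
  then show ?thesis using a by (intro exI[of _ y]) auto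
qed

text \<open>\<open>LEAST\<close> on the reals is informative only if the minimum is attained. It is:
  some zero lies to the right of x, and a nonconstant entire function has finitely many zeros in a
  closed disc.\<close>

lemma next_zero:
  assumes x: "x \<ge> 0"
  defines "y \<equiv> (LEAST y. y > x \<and> bessel_J \<nu> (of_real y) = 0)"
  shows "y > x" "is_zero y" "\<And>u. x < u \<Longrightarrow> is_zero u \<Longrightarrow> y \<le> u"
proof -
  obtain y0 where y0: "y0 > x" "is_zero y0" using exists_greater_zero[of x] by blast
  define T where "T = {u. x < u \<and> u \<le> y0 \<and> is_zero u}"
  have "\<not> clifford \<nu> constant_on UNIV"
  proof
    assume "clifford \<nu> constant_on UNIV"
    then have "clifford \<nu> 0 = clifford \<nu> (of_real (y0\<^sup>2 / 4))" by (auto simp: constant_on_def)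
    then show False using y0(2) clifford_nonzero_nonpos[OF \<nu>0, of 0] by (simp add: is_zero_iff)
  qed
  then have "finite {w \<in> cball 0 (y0\<^sup>2 / 4). clifford \<nu> w = 0}"
    by (intro holomorphic_compact_finite_zeros[of _ UNIV]) (auto simp: clifford_holomorphic[OF \<nu>0])
  moreover have "(\<lambda>u. complex_of_real (u\<^sup>2 / 4)) ` T \<subseteq> {w \<in> cball 0 (y0\<^sup>2 / 4). clifford \<nu> w = 0}"
  proof
    fix w assume "w \<in> (\<lambda>u. complex_of_real (u\<^sup>2 / 4)) ` T"
    then obtain u where u: "x < u" "u \<le> y0" "is_zero u" "w = complex_of_real (u\<^sup>2 / 4)" by (auto simp: T_def)
    have "u\<^sup>2 \<le> y0\<^sup>2" using u x by (intro power_mono) auto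
    then have "norm w \<le> y0\<^sup>2 / 4" unfolding u(4) norm_of_real by simp
    then show "w \<in> {w \<in> cball 0 (y0\<^sup>2 / 4). clifford \<nu> w = 0}" using u(3) by (simp add: u(4) is_zero_iff)
  qed
  ultimately have "finite ((\<lambda>u. complex_of_real (u\<^sup>2 / 4)) ` T)" by (rule rev_finite_subset)
  moreover have "inj_on (\<lambda>u. complex_of_real (u\<^sup>2 / 4)) T"
  proof (rule inj_onI)
    fix u u' assume uu: "u \<in> T" "u' \<in> T" "complex_of_real (u\<^sup>2 / 4) = complex_of_real (u'\<^sup>2 / 4)"
    then have "u\<^sup>2 = u'\<^sup>2" unfolding of_real_eq_iff by simp
    then show "u = u'" using uu(1,2) x by (simp add: T_def power2_eq_iff_nonneg)
  qed
  ultimately have fin: "finite T" by (rule finite_imageD)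
  have ne: "T \<noteq> {}" using y0 by (auto simp: T_def)
  have M: "Min T \<in> T" using fin ne by simp
  have le: "Min T \<le> u" if "x < u" "is_zero u" for u
  proof (cases "u \<le> y0")
    case True
    then show ?thesis using that fin by (intro Min_le) (auto simp: T_def)
  next
    case False
    then show ?thesis using M by (auto simp: T_def)
  qed
  have "y = Min T" unfolding y_def
    by (rule Least_equality) (use M le x bessel_J_eq_0_iff in \<open>auto simp: T_def\<close>)
  then show "y > x" "is_zero y" "\<And>u. x < u \<Longrightarrow> is_zero u \<Longrightarrow> y \<le> u"
    using M le by (auto simp: T_def)
qed

abbreviation "j \<equiv> bessel_zero_nat \<nu>"

lemma j_nonneg: "j k \<ge> 0"
proof (induction k)
  case (Suc k)
  then show ?case using next_zero(1)[OF Suc] by (simp add: bessel_zero_nat.simps(2))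
qed simp

lemma j_less: "j k < j (Suc k)"
  and j_is_zero: "is_zero (j (Suc k))"
  and j_least: "j k < u \<Longrightarrow> is_zero u \<Longrightarrow> j (Suc k) \<le> u"
  using next_zero[OF j_nonneg[of k]] by (auto simp: bessel_zero_nat.simps(2))

lemma j_pos: "j (Suc k) > 0"
  using j_less[of k] j_nonneg[of k] by simp

lemma j_gap_lower: "j (Suc k) + pi \<le> j (Suc (Suc k))"
proof -
  have "(1/2)\<^sup>2 \<le> \<nu>\<^sup>2" using \<nu> by (intro power_mono) auto
  then have m: "\<nu>\<^sup>2 - 1/4 \<ge> 0" by (simp add: power_divide)
  have "pi \<le> j (Suc (Suc k)) - j (Suc k)"
  proof (rule sturm_gap[where v = "bessel_nf \<nu>" and v' = "bessel_nf' \<nu>" and q = "\<lambda>x. 1 - (\<nu>\<^sup>2 - 1/4) / x\<^sup>2"])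
    show "j (Suc k) < j (Suc (Suc k))" by (rule j_less)
    fix x assume x: "j (Suc k) \<le> x"
    then show "(bessel_nf \<nu> has_real_derivative bessel_nf' \<nu> x) (at x)"
      "(bessel_nf' \<nu> has_real_derivative - (1 - (\<nu>\<^sup>2 - 1/4) / x\<^sup>2) * bessel_nf \<nu> x) (at x)"
      using bessel_nf_ode[OF \<nu>0, of x] j_pos[of k] by auto
    show "1 - (\<nu>\<^sup>2 - 1/4) / x\<^sup>2 \<le> 1" using m by simp
  next
    fix x assume x: "j (Suc k) < x" "x < j (Suc (Suc k))"
    then have "\<not> is_zero x" using j_least[of "Suc k" x] by auto
    then show "bessel_nf \<nu> x \<noteq> 0" using x j_pos[of k] by (simp add: bessel_nf_eq_0_iff)
  next
    show "bessel_nf \<nu> (j (Suc k)) = 0" "bessel_nf \<nu> (j (Suc (Suc k))) = 0"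
      using j_pos j_is_zero by (simp_all only: bessel_nf_eq_0_iff)
    show "bessel_nf' \<nu> (j (Suc (Suc k))) \<noteq> 0" by (rule bessel_nf'_nonzero[OF j_pos j_is_zero])
  qed
  then show ?thesis by simp
qed

lemma j_gap_upper:
  assumes "(\<nu>\<^sup>2 - 1/4) / (j (Suc k))\<^sup>2 \<le> \<tau>" "\<tau> < 1"
  shows "j (Suc (Suc k)) \<le> j (Suc k) + pi / sqrt (1 - \<tau>)"
  using exists_zero_within[OF j_pos assms] j_least[of "Suc k"] by force

text \<open>As pi < 4, this puts \<open>lam 0\<close> above 1/2, and with it the shift c, which is
  at least \<open>lam 0\<close>.\<close>

lemma j_1: "j (Suc 0) \<ge> 2"
proof (rule ccontr)
  assume "\<not> j (Suc 0) \<ge> 2"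
  then have "(j (Suc 0))\<^sup>2 < 2\<^sup>2" using j_pos[of 0] by (intro power_strict_mono) auto
  then have "clifford_real \<nu> ((j (Suc 0))\<^sup>2 / 4) > 0"
    by (intro clifford_real_pos_initial \<nu>0) auto
  then show False using j_is_zero[of 0] unfolding is_zero_def by simp
qed

text \<open>The sequence \<open>lam\<close> starts at index 0, so \<open>lam k\<close> is the zero with number \<open>k + 1\<close>.\<close>
definition lam :: "nat \<Rightarrow> real" where "lam k = j (Suc k) / pi"

lemma lam_pos: "lam k > 0" using j_pos[of k] by (simp add: lam_def)

lemma lam_0: "lam 0 > 1/2"
  using j_1 pi_less_4 by (simp add: lam_def field_simps)

lemma lam_Suc: "lam k + 1 \<le> lam (Suc k)"
  using j_gap_lower[of k] divide_right_mono[OF j_gap_lower[of k], of pi]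
  by (simp add: lam_def add_divide_distrib)

lemma lam_lower: "lam k \<ge> real (k + 1) / 2"
proof (induction k)
  case (Suc k)
  then show ?case using lam_Suc[of k] by simp
qed (use lam_0 in simp)

lemma lam_progression: "\<exists>c C. perturbed_progression lam c C"
proof -
  define M where "M = (\<nu>\<^sup>2 - 1/4) / pi\<^sup>2"
  have "(1/2)\<^sup>2 \<le> \<nu>\<^sup>2" using \<nu> by (intro power_mono) auto
  then have M: "M \<ge> 0" by (simp add: M_def power_divide)
  \<comment> \<open>From this index on 8M \<le> k+1 \<le> (k+1)^2, so that \<tau> below is at most
    1/2.\<close>
  define N where "N = nat \<lceil>8 * M\<rceil>"
  have upper: "lam (Suc k) - lam k \<le> 1 + 4 * M / (real (k + 1))\<^sup>2" if k: "k \<ge> N" for k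
  proof -
    define \<tau> where "\<tau> = 4 * M / (real (k + 1))\<^sup>2"
    have "8 * M \<le> real (k + 1)" using k unfolding N_def by linarith
    also have "\<dots> \<le> (real (k + 1))\<^sup>2" by (simp add: power2_eq_square)
    finally have \<tau>: "\<tau> \<ge> 0" "\<tau> \<le> 1/2" using M by (auto simp: \<tau>_def divide_le_eq)
    have "(\<nu>\<^sup>2 - 1/4) / (j (Suc k))\<^sup>2 = M / (lam k)\<^sup>2"
      by (simp add: M_def lam_def power_divide)
    also have "\<dots> \<le> M / (real (k + 1) / 2)\<^sup>2"
      using M lam_lower[of k] lam_pos[of k] by (intro divide_left_mono power_mono mult_pos_pos) auto
    also have "\<dots> = \<tau>" by (simp add: \<tau>_def power_divide)
    finally have "j (Suc (Suc k)) \<le> j (Suc k) + pi / sqrt (1 - \<tau>)"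
      using \<tau> by (intro j_gap_upper) auto
    then have "lam (Suc k) \<le> (j (Suc k) + pi / sqrt (1 - \<tau>)) / pi"
      unfolding lam_def by (rule divide_right_mono) simp
    also have "\<dots> = lam k + 1 / sqrt (1 - \<tau>)"
      by (simp add: lam_def add_divide_distrib)
    \<comment> \<open>Squared and cleared of denominators this is \<tau>(1 - \<tau> - \<tau>^2)
      \<ge> 0, which holds on [0, 1/2].\<close>
    also have "1 / sqrt (1 - \<tau>) \<le> 1 + \<tau>"
    proof -
      have "\<tau> * (1 - \<tau> - \<tau>\<^sup>2) \<ge> 0"
      proof (intro mult_nonneg_nonneg \<tau>)
        have "\<tau>\<^sup>2 \<le> (1/2)\<^sup>2" using \<tau> by (intro power_mono) auto
        then show "1 - \<tau> - \<tau>\<^sup>2 \<ge> 0" using \<tau> by (simp add: power_divide)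
      qed
      then have "1 \<le> (1 - \<tau>) * (1 + \<tau>)\<^sup>2" by (simp add: algebra_simps power2_eq_square)
      then have "sqrt 1 \<le> sqrt ((1 - \<tau>) * (1 + \<tau>)\<^sup>2)" by (rule real_sqrt_le_mono)
      also have "\<dots> = sqrt (1 - \<tau>) * (1 + \<tau>)" using \<tau> by (simp add: real_sqrt_mult)
      finally show ?thesis using \<tau> by (simp add: field_simps)
    qed
    finally show ?thesis by (simp add: \<tau>_def)
  qed
  obtain c C where "c \<ge> lam 0" "\<And>k. \<bar>lam k - (real k + c)\<bar> \<le> C / real (k + 1)"
    using near_unit_increments[of lam "4 * M" N] lam_Suc M upper by auto
  then have "perturbed_progression lam c C"
    using lam_pos lam_0 by unfold_locales auto
  then show ?thesis by blast
qed

lemma lam_strict_mono: "strict_mono lam"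
  by (rule strict_monoI_Suc) (use lam_Suc in \<open>auto intro: less_le_trans[OF less_add_one]\<close>)

lemma lam_at_top: "filterlim lam at_top sequentially"
proof (rule filterlim_at_top_mono)
  show "filterlim (\<lambda>k. real (k + 1) / 2) at_top sequentially" by real_asymp
qed (use lam_lower in auto)

section \<open>Completeness of the list of zeros and the product expansion\<close>

lemma positive_zero_is_j:
  assumes x: "x > 0" "is_zero x"
  shows "\<exists>k. x = j (Suc k)"
proof -
  have "\<exists>k. x / pi < lam k" using lam_at_top
    by (metis (mono_tags, lifting) eventually_False_sequentially eventually_mono filterlim_at_top_dense)
  then have ex: "\<exists>k. x \<le> j (Suc k)"
    by (auto simp: lam_def field_simps intro: less_imp_le)
  define k where "k = (LEAST k. x \<le> j (Suc k))"
  have k: "x \<le> j (Suc k)" unfolding k_def using ex by (rule LeastI_ex)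
  have "j k < x"
  proof (cases k)
    case 0
    then show ?thesis using x by simp
  next
    case (Suc i)
    then show ?thesis using not_less_Least[of i "\<lambda>k. x \<le> j (Suc k)"] by (simp add: k_def[symmetric])
  qed
  then have "j (Suc k) \<le> x" using x by (intro j_least)
  then show ?thesis using k by (intro exI[of _ k]) simp
qed

text \<open>Lommel's argument confines the zeros to the real line, and positivity of the series to
  its positive half. There w = x^2/4 matches them with the positive Bessel zeros, of which the
  recursion misses none because it tends to infinity.\<close>

lemma clifford_zeros: "clifford \<nu> w = 0 \<longleftrightarrow> (\<exists>k. w = of_real ((pi * lam k / 2)\<^sup>2))"
proof
  assume w: "clifford \<nu> w = 0"
  then have w1: "w = of_real (Re w)" using clifford_zero_real[OF \<nu>0 w] by (simp add: complex_eq_iff)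
  have "\<not> Re w \<le> 0" using clifford_nonzero_nonpos[OF \<nu>0, of "Re w"] w w1 by auto
  then have pos: "Re w > 0" by simp
  define x where "x = 2 * sqrt (Re w)"
  have x: "x > 0" "x\<^sup>2 / 4 = Re w" using pos by (auto simp: x_def power_mult_distrib)
  then have "is_zero x" using w w1 by (simp add: is_zero_iff)
  then obtain k where "x = j (Suc k)" using positive_zero_is_j x by blast
  then have "(pi * lam k / 2)\<^sup>2 = Re w" using x by (simp add: lam_def power_divide)
  then show "\<exists>k. w = of_real ((pi * lam k / 2)\<^sup>2)" using w1 by metis
next
  assume "\<exists>k. w = of_real ((pi * lam k / 2)\<^sup>2)"
  then obtain k where "w = of_real ((pi * lam k / 2)\<^sup>2)" by blast
  then have "w = of_real ((j (Suc k))\<^sup>2 / 4)" by (simp add: lam_def power_divide)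
  then show "clifford \<nu> w = 0" using j_is_zero[of k] by (simp only: is_zero_iff)
qed

lemma clifford_product:
  "(\<lambda>N. \<Prod>k<N. 1 - w / of_real ((pi * lam k / 2)\<^sup>2)) \<longlonglongrightarrow> clifford \<nu> w / clifford \<nu> 0"
proof (rule hadamard_product_genus_0[where M = "\<lambda>r. ln (clifford_coeff \<nu> 0) + 2 * sqrt r"])
  show "clifford \<nu> holomorphic_on UNIV" by (rule clifford_holomorphic[OF \<nu>0])
  show "clifford \<nu> 0 \<noteq> 0" using clifford_nonzero_nonpos[OF \<nu>0, of 0] by simp
  show "clifford \<nu> w = 0 \<longleftrightarrow> (\<exists>k. w = of_real ((pi * lam k / 2)\<^sup>2))" for w by (rule clifford_zeros)
  show "deriv (clifford \<nu>) (of_real ((pi * lam k / 2)\<^sup>2)) \<noteq> 0" for k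
  proof -
    have "deriv (clifford \<nu>) u = - clifford (\<nu> + 1) u" for u
      by (rule DERIV_imp_deriv[OF clifford_has_field_derivative[OF \<nu>0]])
    moreover have "clifford (\<nu> + 1) (of_real ((pi * lam k / 2)\<^sup>2)) \<noteq> 0"
      by (rule clifford_zero_simple[OF \<nu>0]) (use clifford_zeros in blast)
    ultimately show ?thesis by simp
  qed
  show "(pi * lam k / 2)\<^sup>2 > 0" for k using lam_pos[of k] by simp
  show "strict_mono (\<lambda>k. (pi * lam k / 2)\<^sup>2)"
  proof (rule strict_monoI)
    fix i k :: nat assume "i < k"
    then have "lam i < lam k" using lam_strict_mono by (simp add: strict_mono_less)
    then show "(pi * lam i / 2)\<^sup>2 < (pi * lam k / 2)\<^sup>2"
      using lam_pos[of i] by (intro power_strict_mono) auto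
  qed
  show "filterlim (\<lambda>k. (pi * lam k / 2)\<^sup>2) at_top sequentially"
  proof -
    have "filterlim (\<lambda>x. (pi * x / 2)\<^sup>2) at_top at_top" by real_asymp
    then show ?thesis by (rule filterlim_compose[OF _ lam_at_top])
  qed
  show "norm (clifford \<nu> w) \<le> exp (ln (clifford_coeff \<nu> 0) + 2 * sqrt (norm w))" for w
    by (rule norm_clifford_le[OF \<nu>0])
  show "((\<lambda>r. (ln (clifford_coeff \<nu> 0) + 2 * sqrt r) / r) \<longlongrightarrow> 0) at_top" by real_asymp
qed

lemma bessel_J_entire_product:
  "(\<lambda>N. \<Prod>k<N. 1 - z\<^sup>2 / of_real ((lam k)\<^sup>2)) \<longlonglongrightarrow> bessel_J_entire \<nu> z / bessel_J_entire \<nu> 0"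
proof -
  have "1 - (of_real pi * z / 2)\<^sup>2 / of_real ((pi * lam k / 2)\<^sup>2) = 1 - z\<^sup>2 / of_real ((lam k)\<^sup>2)" for k
    by (simp add: power_mult_distrib power_divide)
  then show ?thesis
    using clifford_product[of "(of_real pi * z / 2)\<^sup>2"] by (simp add: bessel_J_entire_clifford[OF \<nu>0])
qed

end

subsection \<open>The Bessel zeta function and its shifts\<close>

context bessel
begin

lemma bessel_J_entire_imaginary:
  "bessel_J_entire \<nu> (\<i> * of_real y)
    = of_real ((pi / 2) powr \<nu> * (\<Sum>n. clifford_coeff \<nu> n * (pi * y / 2) ^ (2 * n)))"
proof -
  have t: "(of_real pi * (\<i> * of_real y) / 2)\<^sup>2 = complex_of_real (- ((pi * y / 2)\<^sup>2))"
    by (simp add: power_mult_distrib power_divide)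
  have eq: "(-1) ^ n * clifford_coeff \<nu> n * (- ((pi * y / 2)\<^sup>2)) ^ n = clifford_coeff \<nu> n * (pi * y / 2) ^ (2 * n)" for n
  proof -
    have "(-1) ^ n * (- ((pi * y / 2)\<^sup>2)) ^ n = ((pi * y / 2)\<^sup>2) ^ n"
      by (subst power_mult_distrib[symmetric]) simp
    then have "clifford_coeff \<nu> n * ((-1) ^ n * (- ((pi * y / 2)\<^sup>2)) ^ n) = clifford_coeff \<nu> n * (pi * y / 2) ^ (2 * n)"
      by (simp only: power_mult)
    then show ?thesis by (simp only: mult_ac)
  qed
  have "clifford_real \<nu> (- ((pi * y / 2)\<^sup>2)) = (\<Sum>n. clifford_coeff \<nu> n * (pi * y / 2) ^ (2 * n))"
    using sums_unique[OF clifford_of_real(2)[OF \<nu>0, of "- ((pi * y / 2)\<^sup>2)"]] unfolding eq .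
  then show ?thesis
    unfolding bessel_J_entire_clifford[OF \<nu>0] t clifford_of_real(1)[OF \<nu>0] by simp
qed

definition E0 :: real where "E0 = (pi / 2) powr \<nu> * clifford_coeff \<nu> 0"

lemma E0: "bessel_J_entire \<nu> 0 = of_real E0" "E0 > 0"
  using clifford_coeff_pos[of \<nu> 0] \<nu> by (auto simp: bessel_J_entire_clifford[OF \<nu>0] clifford_0 E0_def)

text \<open>At z = iy all factors of the product are positive, so their real logarithms can be
  summed without any question of branches.\<close>

lemma exp_log_det:
  assumes y: "y > 0" and s: "summable (\<lambda>k. ln (1 + y\<^sup>2 / (lam k)\<^sup>2))"
  shows "exp (\<Sum>k. ln (1 + y\<^sup>2 / (lam k)\<^sup>2))
    = (pi / 2) powr \<nu> * (\<Sum>n. clifford_coeff \<nu> n * (pi * y / 2) ^ (2 * n)) / E0"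
proof -
  have p: "1 + y\<^sup>2 / (lam k)\<^sup>2 > 0" for k using lam_pos[of k] by (simp add: add_pos_nonneg)
  have eq: "1 - (\<i> * of_real y)\<^sup>2 / of_real ((lam k)\<^sup>2) = complex_of_real (1 + y\<^sup>2 / (lam k)\<^sup>2)" for k
    by (simp add: power_mult_distrib)
  have 1: "(\<lambda>N. \<Prod>k<N. 1 + y\<^sup>2 / (lam k)\<^sup>2) \<longlonglongrightarrow>
      (pi / 2) powr \<nu> * (\<Sum>n. clifford_coeff \<nu> n * (pi * y / 2) ^ (2 * n)) / E0"
    using bessel_J_entire_product[of "\<i> * of_real y"]
    unfolding eq bessel_J_entire_imaginary E0(1) of_real_prod[symmetric] of_real_divide[symmetric]
      tendsto_of_real_iff .
  have "(\<lambda>N. exp (\<Sum>k<N. ln (1 + y\<^sup>2 / (lam k)\<^sup>2))) \<longlonglongrightarrow> exp (\<Sum>k. ln (1 + y\<^sup>2 / (lam k)\<^sup>2))"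
    by (intro tendsto_exp summable_LIMSEQ s)
  moreover have "exp (\<Sum>k<N. ln (1 + y\<^sup>2 / (lam k)\<^sup>2)) = (\<Prod>k<N. 1 + y\<^sup>2 / (lam k)\<^sup>2)" for N
    using p by (simp add: exp_sum)
  ultimately have 2: "(\<lambda>N. \<Prod>k<N. 1 + y\<^sup>2 / (lam k)\<^sup>2) \<longlonglongrightarrow> exp (\<Sum>k. ln (1 + y\<^sup>2 / (lam k)\<^sup>2))"
    by simp
  show ?thesis by (rule LIMSEQ_unique[OF 2 1])
qed

lemma imaginary_asymptotics:
  "((\<lambda>y. y powr (\<nu> + 1/2) * exp (- (pi * y)) * ((pi / 2) powr \<nu> * (\<Sum>n. clifford_coeff \<nu> n * (pi * y / 2) ^ (2 * n))))
    \<longlongrightarrow> 1 / (sqrt 2 * pi)) at_top"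
proof -
  have "filterlim (\<lambda>y. pi * y) at_top at_top" by real_asymp
  from filterlim_compose[OF clifford_asymptotics[OF \<nu>] this]
  have "((\<lambda>y. (pi / 2) powr \<nu> / pi powr (\<nu> + 1/2) * ((pi * y) powr (\<nu> + 1/2) * exp (- (pi * y)) *
      (\<Sum>n. clifford_coeff \<nu> n * (pi * y / 2) ^ (2 * n)))) \<longlongrightarrow>
      (pi / 2) powr \<nu> / pi powr (\<nu> + 1/2) * (2 powr \<nu> / (sqrt 2 * sqrt pi))) at_top"
    by (rule tendsto_mult[OF tendsto_const])
  moreover have "(pi / 2) powr \<nu> / pi powr (\<nu> + 1/2) * (2 powr \<nu> / (sqrt 2 * sqrt pi)) = 1 / (sqrt 2 * pi)"
  proof -
    have "(pi / 2) powr \<nu> * 2 powr \<nu> = pi powr \<nu>" by (subst powr_mult[symmetric]) auto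
    moreover have "pi powr (\<nu> + 1/2) = pi powr \<nu> * sqrt pi" by (simp add: powr_add powr_half_sqrt)
    moreover have "sqrt pi * sqrt pi = pi" by simp
    ultimately show ?thesis by (simp add: field_simps)
  qed
  moreover have "\<forall>\<^sub>F y in at_top. (pi / 2) powr \<nu> / pi powr (\<nu> + 1/2) * ((pi * y) powr (\<nu> + 1/2) * exp (- (pi * y)) *
      (\<Sum>n. clifford_coeff \<nu> n * (pi * y / 2) ^ (2 * n)))
      = y powr (\<nu> + 1/2) * exp (- (pi * y)) * ((pi / 2) powr \<nu> * (\<Sum>n. clifford_coeff \<nu> n * (pi * y / 2) ^ (2 * n)))"
    using eventually_gt_at_top[of 0]
  proof eventually_elim
    case (elim y)
    have "(pi * y) powr (\<nu> + 1/2) = pi powr (\<nu> + 1/2) * y powr (\<nu> + 1/2)"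
      using elim by (subst powr_mult) auto
    then show ?case by simp
  qed
  ultimately show ?thesis by (simp add: filterlim_cong)
qed

text \<open>The unknown shift \<open>c\<close> of the zeros and the derivative of the zeta function at 0 are both
  read off from the growth of the product along the imaginary axis.\<close>
lemma zeta_values:
  assumes "perturbed_progression lam c C"
  shows "perturbed_progression.H lam c 0 = of_real ((\<nu> + 1/2) / 2)"
    and "exp (2 * perturbed_progression.H' lam c 0 + 2 * perturbed_progression.H lam c 0)
      = of_real (sqrt 2 * pi * E0)"
proof -
  interpret perturbed_progression lam c C by (rule assms)
  define S where "S y = (\<Sum>k. ln (1 + y\<^sup>2 / (lam k)\<^sup>2))" for y
  define L where "L = - 2 * Re (H' 0) - 2 * Re (H 0)"
  define q where "q = 1 / (sqrt 2 * pi) / E0"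
  have q: "q > 0" using E0(2) by (simp add: q_def)
  have 1: "((\<lambda>y. S y - pi * y + 2 * (c - 1/2) * ln y) \<longlongrightarrow> L) at_top"
    using log_det_asymptotics(2) by (simp add: S_def L_def)
  have "((\<lambda>y. exp (S y - pi * y + (\<nu> + 1/2) * ln y)) \<longlongrightarrow> q) at_top"
  proof (rule Lim_transform_eventually)
    show "((\<lambda>y. y powr (\<nu> + 1/2) * exp (- (pi * y)) * ((pi / 2) powr \<nu> * (\<Sum>n. clifford_coeff \<nu> n * (pi * y / 2) ^ (2 * n))) / E0)
        \<longlongrightarrow> q) at_top"
      unfolding q_def by (intro tendsto_divide imaginary_asymptotics tendsto_const) (use E0(2) in simp)
    show "\<forall>\<^sub>F y in at_top. y powr (\<nu> + 1/2) * exp (- (pi * y)) * ((pi / 2) powr \<nu> * (\<Sum>n. clifford_coeff \<nu> n * (pi * y / 2) ^ (2 * n))) / E0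
        = exp (S y - pi * y + (\<nu> + 1/2) * ln y)"
      using eventually_gt_at_top[of 0]
    proof eventually_elim
      case (elim y)
      have eS: "exp (S y) = (pi / 2) powr \<nu> * (\<Sum>n. clifford_coeff \<nu> n * (pi * y / 2) ^ (2 * n)) / E0"
        unfolding S_def using elim log_det_asymptotics(1) by (intro exp_log_det)
      have "exp (S y - pi * y + (\<nu> + 1/2) * ln y) = exp (S y) * exp (- (pi * y)) * y powr (\<nu> + 1/2)"
        using elim by (simp add: powr_def flip: exp_add)
      then show ?case unfolding eS by simp
    qed
  qed
  from tendsto_ln[OF this] q
  have 2: "((\<lambda>y. S y - pi * y + (\<nu> + 1/2) * ln y) \<longlongrightarrow> ln q) at_top" by simp
  \<comment> \<open>Subtracting the two expansions shows that d ln y converges, which forces d = 0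
    and so determines c.\<close>
  define d where "d = 2 * (c - 1/2) - (\<nu> + 1/2)"
  have d3: "((\<lambda>y. d * ln y) \<longlongrightarrow> L - ln q) at_top"
    using tendsto_diff[OF 1 2] by (simp add: d_def algebra_simps)
  have d0: "d = 0"
  proof (rule ccontr)
    assume "d \<noteq> 0"
    then have "((\<lambda>y. d * ln y / d) \<longlongrightarrow> (L - ln q) / d) at_top"
      by (intro tendsto_divide d3 tendsto_const)
    then have "((\<lambda>y::real. ln y) \<longlongrightarrow> (L - ln q) / d) at_top" using \<open>d \<noteq> 0\<close> by simp
    moreover have "filterlim (\<lambda>y::real. ln y) at_infinity at_top"
      by (rule filterlim_at_top_imp_at_infinity[OF ln_at_top])
    ultimately show False using not_tendsto_and_filterlim_at_infinity[of "at_top :: real filter"] by auto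
  qed
  then have "c - 1/2 = (\<nu> + 1/2) / 2" by (simp add: d_def)
  then show "H 0 = of_real ((\<nu> + 1/2) / 2)" by (simp only: H_0)
  have "((\<lambda>y::real. 0::real) \<longlongrightarrow> L - ln q) at_top" using d3 d0 by simp
  then have "L = ln q" by (simp add: tendsto_const_iff)
  then have "exp (- L) = sqrt 2 * pi * E0" using q by (simp add: exp_minus q_def)
  moreover have "2 * H' 0 + 2 * H 0 = of_real (- L)"
    unfolding L_def H'_0(2) H_0 Re_complex_of_real by simp
  ultimately show "exp (2 * H' 0 + 2 * H 0) = of_real (sqrt 2 * pi * E0)"
    by (simp only: exp_of_real)
qed

lemma bessel_lam_int: "bessel_lam \<nu> (int k + 1) = lam k" "bessel_lam \<nu> (- (int k + 1)) = - lam k"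
proof -
  have "nat (int k + 1) = Suc k" "nat (1 + int k) = Suc k" by simp_all
  then show "bessel_lam \<nu> (int k + 1) = lam k" "bessel_lam \<nu> (- (int k + 1)) = - lam k"
    by (auto simp: bessel_lam_def bessel_zero_def lam_def)
qed

lemma bessel_log_int:
  "bessel_log \<nu> (int k + 1) = of_real (ln (lam k))"
  "bessel_log \<nu> (- (int k + 1)) = of_real (ln (lam k)) + of_real pi * \<i>"
  by (simp_all only: bessel_log_def bessel_lam_int minus_minus) auto

lemma exp_bessel_log_int:
  "exp (- s * bessel_log \<nu> (int k + 1)) = npow s (lam k)"
  "exp (- s * bessel_log \<nu> (- (int k + 1))) = exp (- of_real pi * \<i> * s) * npow s (lam k)"
  by (simp_all only: bessel_log_int npow_def) (simp add: ring_distribs exp_diff exp_minus exp_add field_simps)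

end

section \<open>Sums over positive and over nonzero integers\<close>

lemma infsum_int_ge_1:
  fixes f :: "int \<Rightarrow> complex"
  assumes "summable (\<lambda>k. norm (f (int k + 1)))"
  shows "(f has_sum (\<Sum>k. f (int k + 1))) {1..}" "(\<lambda>k. norm (f k)) summable_on {1..}"
proof -
  have im: "{1..} = (\<lambda>k. int k + 1) ` UNIV"
  proof (intro equalityI subsetI)
    fix x :: int assume "x \<in> {1..}"
    then have "x = int (nat (x - 1)) + 1" by simp
    then show "x \<in> (\<lambda>k. int k + 1) ` UNIV" by blast
  qed auto
  have inj: "inj (\<lambda>k. int k + 1)" by (auto intro: injI)
  have "((\<lambda>k. f (int k + 1)) has_sum (\<Sum>k. f (int k + 1))) UNIV"
    by (intro norm_summable_imp_has_sum assms summable_sums summable_norm_cancel[OF assms])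
  then show "(f has_sum (\<Sum>k. f (int k + 1))) {1..}"
    unfolding im by (subst has_sum_reindex[OF inj]) (simp add: o_def)
  have "(\<lambda>k. norm (f (int k + 1))) summable_on UNIV"
    by (intro norm_summable_imp_summable_on) (simp add: assms)
  then show "(\<lambda>k. norm (f k)) summable_on {1..}"
    unfolding im by (subst summable_on_reindex[OF inj]) (simp add: o_def)
qed

lemma infsum_int_nonzero:
  fixes f :: "int \<Rightarrow> complex"
  assumes "summable (\<lambda>k. norm (f (int k + 1)))" "summable (\<lambda>k. norm (f (- (int k + 1))))"
  shows "infsum f (- {0}) = (\<Sum>k. f (int k + 1) + f (- (int k + 1)))"
    and "(\<lambda>k. norm (f k)) summable_on (- {0})"
proof -
  have im: "- {0} = {1..} \<union> uminus ` {1::int..}"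
  proof (intro equalityI subsetI)
    fix x :: int assume x: "x \<in> - {0}"
    show "x \<in> {1..} \<union> uminus ` {1..}"
    proof (cases "x > 0")
      case False
      then have "x = - (- x)" "- x \<in> {1..}" using x by auto
      then show ?thesis by blast
    qed auto
  qed auto
  have inj: "inj_on uminus {1::int..}" by (auto intro: inj_onI)
  note p = infsum_int_ge_1[OF assms(1)] and m = infsum_int_ge_1[of "\<lambda>k. f (- k)", OF assms(2)]
  have "(f has_sum (\<Sum>k. f (- (int k + 1)))) (uminus ` {1..})"
    using m(1) by (subst has_sum_reindex[OF inj]) (simp add: o_def)
  moreover have "{1..} \<inter> uminus ` {1::int..} = {}" by auto
  ultimately have "(f has_sum ((\<Sum>k. f (int k + 1)) + (\<Sum>k. f (- (int k + 1))))) (- {0})"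
    unfolding im by (intro has_sum_Un_disjoint p(1))
  moreover have "(\<Sum>k. f (int k + 1)) + (\<Sum>k. f (- (int k + 1))) = (\<Sum>k. f (int k + 1) + f (- (int k + 1)))"
    by (intro suminf_add summable_norm_cancel[OF assms(1)] summable_norm_cancel[OF assms(2)])
  ultimately show "infsum f (- {0}) = (\<Sum>k. f (int k + 1) + f (- (int k + 1)))"
    by (simp add: infsumI)
  have "(\<lambda>k. norm (f k)) summable_on (uminus ` {1..})"
    using m(2) by (subst summable_on_reindex[OF inj]) (simp add: o_def)
  then show "(\<lambda>k. norm (f k)) summable_on (- {0})"
    unfolding im using p(2) by (intro summable_on_Un_disjoint) auto
qed

context bessel
begin

lemma bessel_zeta_continuation:
  assumes "perturbed_progression lam c C"
  shows "zeta_continuation {1..} (bessel_log \<nu>) {s. Re s > -1} (\<lambda>s. perturbed_progression.H lam c s / (s - 1))"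
proof -
  interpret perturbed_progression lam c C by (rule assms)
  have op: "open {s. Re s > -1}" by (rule open_halfspace_Re_gt)
  have "H holomorphic_on {s. Re s > -1}"
    using H_has_field_derivative op by (auto simp: holomorphic_on_open)
  then have an: "H analytic_on {s. Re s > -1}" using op by (simp add: analytic_on_open)
  have "(\<lambda>s. H s / (s - 1)) meromorphic_on {s. Re s > -1}"
    by (intro meromorphic_intros analytic_on_imp_meromorphic_on[OF an])
  moreover have "(is_pole (\<lambda>s. H s / (s - 1)) z \<and> H z / (z - 1) = 0) \<or> (\<lambda>s. H s / (s - 1)) \<midarrow>z\<rightarrow> H z / (z - 1)"
    if z: "Re z > -1" for z
  proof (cases "z = 1")
    case True
    have "is_pole (\<lambda>s. H s / (s - 1)) 1"
    proof (rule is_pole_divide)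
      show "isCont H 1" using H_has_field_derivative[of 1] by (auto intro: DERIV_isCont)
      have "((\<lambda>s::complex. s - 1) \<longlongrightarrow> 1 - 1) (at 1)" by (intro tendsto_intros)
      then show "filterlim (\<lambda>s::complex. s - 1) (at 0) (at 1)"
        by (auto simp: filterlim_at eventually_at_filter)
    qed (simp add: H_1)
    \<comment> \<open>Division by zero gives the value 0 at s = 1, which is the convention for a
      pole.\<close>
    then show ?thesis using True by simp
  next
    case False
    have "H \<midarrow>z\<rightarrow> H z" using DERIV_isCont[OF H_has_field_derivative[OF z]] by (simp add: isCont_def)
    then show ?thesis using False by (intro disjI2 tendsto_intros) auto
  qed
  ultimately have nm: "(\<lambda>s. H s / (s - 1)) nicely_meromorphic_on {s. Re s > -1}"
    by (simp add: nicely_meromorphic_on_def)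
  have "(\<lambda>k. norm (exp (- s * bessel_log \<nu> k))) summable_on {1..} \<and>
      H s / (s - 1) = (\<Sum>\<^sub>\<infinity>k\<in>{1..}. exp (- s * bessel_log \<nu> k))" if s: "Re s > 1" for s
  proof -
    have sm: "summable (\<lambda>k. norm (exp (- s * bessel_log \<nu> (int k + 1))))"
      unfolding exp_bessel_log_int by (rule npow_summable[OF s])
    have "(\<Sum>k. exp (- s * bessel_log \<nu> (int k + 1))) = H s / (s - 1)"
      unfolding exp_bessel_log_int using zeta_sums[OF s] by (simp add: sums_iff)
    then show ?thesis using infsum_int_ge_1[OF sm] by (simp add: infsumI)
  qed
  then show ?thesis
    unfolding zeta_continuation_def using op nm by (intro conjI exI[of _ 1]) (auto simp: less_imp_le)
qed

text \<open>\<open>A\<close> continues the zeta function of the two-sided sequence across s = 1,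
  where 1 + exp (-pi i s) has a zero. The facts are packaged so that c and C do not appear in what
  follows.\<close>

lemma bessel_zeta_star_data:
  obtains A where "A holomorphic_on {s. Re s > -1}" "A 1 = of_real pi * \<i>"
    "exp (- deriv A 0) = exp (- (of_real pi * \<i> / 2) * (of_real \<nu> + 1/2)) * of_real (sqrt 2 * pi) * bessel_J_entire \<nu> 0"
    "\<And>s. Re s > 1 \<Longrightarrow> summable (\<lambda>k. norm (npow s (lam k)))"
    "\<And>s. Re s > 1 \<Longrightarrow> A s = (1 + exp (- of_real pi * \<i> * s)) * (\<Sum>k. npow s (lam k))"
    "finite_part (bessel_zeta_star \<nu>) 1 = of_real pi * \<i>"
proof -
  obtain c C where pp: "perturbed_progression lam c C" using lam_progression by blast
  interpret perturbed_progression lam c C by (rule pp)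
  define e where "e s = 1 + exp (- of_real pi * \<i> * s)" for s
  have e: "(e has_field_derivative (- of_real pi * \<i> * exp (- of_real pi * \<i> * s))) (at s)" for s
    unfolding e_def[abs_def] by (auto intro!: derivative_eq_intros)
  have em: "exp (- of_real pi * \<i>) = -1" by (simp add: exp_minus exp_pi_i')
  define g where "g s = e s * H s" for s
  have g: "(g has_field_derivative (- of_real pi * \<i> * exp (- of_real pi * \<i> * s) * H s + H' s * e s)) (at s)"
    if "Re s > -1" for s
    unfolding g_def[abs_def] by (rule DERIV_mult[OF e H_has_field_derivative[OF that]])
  \<comment> \<open>The value at 1 is the derivative of the numerator: -pi i exp (-pi i) = pi i,
    times \<open>H 1\<close> = 1.\<close>
  define A where "A s = (if s = 1 then of_real pi * \<i> else g s / (s - 1))" for s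
  have op: "open {s. Re s > -1}" by (rule open_halfspace_Re_gt)
  have e1: "e 1 = 0" using em by (simp add: e_def)
  have hol: "A holomorphic_on {s. Re s > -1}"
  proof (rule pole_theorem_open_0[of g _ 1])
    show "g holomorphic_on {s. Re s > -1}" using g op by (auto simp: holomorphic_on_open)
    show "A 1 = deriv g 1" using DERIV_imp_deriv[OF g[of 1]] em by (simp add: A_def H_1 e1)
  qed (use op in \<open>auto simp: A_def g_def e1\<close>)
  \<comment> \<open>The negative indices double zeta'(0) and, through log (-1) = pi i, add -pi i
    zeta(0), the origin of the phase in the result.\<close>
  have A0: "deriv A 0 = of_real pi * \<i> * H 0 - (2 * H' 0 + 2 * H 0)"
  proof -
    have d: "((\<lambda>s. g s / (s - 1)) has_field_derivative
        ((- of_real pi * \<i> * exp (- of_real pi * \<i> * 0) * H 0 + H' 0 * e 0) * (0 - 1) - g 0 * 1) / ((0 - 1) * (0 - 1))) (at 0)"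
      by (rule DERIV_divide[OF g]) (auto intro!: derivative_eq_intros)
    have "eventually (\<lambda>s. s \<in> - {1::complex}) (nhds 0)"
      by (rule eventually_nhds_in_open) auto
    then have "eventually (\<lambda>s. A s = g s / (s - 1)) (nhds 0)"
      by eventually_elim (simp add: A_def)
    then have "deriv A 0 = deriv (\<lambda>s. g s / (s - 1)) 0" by (rule deriv_cong_ev) simp
    also note DERIV_imp_deriv[OF d]
    finally have "deriv A 0 = ((- of_real pi * \<i> * exp (- of_real pi * \<i> * 0) * H 0 + H' 0 * e 0) * (0 - 1) - g 0 * 1) / ((0 - 1) * (0 - 1))" .
    then show ?thesis by (simp add: g_def e_def algebra_simps)
  qed
  have "exp (- deriv A 0) = exp (- (of_real pi * \<i> * H 0)) * exp (2 * H' 0 + 2 * H 0)"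
    unfolding A0 by (simp add: exp_diff exp_minus field_simps)
  also have "\<dots> = exp (- (of_real pi * \<i> / 2) * (of_real \<nu> + 1/2)) * of_real (sqrt 2 * pi) * bessel_J_entire \<nu> 0"
    unfolding zeta_values(2)[OF pp] E0(1) unfolding zeta_values(1)[OF pp] by (simp add: mult_ac)
  finally have expA: "exp (- deriv A 0) = exp (- (of_real pi * \<i> / 2) * (of_real \<nu> + 1/2)) * of_real (sqrt 2 * pi) * bessel_J_entire \<nu> 0" .
  have As: "A s = (1 + exp (- of_real pi * \<i> * s)) * (\<Sum>k. npow s (lam k))" if s: "Re s > 1" for s
    using s zeta_sums[OF s] by (auto simp: A_def g_def e_def sums_iff)
  have star: "bessel_zeta_star \<nu> s = A s" if "Re s > -1" "s \<noteq> 1" for s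
    using zeta_fun_eq[OF bessel_zeta_continuation[OF pp], of s] that
    by (simp add: bessel_zeta_star_def bessel_zeta_def A_def g_def e_def)
  \<comment> \<open>The finite part is read off from the expansion, not from the value: at 1 itself
    \<open>bessel_zeta_star\<close> is 0.\<close>
  have fp: "finite_part (bessel_zeta_star \<nu>) 1 = of_real pi * \<i>"
  proof -
    have "A analytic_on {1}" using hol op by (auto simp: analytic_at)
    then have "(\<lambda>x. A (1 + x)) has_fps_expansion fps_expansion A 1"
      by (rule analytic_at_imp_has_fps_expansion)
    then have "(\<lambda>x. A (1 + x)) has_laurent_expansion fps_to_fls (fps_expansion A 1)"
      by (rule has_laurent_expansion_fps)
    moreover have ev: "eventually (\<lambda>x. A (1 + x) = bessel_zeta_star \<nu> (1 + x)) (at 0)"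
    proof -
      have "eventually (\<lambda>x. x \<in> ball 0 1 - {0}) (at (0::complex))" by (rule eventually_at_in_open) auto
      then show ?thesis
      proof eventually_elim
        case (elim x)
        then have "\<bar>Re x\<bar> < 1" using abs_Re_le_cmod[of x] by simp
        then have "Re (1 + x) > -1" by simp
        then show ?case using star[of "1 + x"] elim by simp
      qed
    qed
    ultimately have "(\<lambda>x. bessel_zeta_star \<nu> (1 + x)) has_laurent_expansion fps_to_fls (fps_expansion A 1)"
      by (simp only: has_laurent_expansion_cong[OF ev refl])
    then have "laurent_expansion (bessel_zeta_star \<nu>) 1 = fps_to_fls (fps_expansion A 1)"
      by (rule laurent_expansion_eqI)
    then show ?thesis by (simp add: finite_part_def fps_expansion_def A_def)
  qed
  show ?thesis
    by (rule that[OF hol _ expA npow_summable As fp]) (auto simp: A_def)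
qed


text \<open>The family J serves for all n shifts at once and for a single one, so that both sides of
  the multiplicativity claim come from the same formula.\<close>

lemma shifted_zeta:
  fixes z :: "'a \<Rightarrow> complex" and L :: "'a \<Rightarrow> int \<Rightarrow> complex"
  assumes J: "finite J" "J \<noteq> {}" and sh: "\<And>j. j \<in> J \<Longrightarrow> bessel_shift_log \<nu> (z j) (L j)"
  shows "\<exists>D Z. zeta_continuation (- {0}) (\<lambda>k. \<Sum>j\<in>J. L j k) D Z \<and> 0 \<in> D \<and> Z analytic_on {0} \<and>
    exp (- deriv Z 0) = (\<Prod>j\<in>J. of_real (sqrt 2 * pi) * bessel_J_entire \<nu> (z j)
      * exp (- (of_real pi * \<i> / 2) * (of_real \<nu> + 1 / 2) - z j * finite_part (bessel_zeta_star \<nu>) 1))"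
proof -
  obtain A where A: "A holomorphic_on {s. Re s > -1}" and A1: "A 1 = of_real pi * \<i>"
    and A0: "exp (- deriv A 0) = exp (- (of_real pi * \<i> / 2) * (of_real \<nu> + 1/2)) * of_real (sqrt 2 * pi) * bessel_J_entire \<nu> 0"
    and npow_sum: "\<And>s. Re s > 1 \<Longrightarrow> summable (\<lambda>k. norm (npow s (lam k)))"
    and As: "\<And>s. Re s > 1 \<Longrightarrow> A s = (1 + exp (- of_real pi * \<i> * s)) * (\<Sum>k. npow s (lam k))"
    and fp: "finite_part (bessel_zeta_star \<nu>) 1 = of_real pi * \<i>"
    using bessel_zeta_star_data by metis
  define m where "m = real (card J)"
  define n where "n = complex_of_real m"
  have m: "m \<ge> 1" using J by (simp add: m_def Suc_le_eq card_gt_0_iff)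
  have Re_n: "Re (n * s) = m * Re s" for s by (simp add: n_def)
  define b where "b = bessel_log \<nu>"
  define \<mu> where "\<mu> k = complex_of_real (bessel_lam \<nu> k)" for k
  define l where "l k = (\<Sum>j\<in>J. L j k)" for k
  \<comment> \<open>A logarithm of the product of the factors 1 - z j / \<open>\<mu> k\<close>; the
    prescribed branches for large k make it tend to 0.\<close>
  define w where "w k = l k - n * b k" for k
  define Z1 where "Z1 = (\<Sum>j\<in>J. z j)"
  define B where "B = (\<Sum>j\<in>J. norm (z j))"
  define B2 where "B2 = (\<Sum>j\<in>J. (norm (z j))\<^sup>2)"
  have B: "B \<ge> 0" "B2 \<ge> 0" by (auto simp: B_def B2_def intro!: sum_nonneg)
  have \<mu>p: "\<mu> (int i + 1) = of_real (lam i)" and \<mu>m: "\<mu> (- (int i + 1)) = - of_real (lam i)" for i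
    by (simp_all only: \<mu>_def bessel_lam_int of_real_minus)
  have bp: "exp (- s * b (int i + 1)) = npow s (lam i)"
    and bm: "exp (- s * b (- (int i + 1))) = exp (- of_real pi * \<i> * s) * npow s (lam i)" for s i
    unfolding b_def by (rule exp_bessel_log_int)+
  have nonzero_cases: "\<exists>i. k = int i + 1 \<or> k = - (int i + 1)" if "k \<noteq> 0" for k
  proof (cases "k > 0")
    case True
    then show ?thesis by (intro exI[of _ "nat (k - 1)"]) auto
  next
    case False
    then show ?thesis using that by (intro exI[of _ "nat (- k - 1)"]) auto
  qed
  have \<mu>0: "\<mu> k \<noteq> 0" if k: "k \<noteq> 0" for k
  proof -
    obtain i where i: "k = int i + 1 \<or> k = - (int i + 1)" using nonzero_cases[OF k] by blast
    have "complex_of_real (lam i) \<noteq> 0" using lam_pos[of i] by simp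
    then show ?thesis using i by (elim disjE) (simp_all only: \<mu>p \<mu>m neg_equal_0_iff_equal, simp_all)
  qed
  have exp_b: "exp (b k) = \<mu> k" if k: "k \<noteq> 0" for k
  proof -
    obtain i where i: "k = int i + 1 \<or> k = - (int i + 1)" using nonzero_cases[OF k] by blast
    have np: "npow (-1) (lam i) = of_real (lam i)" by (rule npow_minus_1[OF lam_pos])
    have "exp (b (int i + 1)) = of_real (lam i)" using bp[of "-1" i] np by simp
    moreover have "exp (b (- (int i + 1))) = - of_real (lam i)" using bm[of "-1" i] np by simp
    ultimately show ?thesis using i by (elim disjE) (simp_all only: \<mu>p \<mu>m)
  qed
  have exp_L: "exp (L j k) = \<mu> k - z j" if "j \<in> J" "k \<noteq> 0" for j k
    using sh[OF that(1)] that(2) by (simp add: bessel_shift_log_def \<mu>_def)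
  have exp_w: "exp (w k) = (\<Prod>j\<in>J. 1 - z j / \<mu> k)" if k: "k \<noteq> 0" for k
  proof -
    have "exp (l k) = (\<Prod>j\<in>J. \<mu> k - z j)" using J k by (simp add: l_def exp_sum exp_L)
    moreover have "exp (n * b k) = \<mu> k ^ card J"
      using exp_of_nat_mult[of "card J" "b k"] exp_b[OF k] by (simp add: n_def m_def)
    ultimately have "exp (w k) = (\<Prod>j\<in>J. \<mu> k - z j) / (\<Prod>j\<in>J. \<mu> k)" by (simp add: w_def exp_diff)
    also have "\<dots> = (\<Prod>j\<in>J. (\<mu> k - z j) / \<mu> k)" by (rule prod_dividef[symmetric])
    finally show ?thesis using \<mu>0[OF k] by (simp add: diff_divide_distrib)
  qed
  \<comment> \<open>For such i the branch is prescribed and each \<open>norm (u j)\<close> is below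
    1/2. The remaining indices are finitely many and need no estimate.\<close>
  have w_bounds: "norm (w k) \<le> 2 * B / lam i" "norm (w k + Z1 / \<mu> k) \<le> 2 * B2 / (lam i)\<^sup>2"
    if k: "k = int i + 1 \<or> k = - (int i + 1)" and big: "lam i > 2 * B + 1" for k i
  proof -
    have k0: "k \<noteq> 0" using k by auto
    have "norm (\<mu> (int i + 1)) = lam i" "norm (\<mu> (- (int i + 1))) = lam i"
      unfolding \<mu>p \<mu>m using lam_pos[of i] by simp_all
    then have n\<mu>: "norm (\<mu> k) = lam i" using k by metis
    define u where "u j = - z j / \<mu> k" for j
    have nu: "norm (u j) = norm (z j) / lam i" for j by (simp add: u_def norm_divide n\<mu>)
    have zB: "norm (z j) \<le> B" if "j \<in> J" for j unfolding B_def using J that by (intro member_le_sum) auto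
    have u2: "norm (u j) < 1/2" if "j \<in> J" for j
    proof -
      have "2 * norm (z j) < lam i" using zB[OF that] big by simp
      then show ?thesis unfolding nu using lam_pos[of i] by (simp add: field_simps)
    qed
    have Lj: "L j k = b k + Ln (1 + u j)" if "j \<in> J" for j
    proof -
      have "norm (z j) < \<bar>bessel_lam \<nu> k\<bar>"
        using zB[OF that] big n\<mu> B norm_ge_zero[of "z j"] by (simp add: \<mu>_def)
      then show ?thesis using sh[OF that] k0 by (simp add: bessel_shift_log_def b_def u_def \<mu>_def)
    qed
    have wk: "w k = (\<Sum>j\<in>J. Ln (1 + u j))"
      by (simp add: w_def l_def Lj sum.distrib n_def m_def)
    have "norm (w k) \<le> (\<Sum>j\<in>J. 2 * (norm (z j) / lam i))"
      unfolding wk using norm_Ln_le[OF u2] by (intro sum_norm_le) (simp add: nu)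
    also have "\<dots> = 2 * B / lam i" by (simp add: B_def sum_distrib_left sum_divide_distrib)
    finally show "norm (w k) \<le> 2 * B / lam i" .
    have "Z1 / \<mu> k = (\<Sum>j\<in>J. - u j)" by (simp add: Z1_def u_def sum_divide_distrib)
    then have "w k + Z1 / \<mu> k = (\<Sum>j\<in>J. Ln (1 + u j) - u j)"
      by (simp add: wk sum_subtractf sum_negf)
    also have "norm \<dots> \<le> (\<Sum>j\<in>J. 2 * ((norm (z j))\<^sup>2 / (lam i)\<^sup>2))"
    proof (intro sum_norm_le)
      fix j assume j: "j \<in> J"
      have "norm (Ln (1 + u j) - u j) \<le> (norm (u j))\<^sup>2 / (1 - norm (u j))"
        using u2[OF j] by (intro Ln_approx_linear) simp
      also have "\<dots> \<le> (norm (u j))\<^sup>2 / (1/2)" using u2[OF j] by (intro divide_left_mono) auto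
      finally show "norm (Ln (1 + u j) - u j) \<le> 2 * ((norm (z j))\<^sup>2 / (lam i)\<^sup>2)"
        by (simp add: nu power_divide mult.commute)
    qed
    also have "\<dots> = 2 * B2 / (lam i)\<^sup>2" by (simp add: B2_def sum_distrib_left sum_divide_distrib)
    finally show "norm (w k + Z1 / \<mu> k) \<le> 2 * B2 / (lam i)\<^sup>2" .
  qed
  txt \<open>Expanding the \<open>k\<close>-th summand to first order in \<open>1 / \<lambda>\<^sub>k\<close> leaves the remainder \<open>Y k\<close>, whose sum
    converges for \<open>Re s > -1/m\<close>; the two leading terms sum to values of the unshifted zeta function.\<close>
  define Y where "Y k s = exp (- (n * s) * b k) * (exp (- s * w k) - 1 - s * (Z1 / \<mu> k))" for k s
  define Y' where "Y' k s = - (n * b k) * exp (- (n * s) * b k) * (exp (- s * w k) - 1 - s * (Z1 / \<mu> k))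
      + (- w k * exp (- s * w k) - Z1 / \<mu> k) * exp (- (n * s) * b k)" for k s
  have Y_deriv: "(Y k has_field_derivative Y' k s) (at s)" for k s
  proof -
    have "((\<lambda>s. exp (- s * a) - 1 - s * d) has_field_derivative (- a * exp (- s * a) - d)) (at s)" for a d
      by (auto intro!: derivative_eq_intros)
    moreover have "((\<lambda>s. exp (- (n * s) * a)) has_field_derivative (- (n * a) * exp (- (n * s) * a))) (at s)" for a
      by (auto intro!: derivative_eq_intros)
    ultimately show ?thesis unfolding Y_def[abs_def] Y'_def by (intro DERIV_mult)
  qed
  \<comment> \<open>The factor exp (m pi N) bounds exp (-pi i n s), which the negative k bring in;
    the rest collects the second-order errors of exp and of Ln.\<close>
  define K where "K N = exp (m * pi * N) * (exp (2 * N * B) * (2 * N * B)\<^sup>2 + 2 * N * B2)" for N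
  have Y_bound: "norm (Y k s) \<le> K N * (real (i + 1) / 2) powr (- m * \<sigma> - 2)"
    if k: "k = int i + 1 \<or> k = - (int i + 1)" and big: "lam i > 2 * B + 1"
      and s: "norm s \<le> N" "\<sigma> \<le> Re s" and \<sigma>: "m * \<sigma> > -1" for k i s N \<sigma>
  proof -
    have N: "N \<ge> 0" using s(1) norm_ge_zero[of s] by linarith
    have l1: "lam i \<ge> 1" using big B by simp
    have wb: "norm (w k) \<le> 2 * B / lam i" "norm (w k + Z1 / \<mu> k) \<le> 2 * B2 / (lam i)\<^sup>2"
      using w_bounds[OF k big] by auto
    have "norm (exp (- (n * s) * b k)) \<le> exp (m * pi * N) * lam i powr (- (m * Re s))"
    proof -
      have np: "norm (npow (n * s) (lam i)) = lam i powr (- (m * Re s))"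
        using norm_npow[OF lam_pos[of i], of "n * s"] by (simp only: Re_n)
      have "Im s \<le> N" using abs_Im_le_cmod[of s] s(1) by linarith
      then have "pi * (m * Im s) \<le> m * pi * N" using m by (simp add: mult_ac mult_left_mono)
      then have e: "norm (exp (- of_real pi * \<i> * (n * s))) \<le> exp (m * pi * N)"
        by (simp add: norm_exp_eq_Re n_def)
      have e1: "1 \<le> exp (m * pi * N)" using m N by simp
      show ?thesis
        using k
      proof
        assume "k = int i + 1"
        then show ?thesis using mult_right_mono[OF e1, of "lam i powr (- (m * Re s))"] bp[of "n * s" i] np by simp
      next
        assume "k = - (int i + 1)"
        then have "norm (exp (- (n * s) * b k)) = norm (exp (- of_real pi * \<i> * (n * s))) * lam i powr (- (m * Re s))"
          using bm[of "n * s" i] np by (simp only: norm_mult)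
        then show ?thesis using mult_right_mono[OF e, of "lam i powr (- (m * Re s))"] by simp
      qed
    qed
    moreover have "norm (exp (- s * w k) - 1 - s * (Z1 / \<mu> k))
        \<le> (exp (2 * N * B) * (2 * N * B)\<^sup>2 + 2 * N * B2) / (lam i)\<^sup>2"
    proof -
      define u where "u = - s * w k"
      have nu: "norm u \<le> 2 * N * B / lam i"
      proof -
        have "norm u \<le> N * (2 * B / lam i)"
          unfolding u_def norm_mult norm_minus_cancel using s(1) wb(1) N by (intro mult_mono) auto
        then show ?thesis by (simp add: mult_ac)
      qed
      also have "\<dots> \<le> 2 * N * B / 1" using l1 N B by (intro divide_left_mono) auto
      finally have "\<bar>Re u\<bar> \<le> 2 * N * B" using abs_Re_le_cmod[of u] by simp
      moreover have "norm (exp u - (1 + u)) \<le> exp \<bar>Re u\<bar> * (norm u)\<^sup>2"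
        using Taylor_exp[of u 1] by (simp add: numeral_2_eq_2)
      moreover have "(norm u)\<^sup>2 \<le> (2 * N * B / lam i)\<^sup>2" using nu by (intro power_mono) auto
      ultimately have 1: "norm (exp u - (1 + u)) \<le> exp (2 * N * B) * (2 * N * B / lam i)\<^sup>2"
        by (elim order_trans) (intro mult_mono, auto)
      have 2: "norm (s * (w k + Z1 / \<mu> k)) \<le> N * (2 * B2 / (lam i)\<^sup>2)"
        unfolding norm_mult using s(1) wb(2) N by (intro mult_mono) auto
      have eq: "exp (- s * w k) - 1 - s * (Z1 / \<mu> k) = (exp u - (1 + u)) - s * (w k + Z1 / \<mu> k)"
        by (simp add: u_def algebra_simps)
      have "norm (exp (- s * w k) - 1 - s * (Z1 / \<mu> k))
          \<le> exp (2 * N * B) * (2 * N * B / lam i)\<^sup>2 + N * (2 * B2 / (lam i)\<^sup>2)"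
        unfolding eq by (rule order_trans[OF norm_triangle_ineq4 add_mono[OF 1 2]])
      then show ?thesis by (simp add: power_divide add_divide_distrib mult_ac)
    qed
    ultimately have "norm (Y k s) \<le> (exp (m * pi * N) * lam i powr (- (m * Re s))) *
        ((exp (2 * N * B) * (2 * N * B)\<^sup>2 + 2 * N * B2) / (lam i)\<^sup>2)"
      unfolding Y_def norm_mult by (intro mult_mono) auto
    also have "\<dots> = K N * lam i powr (- (m * Re s) - 2)"
      using l1 by (simp add: K_def powr_diff powr_numeral)
    also have "\<dots> \<le> K N * lam i powr (- m * \<sigma> - 2)"
    proof (rule mult_left_mono)
      have "m * \<sigma> \<le> m * Re s" using m s(2) by (intro mult_left_mono) auto
      then show "lam i powr (- (m * Re s) - 2) \<le> lam i powr (- m * \<sigma> - 2)"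
        using l1 by (intro powr_mono) auto
      show "K N \<ge> 0" using N B by (simp add: K_def)
    qed
    also have "\<dots> \<le> K N * (real (i + 1) / 2) powr (- m * \<sigma> - 2)"
    proof (rule mult_left_mono)
      show "lam i powr (- m * \<sigma> - 2) \<le> (real (i + 1) / 2) powr (- m * \<sigma> - 2)"
        using lam_lower[of i] \<sigma> by (intro powr_mono2') auto
      show "K N \<ge> 0" using N B by (simp add: K_def)
    qed
    finally show ?thesis .
  qed
  have ev_big: "\<forall>\<^sub>F i in sequentially. lam i > 2 * B + 1"
    using lam_at_top by (simp add: filterlim_at_top_dense)
  have h_summable: "summable (\<lambda>i. K N * (real (i + 1) / 2) powr (- m * \<sigma> - 2))" if "m * \<sigma> > -1" for N \<sigma>
  proof -
    have "summable (\<lambda>i. real (Suc i) powr (- m * \<sigma> - 2))"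
      by (subst summable_Suc_iff, subst summable_real_powr_iff) (use that in simp)
    then have "summable (\<lambda>i. K N / 2 powr (- m * \<sigma> - 2) * real (i + 1) powr (- m * \<sigma> - 2))"
      by (intro summable_mult) simp
    moreover have "(real (i + 1) / 2) powr (- m * \<sigma> - 2) = real (i + 1) powr (- m * \<sigma> - 2) / 2 powr (- m * \<sigma> - 2)" for i
      by (rule powr_divide)
    ultimately show ?thesis by simp
  qed
  \<comment> \<open>The half-plane on which k^(-m Re s - 2) is summable.\<close>
  define D where "D = {s. Re s > - 1 / m}"
  have D: "s \<in> D \<longleftrightarrow> m * Re s > -1" for s using m by (simp add: D_def field_simps)
  have opD: "open D" unfolding D_def by (rule open_halfspace_Re_gt)
  define T where "T i s = Y (int i + 1) s + Y (- (int i + 1)) s" for i s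
  define T' where "T' i s = Y' (int i + 1) s + Y' (- (int i + 1)) s" for i s
  have "\<exists>g g'. \<forall>s\<in>D. (\<lambda>i. T i s) sums g s \<and> (\<lambda>i. T' i s) sums g' s \<and> (g has_field_derivative g' s) (at s)"
  proof (rule series_and_derivative_comparison_local[OF opD])
    show "(T i has_field_derivative T' i s) (at s)" for i s
      unfolding T_def[abs_def] T'_def by (intro DERIV_add Y_deriv)
    fix x assume x: "x \<in> D"
    define r where "r = (Re x + 1 / m) / 2"
    define \<sigma> where "\<sigma> = Re x - r"
    have r: "r > 0" using x by (simp add: r_def D_def)
    have \<sigma>: "m * \<sigma> > -1"
    proof -
      have "m * \<sigma> = (m * Re x - 1) / 2" using m by (simp add: \<sigma>_def r_def field_simps)
      then show ?thesis using x D by simp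
    qed
    define h where "h i = 2 * (K (norm x + r) * (real (i + 1) / 2) powr (- m * \<sigma> - 2))" for i
    have "summable h" unfolding h_def by (intro summable_mult h_summable \<sigma>)
    moreover have "\<forall>\<^sub>F i in sequentially. \<forall>y\<in>ball x r \<inter> D. norm (T i y) \<le> h i"
      using ev_big
    proof eventually_elim
      case (elim i)
      show ?case
      proof
        fix y assume "y \<in> ball x r \<inter> D"
        then have xy: "norm (x - y) < r" by (simp add: dist_norm)
        have ny: "norm y \<le> norm x + r" using norm_triangle_sub[of y x] xy by (simp add: norm_minus_commute)
        have ry: "\<sigma> \<le> Re y" using abs_Re_le_cmod[of "x - y"] xy by (simp add: \<sigma>_def)
        have "norm (Y (int i + 1) y) \<le> K (norm x + r) * (real (i + 1) / 2) powr (- m * \<sigma> - 2)"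
          "norm (Y (- (int i + 1)) y) \<le> K (norm x + r) * (real (i + 1) / 2) powr (- m * \<sigma> - 2)"
          by (rule Y_bound[OF _ elim ny ry \<sigma>], simp)+
        then show "norm (T i y) \<le> h i"
          unfolding T_def h_def using norm_triangle_ineq[of "Y (int i + 1) y" "Y (- (int i + 1)) y"] by linarith
      qed
    qed
    ultimately show "\<exists>d h. 0 < d \<and> summable h \<and> (\<forall>\<^sub>F i in sequentially. \<forall>y\<in>ball x d \<inter> D. norm (T i y) \<le> h i)"
      using r by blast
  qed
  then obtain g g' where g: "\<And>s. s \<in> D \<Longrightarrow> (\<lambda>i. T i s) sums g s"
    "\<And>s. s \<in> D \<Longrightarrow> (\<lambda>i. T' i s) sums g' s" "\<And>s. s \<in> D \<Longrightarrow> (g has_field_derivative g' s) (at s)"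
    by blast
  \<comment> \<open>The argument is ns because the leading powers of all factors combine. At s = 0
    the second term evaluates \<open>A\<close> at 1, which is where the finite part comes
    from.\<close>
  define Z where "Z s = A (n * s) + s * Z1 * A (n * s + 1) + g s" for s
  have Ad: "(A has_field_derivative deriv A s) (at s)" if "Re s > -1" for s
    using holomorphic_derivI[OF A open_halfspace_Re_gt] that by simp
  have Z_deriv: "(Z has_field_derivative (deriv A (n * s) * n + (Z1 * A (n * s + 1) + deriv A (n * s + 1) * n * (s * Z1)) + g' s)) (at s)"
    if s: "s \<in> D" for s
    unfolding Z_def[abs_def]
  proof (intro DERIV_add g(3)[OF s])
    have 1: "Re (n * s) > -1" "Re (n * s + 1) > -1" using s D by (simp_all add: n_def)
    show "((\<lambda>s. A (n * s)) has_field_derivative deriv A (n * s) * n) (at s)"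
      by (rule DERIV_chain'[where f = "\<lambda>s. n * s" and g = A, OF _ Ad[OF 1(1)]]) (auto intro!: derivative_eq_intros)
    have "((\<lambda>s. A (n * s + 1)) has_field_derivative deriv A (n * s + 1) * n) (at s)"
      by (rule DERIV_chain'[where f = "\<lambda>s. n * s + 1" and g = A, OF _ Ad[OF 1(2)]]) (auto intro!: derivative_eq_intros)
    moreover have "((\<lambda>s. s * Z1) has_field_derivative Z1) (at s)" by (auto intro!: derivative_eq_intros)
    ultimately show "((\<lambda>s. s * Z1 * A (n * s + 1)) has_field_derivative
        Z1 * A (n * s + 1) + deriv A (n * s + 1) * n * (s * Z1)) (at s)" by (rule DERIV_mult[rotated])
  qed
  have Z_an: "Z analytic_on D" using Z_deriv opD by (auto simp: analytic_on_open holomorphic_on_open)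
  have in_D: "0 \<in> D" using m by (simp add: D)
  have zeta: "(\<lambda>k. norm (exp (- s * l k))) summable_on (- {0}) \<and> Z s = (\<Sum>\<^sub>\<infinity>k\<in>-{0}. exp (- s * l k))"
    if s: "Re s > 1" for s
  proof -
    have "1 * Re s \<le> m * Re s" using m s by (intro mult_right_mono) auto
    then have "1 < m * Re s" using s by linarith
    then have sD: "s \<in> D" and R1: "Re (n * s) > 1" and R2: "Re (n * s + 1) > 1"
      using s D by (simp_all add: n_def)
    have split: "exp (- s * l k) = exp (- (n * s) * b k) + s * Z1 * exp (- (n * s + 1) * b k) + Y k s"
      if k: "k \<noteq> 0" for k
    proof -
      have "exp (- s * l k) = exp (- (n * s) * b k) * exp (- s * w k)"
        unfolding exp_add[symmetric] w_def by (rule arg_cong[of _ _ exp]) (simp add: algebra_simps)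
      \<comment> \<open>The factor 1 / \<open>\<mu> k\<close> of the linear term is absorbed into
        the power, which raises ns to ns + 1.\<close>
      moreover have "exp (- (n * s + 1) * b k) = exp (- (n * s) * b k) / \<mu> k"
        unfolding exp_b[OF k, symmetric] exp_diff[symmetric]
        by (rule arg_cong[of _ _ exp]) (simp add: algebra_simps)
      ultimately show ?thesis by (simp add: Y_def algebra_simps)
    qed
    have npow_sums: "(\<lambda>i. exp (- t * b (int i + 1)) + exp (- t * b (- (int i + 1)))) sums A t"
      "summable (\<lambda>i. norm (exp (- t * b (int i + 1))))" "summable (\<lambda>i. norm (exp (- t * b (- (int i + 1)))))"
      if t: "Re t > 1" for t
    proof -
      show "summable (\<lambda>i. norm (exp (- t * b (int i + 1))))" unfolding bp by (rule npow_sum[OF t])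
      show "summable (\<lambda>i. norm (exp (- t * b (- (int i + 1)))))"
        unfolding bm norm_mult by (rule summable_mult[OF npow_sum[OF t]])
      have "(\<lambda>i. (1 + exp (- of_real pi * \<i> * t)) * npow t (lam i)) sums A t"
        unfolding As[OF t] by (rule sums_mult[OF summable_sums[OF summable_norm_cancel[OF npow_sum[OF t]]]])
      then show "(\<lambda>i. exp (- t * b (int i + 1)) + exp (- t * b (- (int i + 1)))) sums A t"
        unfolding bp bm by (simp only: distrib_right mult_1)
    qed
    have Ysum: "summable (\<lambda>i. norm (Y (k i) s))"
      if k: "\<And>i. k i = int i + 1 \<or> k i = - (int i + 1)" for k
    proof (rule summable_comparison_test_ev)
      show "summable (\<lambda>i. K (norm s) * (real (i + 1) / 2) powr (- m * 1 - 2))"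
        by (rule h_summable) (use m in simp)
      show "\<forall>\<^sub>F i in sequentially. norm (norm (Y (k i) s)) \<le> K (norm s) * (real (i + 1) / 2) powr (- m * 1 - 2)"
        using ev_big
      proof eventually_elim
        case (elim i)
        show ?case unfolding real_norm_def abs_norm_cancel
          by (rule Y_bound[OF k elim order_refl]) (use s m in auto)
      qed
    qed
    have sm: "summable (\<lambda>i. norm (exp (- s * l (k i))))"
      if k: "\<And>i. k i \<noteq> 0" and 1: "\<And>t. Re t > 1 \<Longrightarrow> summable (\<lambda>i. norm (exp (- t * b (k i))))"
        and 2: "summable (\<lambda>i. norm (Y (k i) s))" for k :: "nat \<Rightarrow> int"
    proof (rule summable_comparison_test')
      show "summable (\<lambda>i. norm (exp (- (n * s) * b (k i))) + norm (s * Z1) * norm (exp (- (n * s + 1) * b (k i))) + norm (Y (k i) s))"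
        by (intro summable_add summable_mult 1 R1 R2 2)
      show "norm (norm (exp (- s * l (k i)))) \<le> norm (exp (- (n * s) * b (k i)))
          + norm (s * Z1) * norm (exp (- (n * s + 1) * b (k i))) + norm (Y (k i) s)" for i
        unfolding real_norm_def abs_norm_cancel split[OF k] norm_mult[symmetric]
        by (intro order_trans[OF norm_triangle_ineq] add_mono norm_triangle_ineq order_refl)
    qed
    have smp: "summable (\<lambda>i. norm (exp (- s * l (int i + 1))))"
      by (rule sm[OF _ npow_sums(2) Ysum]) auto
    have smm: "summable (\<lambda>i. norm (exp (- s * l (- (int i + 1)))))"
      by (rule sm[OF _ npow_sums(3) Ysum]) auto
    have "(\<lambda>i. (exp (- (n * s) * b (int i + 1)) + exp (- (n * s) * b (- (int i + 1))))
        + s * Z1 * (exp (- (n * s + 1) * b (int i + 1)) + exp (- (n * s + 1) * b (- (int i + 1)))) + T i s) sums Z s"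
      unfolding Z_def by (intro sums_add sums_mult npow_sums(1) R1 R2 g(1) sD)
    moreover have "(exp (- (n * s) * b (int i + 1)) + exp (- (n * s) * b (- (int i + 1))))
        + s * Z1 * (exp (- (n * s + 1) * b (int i + 1)) + exp (- (n * s + 1) * b (- (int i + 1)))) + T i s
        = exp (- s * l (int i + 1)) + exp (- s * l (- (int i + 1)))" for i
    proof -
      have nz: "int i + 1 \<noteq> 0" "- (int i + 1) \<noteq> 0" by auto
      show ?thesis unfolding split[OF nz(1)] split[OF nz(2)] T_def by (simp only: distrib_left add_ac)
    qed
    ultimately have "(\<lambda>i. exp (- s * l (int i + 1)) + exp (- s * l (- (int i + 1)))) sums Z s" by (simp only:)
    then show ?thesis
      using infsum_int_nonzero[of "\<lambda>k. exp (- s * l k)", OF smp smm] by (simp only: sums_iff)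
  qed
  have cont: "zeta_continuation (- {0}) l D Z"
    unfolding zeta_continuation_def
  proof (intro conjI opD ballI allI impI)
    show "Z nicely_meromorphic_on D" by (rule analytic_on_imp_nicely_meromorphic_on[OF Z_an])
    show "s + complex_of_real t \<in> D" if "s \<in> D" "0 \<le> t" for s t using that by (simp add: D_def)
    have "s \<in> D" if "Re s > 1" for s
    proof -
      have "- 1 / m \<le> 0" using m by simp
      then have "- 1 / m < Re s" using that by linarith
      then show ?thesis unfolding D_def by blast
    qed
    then show "\<exists>\<sigma>. \<forall>s. \<sigma> < Re s \<longrightarrow> s \<in> D \<and> (\<lambda>k. norm (exp (- s * l k))) summable_on - {0} \<and>
        Z s = (\<Sum>\<^sub>\<infinity>k\<in>-{0}. exp (- s * l k))"
      using zeta by blast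
  qed
  \<comment> \<open>At s = 0 the terms with \<open>Z1\<close> cancel between k and -k.\<close>
  have T'0: "T' i 0 = - (w (int i + 1) + w (- (int i + 1)))" for i
    unfolding T'_def Y'_def \<mu>p \<mu>m by simp
  \<comment> \<open>Only the exponentials of the \<open>w k\<close> enter, so the arbitrary branches
    at small k leave no trace.\<close>
  have prod_lim: "(\<lambda>N. \<Prod>i<N. exp (- T' i 0)) \<longlonglongrightarrow> (\<Prod>j\<in>J. bessel_J_entire \<nu> (z j) / bessel_J_entire \<nu> 0)"
  proof -
    have "exp (- T' i 0) = (\<Prod>j\<in>J. 1 - (z j)\<^sup>2 / of_real ((lam i)\<^sup>2))" for i
    proof -
      have nz: "int i + 1 \<noteq> 0" "- (int i + 1) \<noteq> 0" by auto
      have l0: "complex_of_real (lam i) \<noteq> 0" using lam_pos[of i] by simp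
      have "exp (- T' i 0) = exp (w (int i + 1)) * exp (w (- (int i + 1)))"
        unfolding T'0 by (simp only: minus_minus exp_add)
      also have "\<dots> = (\<Prod>j\<in>J. (1 - z j / of_real (lam i)) * (1 - z j / - of_real (lam i)))"
        unfolding exp_w[OF nz(1)] exp_w[OF nz(2)] \<mu>p \<mu>m by (rule prod.distrib[symmetric])
      also have "\<dots> = (\<Prod>j\<in>J. 1 - (z j)\<^sup>2 / of_real ((lam i)\<^sup>2))"
        by (intro prod.cong refl) (use l0 in \<open>simp add: power2_eq_square field_simps\<close>)
      finally show ?thesis .
    qed
    then have "(\<lambda>N. \<Prod>i<N. exp (- T' i 0)) = (\<lambda>N. \<Prod>j\<in>J. \<Prod>i<N. 1 - (z j)\<^sup>2 / of_real ((lam i)\<^sup>2))"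
      by (simp add: prod.swap[of _ J])
    then show ?thesis by (simp only:) (intro tendsto_prod bessel_J_entire_product)
  qed
  have "(\<lambda>N. exp (- (\<Sum>i<N. T' i 0))) \<longlonglongrightarrow> exp (- g' 0)"
    using g(2)[OF in_D] by (intro tendsto_exp tendsto_minus) (simp add: sums_def)
  then have "(\<lambda>N. \<Prod>i<N. exp (- T' i 0)) \<longlonglongrightarrow> exp (- g' 0)"
    by (simp only: sum_negf[symmetric] exp_sum finite_lessThan)
  from LIMSEQ_unique[OF this prod_lim]
  have g'0: "exp (- g' 0) = (\<Prod>j\<in>J. bessel_J_entire \<nu> (z j) / bessel_J_entire \<nu> 0)" .
  have "deriv Z 0 = n * deriv A 0 + Z1 * (of_real pi * \<i>) + g' 0"
    using DERIV_imp_deriv[OF Z_deriv[OF in_D]] by (simp add: A1 mult.commute)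
  then have "exp (- deriv Z 0) = exp (n * - deriv A 0) * exp (\<Sum>j\<in>J. - (z j * (of_real pi * \<i>))) * exp (- g' 0)"
    unfolding exp_add[symmetric] by (simp add: Z1_def sum_negf sum_distrib_right)
  also have "exp (n * - deriv A 0) = (\<Prod>j\<in>J. exp (- deriv A 0))"
    using exp_of_nat_mult[of "card J" "- deriv A 0"] by (simp add: n_def m_def)
  also have "exp (\<Sum>j\<in>J. - (z j * (of_real pi * \<i>))) = (\<Prod>j\<in>J. exp (- (z j * (of_real pi * \<i>))))"
    using J by (simp add: exp_sum)
  also note g'0
  also have "(\<Prod>j\<in>J. exp (- deriv A 0)) * (\<Prod>j\<in>J. exp (- (z j * (of_real pi * \<i>))))
      * (\<Prod>j\<in>J. bessel_J_entire \<nu> (z j) / bessel_J_entire \<nu> 0)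
      = (\<Prod>j\<in>J. of_real (sqrt 2 * pi) * bessel_J_entire \<nu> (z j)
      * exp (- (of_real pi * \<i> / 2) * (of_real \<nu> + 1 / 2) - z j * finite_part (bessel_zeta_star \<nu>) 1))"
    unfolding prod.distrib[symmetric]
  proof (intro prod.cong refl)
    fix j
    have E: "bessel_J_entire \<nu> 0 \<noteq> 0" using E0 by simp
    have "exp (- (of_real pi * \<i> / 2) * (of_real \<nu> + 1 / 2) - z j * (of_real pi * \<i>))
        = exp (- (of_real pi * \<i> / 2) * (of_real \<nu> + 1 / 2)) * exp (- (z j * (of_real pi * \<i>)))"
      unfolding exp_add[symmetric] by simp
    then show "exp (- deriv A 0) * exp (- (z j * (of_real pi * \<i>))) * (bessel_J_entire \<nu> (z j) / bessel_J_entire \<nu> 0)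
        = of_real (sqrt 2 * pi) * bessel_J_entire \<nu> (z j)
          * exp (- (of_real pi * \<i> / 2) * (of_real \<nu> + 1 / 2) - z j * finite_part (bessel_zeta_star \<nu>) 1)"
      unfolding fp A0 using E by simp
  qed
  finally have val: "exp (- deriv Z 0) = (\<Prod>j\<in>J. of_real (sqrt 2 * pi) * bessel_J_entire \<nu> (z j)
      * exp (- (of_real pi * \<i> / 2) * (of_real \<nu> + 1 / 2) - z j * finite_part (bessel_zeta_star \<nu>) 1))" .
  have "Z analytic_on {0}" by (rule analytic_on_subset[OF Z_an]) (use in_D in simp)
  then show ?thesis using cont in_D val unfolding l_def by blast
qed

end

theorem corollary3p8:
  fixes \<nu> :: real and n :: nat and z :: "nat \<Rightarrow> complex" and L :: "nat \<Rightarrow> int \<Rightarrow> complex"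
  assumes "\<nu> \<ge> 1 / 2"
    and "n \<ge> 1"
    and "\<And>j k. j \<in> {1..n} \<Longrightarrow> k \<noteq> 0 \<Longrightarrow> z j \<noteq> of_real (bessel_zero \<nu> k / pi)"
    and "\<And>j. j \<in> {1..n} \<Longrightarrow> bessel_shift_log \<nu> (z j) (L j)"
  shows "zeta_regularizable (- {0})
           (\<lambda>k. \<Prod>j=1..n. (of_real (bessel_zero \<nu> k / pi) - z j)) (\<lambda>k. \<Sum>j=1..n. L j k)
       \<and> (\<forall>j\<in>{1..n}. zeta_regularizable (- {0})
             (\<lambda>k. of_real (bessel_zero \<nu> k / pi) - z j) (L j))
       \<and> zeta_reg_prod (- {0}) (\<lambda>k. \<Sum>j=1..n. L j k)
           = (\<Prod>j=1..n. zeta_reg_prod (- {0}) (L j))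
       \<and> (\<Prod>j=1..n. zeta_reg_prod (- {0}) (L j))
           = (\<Prod>j=1..n. of_real (sqrt 2 * pi) * bessel_J_entire \<nu> (z j)
                * exp (- (of_real pi * \<i> / 2) * (of_real \<nu> + 1 / 2)
                       - z j * finite_part (bessel_zeta_star \<nu>) 1))"
proof -
  interpret bessel \<nu> by unfold_locales (rule assms(1))
  let ?R = "\<lambda>j. of_real (sqrt 2 * pi) * bessel_J_entire \<nu> (z j)
    * exp (- (of_real pi * \<i> / 2) * (of_real \<nu> + 1 / 2) - z j * finite_part (bessel_zeta_star \<nu>) 1)"
  have main: "zeta_regularizable (- {0}) (\<lambda>k. \<Prod>j\<in>J. (of_real (bessel_zero \<nu> k / pi) - z j)) (\<lambda>k. \<Sum>j\<in>J. L j k)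
      \<and> zeta_reg_prod (- {0}) (\<lambda>k. \<Sum>j\<in>J. L j k) = (\<Prod>j\<in>J. ?R j)"
    if J: "J \<noteq> {}" "J \<subseteq> {1..n}" for J
  proof -
    have fin: "finite J" using J finite_subset by blast
    have sh: "bessel_shift_log \<nu> (z j) (L j)" if "j \<in> J" for j using assms(4) J that by blast
    obtain D Z where DZ: "zeta_continuation (- {0}) (\<lambda>k. \<Sum>j\<in>J. L j k) D Z" "0 \<in> D" "Z analytic_on {0}"
      "exp (- deriv Z 0) = (\<Prod>j\<in>J. ?R j)"
      using shifted_zeta[OF fin J(1), of z L] sh by blast
    have "exp (\<Sum>j\<in>J. L j k) = (\<Prod>j\<in>J. (of_real (bessel_zero \<nu> k / pi) - z j))" if "k \<noteq> 0" for k
      using sh that fin by (simp add: exp_sum bessel_shift_log_def bessel_lam_def)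
    then show ?thesis using DZ zeta_reg_prod_eq[OF DZ(1,2)]
      unfolding zeta_regularizable_def by auto
  qed
  have single: "zeta_regularizable (- {0}) (\<lambda>k. of_real (bessel_zero \<nu> k / pi) - z j) (L j)
      \<and> zeta_reg_prod (- {0}) (L j) = ?R j" if "j \<in> {1..n}" for j
    using main[of "{j}"] that by simp
  have "{1..n} \<noteq> {}" using assms(2) by simp
  from main[OF this order_refl] single show ?thesis by simp
qed

end
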